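(* Let $\mathbb{K}$ be a field of characteristic zero, let $\mathcal{P}=\mathcal{P}(E,R)=\mathcal{F}(E)/(R)$ be a binary quadratic operad whose generating space $E=\mathcal{P}(2)$ is homogeneous of degree zero (or even), and let $(A,d)$ be a differential graded $\mathcal{P}$-algebra with differential of degree $|d|=+1$ (or odd). For each multiplication $[\cdot,\cdot]\in E$ define the derived brackets on the shifted space $sA$ by $$[sx_1,sx_2]_{d}:=-(-1)^{|x_1|}s[dx_1,x_2],\qquad [sx_1,sx_2]^{d}:=s[x_1,dx_2]\qquad (x_1,x_2\in A).$$ Then $sA$ with the derived brackets is a $(\mathcal{P}erm\circ\mathcal{P})$-algebra, where $\circ$ is the Manin white product. Explicitly, there is an operad morphism $\mathcal{P}erm\circ\mathcal{P}\to\mathcal{E}nd(sA)$ which on the generating space $\mathcal{P}erm(2)\otimes E$ is given by $e^2_2\otimes[\cdot,\cdot]\mapsto[\cdot,\cdot]_d$ and $e^2_1\otimes[\cdot,\cdot]\mapsto[\cdot,\cdot]^d$ for all $[\cdot,\cdot]\in E$.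
   Context: The Koszul sign convention is used throughout. Operads are symmetric operads $\{\mathcal{P}(n)\}_{n\ge 1}$ in graded $\mathbb{K}$-vector spaces, with partial compositions $\circ_i$. $\mathcal{E}nd(V)(n)=\mathrm{Hom}(V^{\otimes n},V)$ is the endomorphism operad, with $S_n$-action $f\sigma(x_1,\dots,x_n)=\epsilon(\sigma)f(x_{\sigma^{-1}(1)},\dots,x_{\sigma^{-1}(n)})$, $\epsilon(\sigma)$ the Koszul sign. A $\mathcal{P}$-algebra structure on $V$ is an operad morphism $\mathcal{P}\to\mathcal{E}nd(V)$. Binary quadratic operad: $E$ is an $S_2$-module placed in arity 2, $\mathcal{F}(E)$ is the free operad on it, $R\subset\mathcal{F}(E)(3)$ is an $S_3$-stable subspace, $(R)$ is the operadic ideal generated by $R$, and $\mathcal{P}(E,R):=\mathcal{F}(E)/(R)$. Differential graded $\mathcal{P}$-algebra $(A,d)$: a graded $\mathcal{P}$-algebra $A$ with a linear map $d$, $d^2=0$, which is a derivation of every multiplication in $E$: $d[x,y]=[dx,y]+(-1)^{|x|}[x,dy]$. The operator $s$ is the degree shift of degree $+1$, so $|sx|=|x|+1$. When "even/odd" is used instead of degrees $0$ and $+1$, gradings are read modulo 2. $\mathcal{P}erm$ is the operad of (left) permutation algebras: associative algebras $(C,* )$ with $(x*y)*z=(-1)^{|x||y|}(y*x)*z$. $\mathcal{P}erm(n)$ has basis $e^n_1,\dots,e^n_n$, where $e^n_j$ is the monomial $(x_{i_1}*\cdots*x_{i_{n-1}})*x_j$ whose rightmost entry is $x_j$ (so $e^2_2=x_1*x_2$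 and $e^2_1=x_2*x_1$). Manin white product: for $\mathcal{P}_i=\mathcal{P}(E_i,R_i)$, $i=1,2$, let $\Phi:\mathcal{F}(E_1\otimes E_2)\to\mathcal{F}(E_1)\otimes\mathcal{F}(E_2)$ be the unique operad morphism extending the identity of $E_1\otimes E_2$ (the target is the aritywise tensor product operad). Then $\mathcal{P}_1\circ\mathcal{P}_2$ is the quotient of $\mathcal{F}(E_1\otimes E_2)$ by the operadic ideal generated by $\Phi^{-1}\big(R_1\otimes\mathcal{F}(E_2)(3)+\mathcal{F}(E_1)(3)\otimes R_2\big)\subset\mathcal{F}(E_1\otimes E_2)(3)$. *)

theory Defs
  imports Complex_Main "HOL-Library.Poly_Mapping" "HOL-Combinatorics.Permutations"
begin

section \<open>Vector spaces on explicit carriers\<close>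

text \<open>
  Quotients and tensor products below depend on terms (a generating module, a space of relations),
  so they cannot be types; vector spaces are therefore records with a carrier set.  The ground
  field is a type of class \<^class>\<open>field\<close>.
\<close>

record ('k, 'v) vs =
  carr :: "'v set"
  vzero :: 'v
  vadd :: "'v \<Rightarrow> 'v \<Rightarrow> 'v"
  vsmul :: "'k \<Rightarrow> 'v \<Rightarrow> 'v"

locale vspace =
  fixes V :: "('k::field, 'v, 'z) vs_scheme" (structure)
  assumes zero_closed: "vzero V \<in> carr V"
    and add_closed: "\<lbrakk>x \<in> carr V; y \<in> carr V\<rbrakk> \<Longrightarrow> vadd V x y \<in> carr V"
    and smul_closed: "x \<in> carr V \<Longrightarrow> vsmul V c x \<in> carr V"
    and add_assoc: "\<lbrakk>x \<in> carr V; y \<in> carr V; z \<in> carr V\<rbrakk>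
          \<Longrightarrow> vadd V (vadd V x y) z = vadd V x (vadd V y z)"
    and add_commute: "\<lbrakk>x \<in> carr V; y \<in> carr V\<rbrakk> \<Longrightarrow> vadd V x y = vadd V y x"
    and add_zero: "x \<in> carr V \<Longrightarrow> vadd V (vzero V) x = x"
    and add_inverse: "x \<in> carr V \<Longrightarrow> vadd V x (vsmul V (- 1) x) = vzero V"
    and smul_add_right: "\<lbrakk>x \<in> carr V; y \<in> carr V\<rbrakk>
          \<Longrightarrow> vsmul V c (vadd V x y) = vadd V (vsmul V c x) (vsmul V c y)"
    and smul_add_left: "x \<in> carr V \<Longrightarrow> vsmul V (b + c) x = vadd V (vsmul V b x) (vsmul V c x)"
    and smul_smul: "x \<in> carr V \<Longrightarrow> vsmul V b (vsmul V c x) = vsmul V (b * c) x"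
    and smul_one: "x \<in> carr V \<Longrightarrow> vsmul V 1 x = x"

definition vsubspace :: "('k, 'v, 'z) vs_scheme \<Rightarrow> 'v set \<Rightarrow> bool" where
  "vsubspace V U \<longleftrightarrow> U \<subseteq> carr V \<and> vzero V \<in> U \<and> (\<forall>x\<in>U. \<forall>y\<in>U. vadd V x y \<in> U) \<and>
     (\<forall>c. \<forall>x\<in>U. vsmul V c x \<in> U)"

definition vspan :: "('k, 'v, 'z) vs_scheme \<Rightarrow> 'v set \<Rightarrow> 'v set" where
  "vspan V X = \<Inter> {U. vsubspace V U \<and> X \<subseteq> U}"

definition vlinear ::
  "('k, 'v, 'y) vs_scheme \<Rightarrow> ('k, 'w, 'z) vs_scheme \<Rightarrow> ('v \<Rightarrow> 'w) \<Rightarrow> bool" where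
  "vlinear V W f \<longleftrightarrow> (\<forall>x\<in>carr V. f x \<in> carr W) \<and>
     (\<forall>x\<in>carr V. \<forall>y\<in>carr V. f (vadd V x y) = vadd W (f x) (f y)) \<and>
     (\<forall>c. \<forall>x\<in>carr V. f (vsmul V c x) = vsmul W c (f x))"

definition vcoset :: "('k, 'v, 'z) vs_scheme \<Rightarrow> 'v set \<Rightarrow> 'v \<Rightarrow> 'v set" where
  "vcoset V U x = {vadd V x u | u. u \<in> U}"

definition vquot :: "('k, 'v, 'z) vs_scheme \<Rightarrow> 'v set \<Rightarrow> ('k, 'v set) vs" where
  "vquot V U = \<lparr> carr = vcoset V U ` carr V, vzero = U,
     vadd = (\<lambda>X Y. \<Union>x\<in>X. \<Union>y\<in>Y. vcoset V U (vadd V x y)),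
     vsmul = (\<lambda>c X. \<Union>x\<in>X. vcoset V U (vsmul V c x)) \<rparr>"

text \<open>The free vector space on a set \<open>X\<close>, with basis \<^term>\<open>Poly_Mapping.single x 1\<close> for \<open>x \<in> X\<close>.\<close>

definition free_vs :: "'x set \<Rightarrow> ('k::field, 'x \<Rightarrow>\<^sub>0 'k) vs" where
  "free_vs X = \<lparr> carr = {p. Poly_Mapping.keys p \<subseteq> X}, vzero = 0, vadd = (+),
     vsmul = (\<lambda>c. Poly_Mapping.map ((*) c)) \<rparr>"

abbreviation basis :: "'x \<Rightarrow> ('x \<Rightarrow>\<^sub>0 'k::field)" where
  "basis x \<equiv> Poly_Mapping.single x 1"

definition lin_ext :: "('x \<Rightarrow> 'y) \<Rightarrow> ('x \<Rightarrow>\<^sub>0 'k) \<Rightarrow> ('y \<Rightarrow>\<^sub>0 'k::field)" where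
  "lin_ext h p = (\<Sum>x\<in>Poly_Mapping.keys p. Poly_Mapping.single (h x) (Poly_Mapping.lookup p x))"

definition bilin_ext ::
  "('x \<Rightarrow> 'y \<Rightarrow> 'z) \<Rightarrow> ('x \<Rightarrow>\<^sub>0 'k) \<Rightarrow> ('y \<Rightarrow>\<^sub>0 'k) \<Rightarrow> ('z \<Rightarrow>\<^sub>0 'k::field)" where
  "bilin_ext h p q = (\<Sum>x\<in>Poly_Mapping.keys p. \<Sum>y\<in>Poly_Mapping.keys q.
     Poly_Mapping.single (h x y) (Poly_Mapping.lookup p x * Poly_Mapping.lookup q y))"

definition bilinear_relators ::
  "('k::field, 'v, 'y) vs_scheme \<Rightarrow> ('k, 'w, 'z) vs_scheme \<Rightarrow> ('v \<times> 'w \<Rightarrow>\<^sub>0 'k) set" where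
  "bilinear_relators V W =
     {basis (vadd V v v', w) - basis (v, w) - basis (v', w) | v v' w.
        v \<in> carr V \<and> v' \<in> carr V \<and> w \<in> carr W} \<union>
     {basis (v, vadd W w w') - basis (v, w) - basis (v, w') | v w w'.
        v \<in> carr V \<and> w \<in> carr W \<and> w' \<in> carr W} \<union>
     {basis (vsmul V c v, w) - Poly_Mapping.single (v, w) c | c v w. v \<in> carr V \<and> w \<in> carr W} \<union>
     {basis (v, vsmul W c w) - Poly_Mapping.single (v, w) c | c v w. v \<in> carr V \<and> w \<in> carr W}"

definition tensor_null ::
  "('k::field, 'v, 'y) vs_scheme \<Rightarrow> ('k, 'w, 'z) vs_scheme \<Rightarrow> ('v \<times> 'w \<Rightarrow>\<^sub>0 'k) set" where
  "tensor_null V W = vspan (free_vs (carr V \<times> carr W)) (bilinear_relators V W)"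

definition vtensor ::
  "('k::field, 'v, 'y) vs_scheme \<Rightarrow> ('k, 'w, 'z) vs_scheme \<Rightarrow> ('k, ('v \<times> 'w \<Rightarrow>\<^sub>0 'k) set) vs" where
  "vtensor V W = vquot (free_vs (carr V \<times> carr W)) (tensor_null V W)"

definition tens ::
  "('k::field, 'v, 'y) vs_scheme \<Rightarrow> ('k, 'w, 'z) vs_scheme \<Rightarrow> 'v \<Rightarrow> 'w \<Rightarrow> ('v \<times> 'w \<Rightarrow>\<^sub>0 'k) set" where
  "tens V W v w = vcoset (free_vs (carr V \<times> carr W)) (tensor_null V W) (basis (v, w))"


section \<open>\<open>S\<^sub>2\<close>-modules\<close>

text \<open>The field \<open>swp\<close> is the action of the transposition.\<close>

record ('k, 'v) s2mod = "('k, 'v) vs" +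
  swp :: "'v \<Rightarrow> 'v"

locale s2_module = vspace E for E :: "('k::field, 'v, 'z) s2mod_scheme" (structure) +
  assumes swp_linear: "vlinear E E (swp E)"
    and swp_swp: "x \<in> carr E \<Longrightarrow> swp E (swp E x) = x"

definition s2_tensor ::
  "('k::field, 'v, 'y) s2mod_scheme \<Rightarrow> ('k, 'w, 'z) s2mod_scheme \<Rightarrow>
     ('k, ('v \<times> 'w \<Rightarrow>\<^sub>0 'k) set) s2mod" where
  "s2_tensor E1 E2 = vs.extend (vtensor E1 E2) (s2mod.fields
     (\<lambda>X. \<Union>p\<in>X. vcoset (free_vs (carr E1 \<times> carr E2)) (tensor_null E1 E2)
        (lin_ext (map_prod (swp E1) (swp E2)) p)))"


section \<open>Operads\<close>

text \<open>
  The data of a symmetric operad with partial compositions.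
  \<^item> \<open>opsp P n\<close> is the space of arity \<open>n\<close>; only \<open>n \<ge> 1\<close> matters.
  \<^item> \<open>ocomp P m n i f g\<close> is \<open>f \<circ>\<^sub>i g\<close> for \<open>f\<close> of arity \<open>m\<close>, \<open>g\<close> of arity \<open>n\<close> and \<open>1 \<le> i \<le> m\<close>.
  \<^item> \<open>oact P n f \<sigma>\<close> is the right action of a permutation \<open>\<sigma>\<close> of \<open>{1..n}\<close>.

  A plain \<open>operad\<close> is a graded operad concentrated in degree zero.  A \<open>graded_operad\<close> also carries
  the subspaces \<open>ohom P n g\<close> of elements of arity \<open>n\<close> and degree \<open>g\<close>.
\<close>

record ('k, 'p) operad =
  opsp :: "nat \<Rightarrow> ('k, 'p) vs"
  ounit :: 'p
  ocomp :: "nat \<Rightarrow> nat \<Rightarrow> nat \<Rightarrow> 'p \<Rightarrow> 'p \<Rightarrow> 'p"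
  oact :: "nat \<Rightarrow> 'p \<Rightarrow> (nat \<Rightarrow> nat) \<Rightarrow> 'p"

record ('k, 'p, 'g) graded_operad = "('k, 'p) operad" +
  ohom :: "nat \<Rightarrow> 'g \<Rightarrow> 'p set"

definition operad_hom ::
  "('k, 'p, 'y) operad_scheme \<Rightarrow> ('k, 'q, 'z) operad_scheme \<Rightarrow> (nat \<Rightarrow> 'p \<Rightarrow> 'q) \<Rightarrow> bool" where
  "operad_hom P Q \<phi> \<longleftrightarrow>
     (\<forall>n\<ge>1. vlinear (opsp P n) (opsp Q n) (\<phi> n)) \<and>
     \<phi> 1 (ounit P) = ounit Q \<and>
     (\<forall>m\<ge>1. \<forall>n\<ge>1. \<forall>i\<in>{1..m}. \<forall>f\<in>carr (opsp P m). \<forall>g\<in>carr (opsp P n).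
        \<phi> (m + n - 1) (ocomp P m n i f g) = ocomp Q m n i (\<phi> m f) (\<phi> n g)) \<and>
     (\<forall>n\<ge>1. \<forall>\<sigma>. \<sigma> permutes {1..n} \<longrightarrow>
        (\<forall>f\<in>carr (opsp P n). \<phi> n (oact P n f \<sigma>) = oact Q n (\<phi> n f) \<sigma>))"

definition operadic_ideal :: "('k, 'p, 'z) operad_scheme \<Rightarrow> (nat \<Rightarrow> 'p set) \<Rightarrow> bool" where
  "operadic_ideal P I \<longleftrightarrow>
     (\<forall>n\<ge>1. vsubspace (opsp P n) (I n)) \<and>
     (\<forall>m\<ge>1. \<forall>n\<ge>1. \<forall>i\<in>{1..m}. \<forall>f\<in>carr (opsp P m). \<forall>g\<in>carr (opsp P n).
        f \<in> I m \<or> g \<in> I n \<longrightarrow> ocomp P m n i f g \<in> I (m + n - 1)) \<and>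
     (\<forall>n\<ge>1. \<forall>\<sigma>. \<sigma> permutes {1..n} \<longrightarrow> (\<forall>f\<in>I n. oact P n f \<sigma> \<in> I n))"

text \<open>The ideal generated by a set \<open>R\<close> of elements of arity \<open>k\<close>.\<close>

definition gen_ideal :: "('k, 'p, 'z) operad_scheme \<Rightarrow> nat \<Rightarrow> 'p set \<Rightarrow> nat \<Rightarrow> 'p set" where
  "gen_ideal P k R n = \<Inter> {I n | I. operadic_ideal P I \<and> R \<subseteq> I k}"

definition quot_operad ::
  "('k, 'p, 'z) operad_scheme \<Rightarrow> (nat \<Rightarrow> 'p set) \<Rightarrow> ('k, 'p set) operad" where
  "quot_operad P I = \<lparr>
     opsp = (\<lambda>n. vquot (opsp P n) (I n)),
     ounit = vcoset (opsp P 1) (I 1) (ounit P),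
     ocomp = (\<lambda>m n i X Y. \<Union>f\<in>X. \<Union>g\<in>Y.
        vcoset (opsp P (m + n - 1)) (I (m + n - 1)) (ocomp P m n i f g)),
     oact = (\<lambda>n X \<sigma>. \<Union>f\<in>X. vcoset (opsp P n) (I n) (oact P n f \<sigma>)) \<rparr>"

text \<open>
  The aritywise tensor product.  For operads concentrated in degree zero there is no Koszul sign in
  \<open>(f \<otimes> f') \<circ>\<^sub>i (g \<otimes> g') = (f \<circ>\<^sub>i g) \<otimes> (f' \<circ>\<^sub>i g')\<close>.
\<close>

definition pair_operad ::
  "('k::field, 'p, 'y) operad_scheme \<Rightarrow> ('k, 'q, 'z) operad_scheme \<Rightarrow> ('k, 'p \<times> 'q \<Rightarrow>\<^sub>0 'k) operad" where
  "pair_operad P Q = \<lparr>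
     opsp = (\<lambda>n. free_vs (carr (opsp P n) \<times> carr (opsp Q n))),
     ounit = basis (ounit P, ounit Q),
     ocomp = (\<lambda>m n i. bilin_ext (\<lambda>(f, f') (g, g'). (ocomp P m n i f g, ocomp Q m n i f' g'))),
     oact = (\<lambda>n p \<sigma>. lin_ext (\<lambda>(f, f'). (oact P n f \<sigma>, oact Q n f' \<sigma>)) p) \<rparr>"

definition tensor_operad ::
  "('k::field, 'p, 'y) operad_scheme \<Rightarrow> ('k, 'q, 'z) operad_scheme \<Rightarrow>
     ('k, ('p \<times> 'q \<Rightarrow>\<^sub>0 'k) set) operad" where
  "tensor_operad P Q = quot_operad (pair_operad P Q) (\<lambda>n. tensor_null (opsp P n) (opsp Q n))"


section \<open>The free operad on an \<open>S\<^sub>2\<close>-module placed in arity 2\<close>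

text \<open>
  \<open>Lf j\<close> stands for the variable \<open>x\<^sub>j\<close> and \<open>Nd e l r\<close> for \<open>e(l, r)\<close>.  A tree monomial of arity \<open>n\<close>
  uses each of \<open>x\<^sub>1, \<dots>, x\<^sub>n\<close> exactly once.
\<close>

datatype 'e btree = Lf nat | Nd 'e "'e btree" "'e btree"

primrec leaves :: "'e btree \<Rightarrow> nat list" where
  "leaves (Lf j) = [j]"
| "leaves (Nd e l r) = leaves l @ leaves r"

definition trees :: "('k, 'e, 'z) vs_scheme \<Rightarrow> nat \<Rightarrow> 'e btree set" where
  "trees E n = {t. distinct (leaves t) \<and> set (leaves t) = {1..n} \<and> set_btree t \<subseteq> carr E}"

text \<open>Replace each leaf \<open>j\<close> by the tree \<open>\<rho> j\<close>.\<close>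

primrec graft :: "(nat \<Rightarrow> 'e btree) \<Rightarrow> 'e btree \<Rightarrow> 'e btree" where
  "graft \<rho> (Lf j) = \<rho> j"
| "graft \<rho> (Nd e l r) = Nd e (graft \<rho> l) (graft \<rho> r)"

definition tree_comp :: "nat \<Rightarrow> nat \<Rightarrow> 'e btree \<Rightarrow> 'e btree \<Rightarrow> 'e btree" where
  "tree_comp n i S T = graft (\<lambda>k. if k < i then Lf k
     else if k = i then graft (\<lambda>j. Lf (j + i - 1)) T else Lf (k + n - 1)) S"

text \<open>
  In line with \<open>(f\<sigma>)(x\<^sub>1, \<dots>, x\<^sub>n) = f(x\<^bsub>\<sigma>\<^sup>-\<^sup>1(1)\<^esub>, \<dots>, x\<^bsub>\<sigma>\<^sup>-\<^sup>1(n)\<^esub>)\<close>, the permutation \<open>\<sigma>\<close> acts by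
  replacing the variable \<open>x\<^sub>k\<close> by \<open>x\<^bsub>\<sigma>\<^sup>-\<^sup>1(k)\<^esub>\<close>.
\<close>

definition tree_operad :: "('k::field, 'e, 'z) vs_scheme \<Rightarrow> ('k, 'e btree \<Rightarrow>\<^sub>0 'k) operad" where
  "tree_operad E = \<lparr>
     opsp = (\<lambda>n. free_vs (trees E n)),
     ounit = basis (Lf 1),
     ocomp = (\<lambda>m n i. bilin_ext (tree_comp n i)),
     oact = (\<lambda>n p \<sigma>. lin_ext (graft (\<lambda>k. Lf (inv \<sigma> k))) p) \<rparr>"

text \<open>
  The relators make a tree linear in the label of each node and impose \<open>(e\<tau>)(l, r) = e(r, l)\<close> for the
  transposition \<open>\<tau>\<close>.  There is no Koszul sign, because \<open>E\<close> sits in degree zero.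
\<close>

inductive_set tree_relators :: "('k::field, 'e, 'z) s2mod_scheme \<Rightarrow> ('e btree \<Rightarrow>\<^sub>0 'k) set"
  for E :: "('k::field, 'e, 'z) s2mod_scheme" where
  rel_add: "\<lbrakk>e \<in> carr E; e' \<in> carr E\<rbrakk> \<Longrightarrow>
     basis (Nd (vadd E e e') l r) - basis (Nd e l r) - basis (Nd e' l r) \<in> tree_relators E"
| rel_smul: "e \<in> carr E \<Longrightarrow>
     basis (Nd (vsmul E c e) l r) - Poly_Mapping.single (Nd e l r) c \<in> tree_relators E"
| rel_swp: "e \<in> carr E \<Longrightarrow> basis (Nd (swp E e) l r) - basis (Nd e r l) \<in> tree_relators E"
| rel_left: "p \<in> tree_relators E \<Longrightarrow> lin_ext (\<lambda>l. Nd e l r) p \<in> tree_relators E"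
| rel_right: "p \<in> tree_relators E \<Longrightarrow> lin_ext (\<lambda>r. Nd e l r) p \<in> tree_relators E"

definition free_null :: "('k::field, 'e, 'z) s2mod_scheme \<Rightarrow> nat \<Rightarrow> ('e btree \<Rightarrow>\<^sub>0 'k) set" where
  "free_null E n = vspan (free_vs (trees E n)) (tree_relators E \<inter> carr (free_vs (trees E n)))"

definition free_operad :: "('k::field, 'e, 'z) s2mod_scheme \<Rightarrow> ('k, ('e btree \<Rightarrow>\<^sub>0 'k) set) operad" where
  "free_operad E = quot_operad (tree_operad E) (free_null E)"

definition free_class ::
  "('k::field, 'e, 'z) s2mod_scheme \<Rightarrow> nat \<Rightarrow> ('e btree \<Rightarrow>\<^sub>0 'k) \<Rightarrow> ('e btree \<Rightarrow>\<^sub>0 'k) set" where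
  "free_class E n p = vcoset (free_vs (trees E n)) (free_null E n) p"

text \<open>The inclusion of \<open>E\<close> as the arity 2 part.\<close>

definition free_gen :: "('k::field, 'e, 'z) s2mod_scheme \<Rightarrow> 'e \<Rightarrow> ('e btree \<Rightarrow>\<^sub>0 'k) set" where
  "free_gen E e = free_class E 2 (basis (Nd e (Lf 1) (Lf 2)))"


section \<open>Binary quadratic operads and the Manin white product\<close>

definition quadratic_relations ::
  "('k::field, 'e, 'z) s2mod_scheme \<Rightarrow> ('e btree \<Rightarrow>\<^sub>0 'k) set set \<Rightarrow> bool" where
  "quadratic_relations E R \<longleftrightarrow> vsubspace (opsp (free_operad E) 3) R \<and>
     (\<forall>\<sigma>. \<sigma> permutes {1..3} \<longrightarrow> (\<forall>x\<in>R. oact (free_operad E) 3 x \<sigma> \<in> R))"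

definition bq_operad ::
  "('k::field, 'e, 'z) s2mod_scheme \<Rightarrow> ('e btree \<Rightarrow>\<^sub>0 'k) set set \<Rightarrow>
     ('k, ('e btree \<Rightarrow>\<^sub>0 'k) set set) operad" where
  "bq_operad E R = quot_operad (free_operad E) (gen_ideal (free_operad E) 3 R)"

text \<open>The element of \<open>\<P>(E,R)(2)\<close> given by an element of \<open>E\<close>.\<close>

definition bq_gen ::
  "('k::field, 'e, 'z) s2mod_scheme \<Rightarrow> ('e btree \<Rightarrow>\<^sub>0 'k) set set \<Rightarrow> 'e \<Rightarrow>
     ('e btree \<Rightarrow>\<^sub>0 'k) set set" where
  "bq_gen E R e = vcoset (opsp (free_operad E) 2) (gen_ideal (free_operad E) 3 R 2) (free_gen E e)"

text \<open>
  The operad morphism \<open>\<F>(E\<^sub>1 \<otimes> E\<^sub>2) \<rightarrow> \<F>(E\<^sub>1) \<otimes> \<F>(E\<^sub>2)\<close> extending the identity of \<open>E\<^sub>1 \<otimes> E\<^sub>2\<close>.  It is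
  unique, but only on the spaces of arity \<open>n \<ge> 1\<close>: its values as a HOL function elsewhere are
  arbitrary, hence \<open>SOME\<close>.
\<close>

definition manin_map ::
  "('k::field, 'e, 'y) s2mod_scheme \<Rightarrow> ('k, 'f, 'z) s2mod_scheme \<Rightarrow> nat \<Rightarrow>
     (('e \<times> 'f \<Rightarrow>\<^sub>0 'k) set btree \<Rightarrow>\<^sub>0 'k) set \<Rightarrow>
     (('e btree \<Rightarrow>\<^sub>0 'k) set \<times> ('f btree \<Rightarrow>\<^sub>0 'k) set \<Rightarrow>\<^sub>0 'k) set" where
  "manin_map E1 E2 = (SOME \<Phi>.
     operad_hom (free_operad (s2_tensor E1 E2)) (tensor_operad (free_operad E1) (free_operad E2)) \<Phi> \<and>
     (\<forall>e1\<in>carr E1. \<forall>e2\<in>carr E2.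
        \<Phi> 2 (free_gen (s2_tensor E1 E2) (tens E1 E2 e1 e2)) =
        tens (opsp (free_operad E1) 2) (opsp (free_operad E2) 2) (free_gen E1 e1) (free_gen E2 e2)))"

definition white_relations ::
  "('k::field, 'e, 'y) s2mod_scheme \<Rightarrow> ('e btree \<Rightarrow>\<^sub>0 'k) set set \<Rightarrow>
     ('k, 'f, 'z) s2mod_scheme \<Rightarrow> ('f btree \<Rightarrow>\<^sub>0 'k) set set \<Rightarrow>
     (('e \<times> 'f \<Rightarrow>\<^sub>0 'k) set btree \<Rightarrow>\<^sub>0 'k) set set" where
  "white_relations E1 R1 E2 R2 =
     (let F1 = opsp (free_operad E1) 3; F2 = opsp (free_operad E2) 3
      in {x \<in> carr (opsp (free_operad (s2_tensor E1 E2)) 3).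
            manin_map E1 E2 3 x \<in> vspan (vtensor F1 F2)
              ({tens F1 F2 r f | r f. r \<in> R1 \<and> f \<in> carr F2} \<union>
               {tens F1 F2 f r | f r. f \<in> carr F1 \<and> r \<in> R2})})"

definition white_product ::
  "('k::field, 'e, 'y) s2mod_scheme \<Rightarrow> ('e btree \<Rightarrow>\<^sub>0 'k) set set \<Rightarrow>
     ('k, 'f, 'z) s2mod_scheme \<Rightarrow> ('f btree \<Rightarrow>\<^sub>0 'k) set set \<Rightarrow>
     ('k, (('e \<times> 'f \<Rightarrow>\<^sub>0 'k) set btree \<Rightarrow>\<^sub>0 'k) set set) operad" where
  "white_product E1 R1 E2 R2 = bq_operad (s2_tensor E1 E2) (white_relations E1 R1 E2 R2)"

text \<open>The class of \<open>e\<^sub>1 \<otimes> e\<^sub>2\<close> in arity 2.\<close>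

definition white_gen ::
  "('k::field, 'e, 'y) s2mod_scheme \<Rightarrow> ('e btree \<Rightarrow>\<^sub>0 'k) set set \<Rightarrow>
     ('k, 'f, 'z) s2mod_scheme \<Rightarrow> ('f btree \<Rightarrow>\<^sub>0 'k) set set \<Rightarrow> 'e \<Rightarrow> 'f \<Rightarrow>
     (('e \<times> 'f \<Rightarrow>\<^sub>0 'k) set btree \<Rightarrow>\<^sub>0 'k) set set" where
  "white_gen E1 R1 E2 R2 e1 e2 =
     bq_gen (s2_tensor E1 E2) (white_relations E1 R1 E2 R2) (tens E1 E2 e1 e2)"


section \<open>The operad of permutation algebras\<close>

text \<open>
  \<open>\<P>erm(2)\<close> has basis \<open>e\<^sup>2\<^sub>1 = x\<^sub>2 * x\<^sub>1\<close> and \<open>e\<^sup>2\<^sub>2 = x\<^sub>1 * x\<^sub>2\<close>, exchanged by the transposition.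
  The relations are \<open>(x\<^sub>1 * x\<^sub>2) * x\<^sub>3 = x\<^sub>1 * (x\<^sub>2 * x\<^sub>3)\<close> and \<open>(x\<^sub>1 * x\<^sub>2) * x\<^sub>3 = (x\<^sub>2 * x\<^sub>1) * x\<^sub>3\<close>; the
  sign in \<open>(x * y) * z = (-1)\<^bsup>|x||y|\<^esup> (y * x) * z\<close> comes from the action on the endomorphism operad.
\<close>

definition perm_E :: "('k::field, nat \<Rightarrow>\<^sub>0 'k) s2mod" where
  "perm_E = vs.extend (free_vs {1, 2}) (s2mod.fields (lin_ext (transpose 1 2)))"

definition perm_e :: "nat \<Rightarrow> (nat \<Rightarrow>\<^sub>0 'k::field)" where
  "perm_e j = basis j"

definition perm_R :: "((nat \<Rightarrow>\<^sub>0 'k) btree \<Rightarrow>\<^sub>0 'k::field) set set" where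
  "perm_R =
     (let F = free_operad perm_E; m = Nd (perm_e 2); x = Lf 1; y = Lf 2; z = Lf 3;
          assoc = free_class perm_E 3 (basis (m (m x y) z) - basis (m x (m y z)));
          comm = free_class perm_E 3 (basis (m (m x y) z) - basis (m (m y x) z))
      in vspan (opsp F 3) {oact F 3 r \<sigma> | r \<sigma>. r \<in> {assoc, comm} \<and> \<sigma> permutes {1..3}})"


section \<open>Graded vector spaces and their endomorphism operads\<close>

text \<open>
  Degrees live in a ring of class \<^class>\<open>ring_parity\<close>, of which only the additive group, \<open>1\<close> and the
  notion of odd elements are used.  The type \<^typ>\<open>int\<close> gives \<open>\<int>\<close>-gradings; the two-element field
  \<open>bit\<close> of \<open>HOL-Library.Z2\<close> is also of this class and gives gradings modulo 2, with \<open>0\<close> for even and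
  \<open>1\<close> for odd.
\<close>

definition homogeneous_decomposition ::
  "('g \<Rightarrow> 'v set) \<Rightarrow> 'v \<Rightarrow> ('g \<Rightarrow> 'v::ab_group_add) \<Rightarrow> bool" where
  "homogeneous_decomposition gr x c \<longleftrightarrow>
     (\<forall>g. c g \<in> gr g) \<and> finite {g. c g \<noteq> 0} \<and> (\<Sum>g | c g \<noteq> 0. c g) = x"

locale graded_space = vector_space sc
  for sc :: "'k::field_char_0 \<Rightarrow> 'v::ab_group_add \<Rightarrow> 'v" +
  fixes gr :: "'g::ring_parity \<Rightarrow> 'v set"
  assumes gr_subspace: "subspace (gr g)"
    and gr_decomposition: "\<exists>!c. homogeneous_decomposition gr x c"

definition hcomp :: "('g \<Rightarrow> 'v set) \<Rightarrow> 'v \<Rightarrow> 'g \<Rightarrow> 'v::ab_group_add" where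
  "hcomp gr x = (THE c. homogeneous_decomposition gr x c)"

text \<open>The even part (\<open>b = False\<close>) or the odd part (\<open>b = True\<close>) of a vector.\<close>

definition parity_part :: "('g::ring_parity \<Rightarrow> 'v set) \<Rightarrow> bool \<Rightarrow> 'v \<Rightarrow> 'v::ab_group_add" where
  "parity_part gr b x = (\<Sum>g | hcomp gr x g \<noteq> 0 \<and> odd g = b. hcomp gr x g)"

text \<open>The linear map that sends a homogeneous \<open>x\<close> to \<open>(-1)\<^bsup>|x|\<^esup> x\<close>.\<close>

definition parity_inv :: "('g::ring_parity \<Rightarrow> 'v set) \<Rightarrow> 'v \<Rightarrow> 'v::ab_group_add" where
  "parity_inv gr x = parity_part gr False x - parity_part gr True x"

text \<open>
  A linear map \<open>V\<^bsup>\<otimes>n\<^esup> \<rightarrow> V\<close> is a multilinear function of \<open>x\<^sub>1, \<dots>, x\<^sub>n\<close>.  It is encoded as a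
  function of a sequence \<open>x\<close> that depends on these entries only.
\<close>

definition multilinear_maps :: "('k::field \<Rightarrow> 'v::ab_group_add \<Rightarrow> 'v) \<Rightarrow> nat \<Rightarrow> ((nat \<Rightarrow> 'v) \<Rightarrow> 'v) set" where
  "multilinear_maps sc n = {f.
     (\<forall>x y. (\<forall>j\<in>{1..n}. x j = y j) \<longrightarrow> f x = f y) \<and>
     (\<forall>j\<in>{1..n}. \<forall>x. Vector_Spaces.linear sc sc (\<lambda>v. f (x(j := v))))}"

definition End_hom ::
  "('k::field \<Rightarrow> 'v::ab_group_add \<Rightarrow> 'v) \<Rightarrow> ('g::ring_parity \<Rightarrow> 'v set) \<Rightarrow> nat \<Rightarrow> 'g \<Rightarrow>
     ((nat \<Rightarrow> 'v) \<Rightarrow> 'v) set" where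
  "End_hom sc gr n g = {f \<in> multilinear_maps sc n.
     \<forall>x \<delta>. (\<forall>j\<in>{1..n}. x j \<in> gr (\<delta> j)) \<longrightarrow> f x \<in> gr (g + (\<Sum>j = 1..n. \<delta> j))}"


definition End_space ::
  "('k::field \<Rightarrow> 'v::ab_group_add \<Rightarrow> 'v) \<Rightarrow> ('g::ring_parity \<Rightarrow> 'v set) \<Rightarrow> nat \<Rightarrow>
     ('k, (nat \<Rightarrow> 'v) \<Rightarrow> 'v) vs" where
  "End_space sc gr n =
     (let M = \<lparr> carr = multilinear_maps sc n, vzero = (\<lambda>x. 0), vadd = (\<lambda>f g x. f x + g x),
                vsmul = (\<lambda>c f x. sc c (f x)) \<rparr>
      in M\<lparr> carr := vspan M (\<Union>g. End_hom sc gr n g) \<rparr>)"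

text \<open>
  The even and the odd part of a multilinear map \<open>f\<close>: conjugating \<open>f\<close> with the parity involution
  multiplies it by \<open>(-1)\<^bsup>|f|\<^esup>\<close>.
\<close>

definition End_part ::
  "('k::field \<Rightarrow> 'v::ab_group_add \<Rightarrow> 'v) \<Rightarrow> ('g::ring_parity \<Rightarrow> 'v set) \<Rightarrow> bool \<Rightarrow>
     ((nat \<Rightarrow> 'v) \<Rightarrow> 'v) \<Rightarrow> (nat \<Rightarrow> 'v) \<Rightarrow> 'v" where
  "End_part sc gr b f x =
     sc (1 / 2) (f x + sc (if b then - 1 else 1) (parity_inv gr (f (\<lambda>j. parity_inv gr (x j)))))"

text \<open>
  On homogeneous arguments and for homogeneous \<open>g\<close>,
  \<open>(f \<circ>\<^sub>i g)(x\<^sub>1, \<dots>) = (-1)\<^bsup>|g|(|x\<^sub>1| + \<dots> + |x\<^bsub>i-1\<^esub>|)\<^esup> f(x\<^sub>1, \<dots>, x\<^bsub>i-1\<^esub>, g(x\<^sub>i, \<dots>, x\<^bsub>i+n-1\<^esub>), x\<^bsub>i+n\<^esub>, \<dots>)\<close>.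
  The definition extends this bilinearly: the odd part of \<open>g\<close> applies the parity involution to
  \<open>x\<^sub>1, \<dots>, x\<^bsub>i-1\<^esub>\<close>.
\<close>

definition End_comp ::
  "('k::field \<Rightarrow> 'v::ab_group_add \<Rightarrow> 'v) \<Rightarrow> ('g::ring_parity \<Rightarrow> 'v set) \<Rightarrow> nat \<Rightarrow> nat \<Rightarrow>
     ((nat \<Rightarrow> 'v) \<Rightarrow> 'v) \<Rightarrow> ((nat \<Rightarrow> 'v) \<Rightarrow> 'v) \<Rightarrow> (nat \<Rightarrow> 'v) \<Rightarrow> 'v" where
  "End_comp sc gr n i f g x =
     (\<Sum>b\<in>UNIV. f (\<lambda>k. if k < i then (if b then parity_inv gr (x k) else x k)
        else if k = i then End_part sc gr b g (\<lambda>j. x (j + i - 1)) else x (k + n - 1)))"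

text \<open>
  On homogeneous arguments, \<open>(f\<sigma>)(x\<^sub>1, \<dots>, x\<^sub>n) = \<epsilon> f(x\<^bsub>\<sigma>\<^sup>-\<^sup>1(1)\<^esub>, \<dots>, x\<^bsub>\<sigma>\<^sup>-\<^sup>1(n)\<^esub>)\<close>, where the Koszul sign \<open>\<epsilon>\<close>
  counts the inversions of \<open>\<sigma>\<close> among the positions of odd arguments.  The definition extends this
  multilinearly, by summing over the sets \<open>B\<close> of positions at which the odd part is taken.
\<close>

definition koszul_sign :: "nat \<Rightarrow> (nat \<Rightarrow> nat) \<Rightarrow> nat set \<Rightarrow> 'k::field" where
  "koszul_sign n \<sigma> B =
     (- 1) ^ card {(i, j). i \<in> {1..n} \<and> j \<in> {1..n} \<and> i < j \<and> \<sigma> i > \<sigma> j \<and> i \<in> B \<and> j \<in> B}"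

definition End_act ::
  "('k::field \<Rightarrow> 'v::ab_group_add \<Rightarrow> 'v) \<Rightarrow> ('g::ring_parity \<Rightarrow> 'v set) \<Rightarrow> nat \<Rightarrow>
     ((nat \<Rightarrow> 'v) \<Rightarrow> 'v) \<Rightarrow> (nat \<Rightarrow> nat) \<Rightarrow> (nat \<Rightarrow> 'v) \<Rightarrow> 'v" where
  "End_act sc gr n f \<sigma> x =
     (\<Sum>B\<in>Pow {1..n}. sc (koszul_sign n \<sigma> B)
        (f (\<lambda>k. parity_part gr (inv \<sigma> k \<in> B) (x (inv \<sigma> k)))))"

definition End_operad ::
  "('k::field \<Rightarrow> 'v::ab_group_add \<Rightarrow> 'v) \<Rightarrow> ('g::ring_parity \<Rightarrow> 'v set) \<Rightarrow>
     ('k, (nat \<Rightarrow> 'v) \<Rightarrow> 'v, 'g) graded_operad" where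
  "End_operad sc gr = \<lparr>
     opsp = End_space sc gr,
     ounit = (\<lambda>x. x 1),
     ocomp = (\<lambda>m n i. End_comp sc gr n i),
     oact = End_act sc gr,
     ohom = End_hom sc gr \<rparr>"

text \<open>
  A structure of graded algebra over an operad concentrated in degree zero: a degree-preserving
  operad morphism to the endomorphism operad.
\<close>

definition graded_algebra ::
  "('k::field, 'p, 'z) operad_scheme \<Rightarrow> ('k \<Rightarrow> 'v::ab_group_add \<Rightarrow> 'v) \<Rightarrow> ('g::ring_parity \<Rightarrow> 'v set) \<Rightarrow>
     (nat \<Rightarrow> 'p \<Rightarrow> (nat \<Rightarrow> 'v) \<Rightarrow> 'v) \<Rightarrow> bool" where
  "graded_algebra P sc gr \<phi> \<longleftrightarrow> operad_hom P (End_operad sc gr) \<phi> \<and>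
     (\<forall>n\<ge>1. \<forall>p\<in>carr (opsp P n). \<phi> n p \<in> ohom (End_operad sc gr) n 0)"


text \<open>
  The two operations have the expected Koszul signs on homogeneous elements; see
  \<open>End_act_homogeneous\<close> and \<open>End_comp_homogeneous\<close>.
\<close>

abbreviation sgn_of :: "'g::ring_parity \<Rightarrow> 'k::field" where "sgn_of g \<equiv> (if even g then 1 else - 1)"

context graded_space
begin

lemma hcomp_homogeneous:
  assumes "v \<in> gr g"
  shows "hcomp gr v = (\<lambda>i. if i = g then v else 0)"
proof -
  have "homogeneous_decomposition gr v (\<lambda>i. if i = g then v else 0)"
    unfolding homogeneous_decomposition_def
    using assms subspace_0[OF gr_subspace]
    by (cases "v = 0") (auto simp: if_distrib cong: if_cong)
  then show ?thesis
    unfolding hcomp_def using gr_decomposition by (metis the1_equality)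
qed

lemma parity_part_homogeneous:
  assumes "v \<in> gr g"
  shows "parity_part gr b v = (if odd g = b then v else 0)"
proof -
  have "{i. hcomp gr v i \<noteq> 0 \<and> odd i = b} = (if v \<noteq> 0 \<and> odd g = b then {g} else {})"
    using hcomp_homogeneous[OF assms] by (auto split: if_splits)
  then show ?thesis
    unfolding parity_part_def using hcomp_homogeneous[OF assms] by auto
qed

lemma parity_inv_homogeneous:
  assumes "v \<in> gr g"
  shows "parity_inv gr v = sc (if even g then 1 else - 1) v"
  using parity_part_homogeneous[OF assms] by (auto simp: parity_inv_def)

lemma multilinear_cong:
  assumes "f \<in> multilinear_maps sc n" "\<forall>j\<in>{1..n}. x j = y j"
  shows "f x = f y"
proof -
  have "\<forall>x y. (\<forall>j\<in>{1..n}. x j = y j) \<longrightarrow> f x = f y"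
    using assms(1) unfolding multilinear_maps_def by blast
  then show ?thesis using assms(2) by metis
qed

lemma multilinear_zero:
  assumes "f \<in> multilinear_maps sc n" "j \<in> {1..n}" "x j = 0"
  shows "f x = 0"
proof -
  interpret l: Vector_Spaces.linear sc sc "\<lambda>v. f (x(j := v))"
    using assms by (simp add: multilinear_maps_def)
  show ?thesis using l.zero assms(3) by (metis fun_upd_triv)
qed

lemma End_act_homogeneous:
  assumes f: "f \<in> multilinear_maps sc n" and \<sigma>: "\<sigma> permutes {1..n}"
    and x: "\<And>j. j \<in> {1..n} \<Longrightarrow> x j \<in> gr (\<delta> j)"
  shows "End_act sc gr n f \<sigma> x =
    sc (koszul_sign n \<sigma> {j\<in>{1..n}. odd (\<delta> j)}) (f (\<lambda>k. x (inv \<sigma> k)))"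
proof -
  let ?O = "{j\<in>{1..n}. odd (\<delta> j)}"
  have inv: "inv \<sigma> k \<in> {1..n}" if "k \<in> {1..n}" for k
    using permutes_in_image[OF permutes_inv[OF \<sigma>]] that by blast
  have z: "f (\<lambda>k. parity_part gr (inv \<sigma> k \<in> B) (x (inv \<sigma> k))) = 0"
    if B: "B \<in> Pow {1..n}" "B \<noteq> ?O" for B
  proof -
    from B obtain j where j: "j \<in> {1..n}" "(j \<in> B) \<noteq> odd (\<delta> j)" by blast
    have "\<sigma> j \<in> {1..n}" "inv \<sigma> (\<sigma> j) = j"
      using permutes_in_image[OF \<sigma>] j permutes_inverses[OF \<sigma>] by auto
    then show ?thesis
      using j parity_part_homogeneous[OF x[OF j(1)]]
      by (intro multilinear_zero[OF f, of "\<sigma> j"]) auto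
  qed
  have e: "f (\<lambda>k. parity_part gr (inv \<sigma> k \<in> ?O) (x (inv \<sigma> k))) = f (\<lambda>k. x (inv \<sigma> k))"
  proof -
    have "\<forall>k\<in>{1..n}. parity_part gr (inv \<sigma> k \<in> ?O) (x (inv \<sigma> k)) = x (inv \<sigma> k)"
      using inv by (auto simp: parity_part_homogeneous[OF x])
    then show ?thesis by (rule multilinear_cong[OF f])
  qed
  have "End_act sc gr n f \<sigma> x = (\<Sum>B\<in>Pow {1..n}. if B = ?O
      then sc (koszul_sign n \<sigma> ?O) (f (\<lambda>k. x (inv \<sigma> k))) else 0)"
    unfolding End_act_def by (rule sum.cong) (use z e in auto)
  moreover have "?O \<subseteq> {1..n}" by blast
  ultimately show ?thesis by simp
qed

lemma gr_signed: "sc (if P then 1 else - 1) v \<in> gr g" if "v \<in> gr g"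
  using subspace_scale[OF gr_subspace that] .

lemma multilinear_scale:
  assumes "f \<in> multilinear_maps sc n" "A \<subseteq> {1..n}"
  shows "f (\<lambda>j. if j \<in> A then sc (c j) (x j) else x j) = sc (\<Prod>j\<in>A. c j) (f x)"
proof -
  have "finite A" using assms(2) finite_subset by blast
  then show ?thesis using assms(2)
  proof (induction A)
    case (insert a A)
    let ?y = "\<lambda>j. if j \<in> A then sc (c j) (x j) else x j"
    interpret l: Vector_Spaces.linear sc sc "\<lambda>v. f (?y(a := v))"
      using assms(1) insert.prems unfolding multilinear_maps_def by blast
    have "(\<lambda>j. if j \<in> insert a A then sc (c j) (x j) else x j) = ?y(a := sc (c a) (x a))"
      by auto
    moreover have "?y(a := x a) = ?y" using insert.hyps by auto
    ultimately show ?case using l.scale[of "c a" "x a"] insert by simp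
  qed simp
qed


lemma prod_sgn: "finite A \<Longrightarrow> (\<Prod>j\<in>A. sgn_of (\<delta> j)) = sgn_of (\<Sum>j\<in>A. \<delta> j)"
  by (induction A rule: finite_induct) auto

lemma End_part_homogeneous:
  assumes g: "g \<in> End_hom sc gr n p" and x: "\<And>j. j \<in> {1..n} \<Longrightarrow> x j \<in> gr (\<delta> j)"
  shows "End_part sc gr b g x = (if odd p = b then g x else 0)"
proof -
  have gm: "g \<in> multilinear_maps sc n" using g by (simp add: End_hom_def)
  have "g (\<lambda>j. parity_inv gr (x j)) =
     g (\<lambda>j. if j \<in> {1..n} then sc (sgn_of (\<delta> j)) (x j) else x j)"
    by (rule multilinear_cong[OF gm]) (use x parity_inv_homogeneous in auto)
  also have "\<dots> = sc (sgn_of (\<Sum>j=1..n. \<delta> j)) (g x)"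
    by (subst multilinear_scale[OF gm order_refl]) (simp only: prod_sgn finite_atLeastAtMost)
  finally have 1: "g (\<lambda>j. parity_inv gr (x j)) = sc (sgn_of (\<Sum>j=1..n. \<delta> j)) (g x)" .
  have "g x \<in> gr (p + (\<Sum>j=1..n. \<delta> j))" using g x by (simp add: End_hom_def)
  then have "parity_inv gr (g (\<lambda>j. parity_inv gr (x j))) =
     sc (sgn_of (p + (\<Sum>j=1..n. \<delta> j))) (sc (sgn_of (\<Sum>j=1..n. \<delta> j)) (g x))"
    unfolding 1 by (intro parity_inv_homogeneous gr_signed)
  also have "\<dots> = sc (sgn_of p) (g x)" by auto
  finally show ?thesis
    using scale_left_distrib[of "1/2" "1/2" "g x"]
    by (auto simp: End_part_def scale_right_distrib)
qed

lemma sum_bool: "(\<Sum>b\<in>UNIV. F b) = F c + F (\<not> c)" for F :: "bool \<Rightarrow> 'c::ab_group_add"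
  by (cases c) (simp_all add: UNIV_bool add.commute)

lemma End_comp_homogeneous:
  assumes f: "f \<in> multilinear_maps sc m" and g: "g \<in> End_hom sc gr n p"
    and mn: "1 \<le> n" "i \<in> {1..m}"
    and x: "\<And>j. j \<in> {1..m + n - 1} \<Longrightarrow> x j \<in> gr (\<delta> j)"
  shows "End_comp sc gr n i f g x =
    sc (if odd p \<and> odd (\<Sum>j\<in>{1..<i}. \<delta> j) then - 1 else 1)
       (f (\<lambda>k. if k < i then x k else if k = i then g (\<lambda>j. x (j + i - 1)) else x (k + n - 1)))"
proof -
  let ?y = "\<lambda>k. if k < i then x k else if k = i then g (\<lambda>j. x (j + i - 1)) else x (k + n - 1)"
  let ?t = "\<lambda>b k. if k < i then (if b then parity_inv gr (x k) else x k)
        else if k = i then End_part sc gr b g (\<lambda>j. x (j + i - 1)) else x (k + n - 1)"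
  have part: "End_part sc gr b g (\<lambda>j. x (j + i - 1)) = (if odd p = b then g (\<lambda>j. x (j + i - 1)) else 0)" for b
  proof (rule End_part_homogeneous[OF g, where \<delta> = "\<lambda>j. \<delta> (j + i - 1)"])
    fix j assume "j \<in> {1..n}"
    then show "x (j + i - 1) \<in> gr (\<delta> (j + i - 1))" using mn by (intro x) auto
  qed
  have z: "f (?t (\<not> odd p)) = 0"
    by (rule multilinear_zero[OF f mn(2)]) (use part[of "\<not> odd p"] in simp)
  have "f (?t (odd p)) = sc (if odd p \<and> odd (\<Sum>j\<in>{1..<i}. \<delta> j) then - 1 else 1) (f ?y)"
  proof (cases "odd p")
    case True
    have "f (?t True) = f (\<lambda>j. if j \<in> {1..<i} then sc (sgn_of (\<delta> j)) (?y j) else ?y j)"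
    proof -
      have "\<forall>j\<in>{1..m}. ?t True j = (if j \<in> {1..<i} then sc (sgn_of (\<delta> j)) (?y j) else ?y j)"
        using True mn part[of True] parity_inv_homogeneous[OF x] by auto
      then show ?thesis by (rule multilinear_cong[OF f])
    qed
    also have "\<dots> = sc (sgn_of (\<Sum>j\<in>{1..<i}. \<delta> j)) (f ?y)"
      using mn by (subst multilinear_scale[OF f]) (auto simp: prod_sgn)
    finally have A: "f (?t True) = sc (sgn_of (\<Sum>j\<in>{1..<i}. \<delta> j)) (f ?y)" .
    have o: "odd p = True" using True by simp
    show ?thesis unfolding o A by simp
  next
    case False
    then have A: "?t False = ?y" using part[of False] by auto
    have o: "odd p = False" using False by simp
    show ?thesis unfolding o A by simp
  qed
  moreover have "End_comp sc gr n i f g x = f (?t (odd p)) + f (?t (\<not> odd p))"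
    unfolding End_comp_def by (rule sum_bool)
  ultimately show ?thesis using z by simp
qed

end


section \<open>Differential graded algebras and derived brackets\<close>

definition bracket ::
  "('k::field, 'e, 'z) s2mod_scheme \<Rightarrow> ('e btree \<Rightarrow>\<^sub>0 'k) set set \<Rightarrow>
     (nat \<Rightarrow> ('e btree \<Rightarrow>\<^sub>0 'k) set set \<Rightarrow> (nat \<Rightarrow> 'a) \<Rightarrow> 'a) \<Rightarrow> 'e \<Rightarrow> 'a \<Rightarrow> 'a \<Rightarrow> 'a" where
  "bracket E R \<alpha> e x y = \<alpha> 2 (bq_gen E R e) (\<lambda>j. if j = 1 then x else y)"

locale dg_algebra = s2_module E + graded_space sc gr
  for E :: "('k::field_char_0, 'e) s2mod"
    and R :: "('e btree \<Rightarrow>\<^sub>0 'k) set set"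
    and sc :: "'k \<Rightarrow> 'a::ab_group_add \<Rightarrow> 'a"
    and gr :: "'g::ring_parity \<Rightarrow> 'a set" +
  fixes \<alpha> :: "nat \<Rightarrow> ('e btree \<Rightarrow>\<^sub>0 'k) set set \<Rightarrow> (nat \<Rightarrow> 'a) \<Rightarrow> 'a"
    and d :: "'a \<Rightarrow> 'a"
  assumes relations: "quadratic_relations E R"
    and algebra: "graded_algebra (bq_operad E R) sc gr \<alpha>"
    and d_linear: "Vector_Spaces.linear sc sc d"
    and d_degree: "x \<in> gr g \<Longrightarrow> d x \<in> gr (g + 1)"
    and d_square: "d (d x) = 0"
    and d_derivation: "\<lbrakk>e \<in> carr E; x \<in> gr g\<rbrakk> \<Longrightarrow>
      d (bracket E R \<alpha> e x y) =
        bracket E R \<alpha> e (d x) y + sc (if even g then 1 else - 1) (bracket E R \<alpha> e x (d y))"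

text \<open>
  The shifted space \<open>sA\<close> has the same underlying space as \<open>A\<close>, with \<open>(sA)\<^sub>g = A\<^bsub>g-1\<^esub>\<close>.  The operator
  \<open>s\<close> is then the identity map.
\<close>

definition shift :: "('g::ring_parity \<Rightarrow> 'a set) \<Rightarrow> 'g \<Rightarrow> 'a set" where
  "shift gr g = gr (g - 1)"

text \<open>
  The sign \<open>(-1)\<^bsup>|x\<^sub>1|\<^esup>\<close> refers to the degree of \<open>x\<^sub>1\<close> in \<open>A\<close>, not in \<open>sA\<close>.
\<close>

definition derived_lower ::
  "('k::field, 'e, 'z) s2mod_scheme \<Rightarrow> ('e btree \<Rightarrow>\<^sub>0 'k) set set \<Rightarrow> ('g::ring_parity \<Rightarrow> 'a set) \<Rightarrow>
     (nat \<Rightarrow> ('e btree \<Rightarrow>\<^sub>0 'k) set set \<Rightarrow> (nat \<Rightarrow> 'a) \<Rightarrow> 'a) \<Rightarrow> ('a \<Rightarrow> 'a) \<Rightarrow> 'e \<Rightarrow>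
     (nat \<Rightarrow> 'a) \<Rightarrow> 'a::ab_group_add" where
  "derived_lower E R gr \<alpha> d e x = - bracket E R \<alpha> e (d (parity_inv gr (x 1))) (x 2)"

definition derived_upper ::
  "('k::field, 'e, 'z) s2mod_scheme \<Rightarrow> ('e btree \<Rightarrow>\<^sub>0 'k) set set \<Rightarrow>
     (nat \<Rightarrow> ('e btree \<Rightarrow>\<^sub>0 'k) set set \<Rightarrow> (nat \<Rightarrow> 'a) \<Rightarrow> 'a) \<Rightarrow> ('a \<Rightarrow> 'a) \<Rightarrow> 'e \<Rightarrow>
     (nat \<Rightarrow> 'a) \<Rightarrow> 'a" where
  "derived_upper E R \<alpha> d e x = bracket E R \<alpha> e (x 1) (d (x 2))"

end

theory Submission
  imports Defs "HOL-Library.Multiset"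
begin

text \<open>
  Write \<open>d' = d s\<^sup>-\<^sup>1 : sA \<rightarrow> A\<close>, a map of degree zero.  For an operation \<open>f\<close> of arity \<open>n\<close> on \<open>A\<close> put
  \<open>D\<^sub>j f = s f (d', \<dots>, d', s\<^sup>-\<^sup>1, d', \<dots>, d')\<close> with \<open>s\<^sup>-\<^sup>1\<close> in position \<open>j\<close>; for \<open>n = 2\<close> these are the derived
  brackets.  Because \<open>d\<close> is a derivation with \<open>d\<^sup>2 = 0\<close>, one has \<open>d D\<^sub>j f = f (d', \<dots>, d')\<close>, whatever
  \<open>j\<close> is.  Hence \<open>D\<^sub>a f \<circ>\<^sub>i D\<^sub>b g = D\<^sub>c (f \<circ>\<^sub>i g)\<close> with the same \<open>c\<close> as in \<open>e\<^sub>a \<circ>\<^sub>i e\<^sub>b = e\<^sub>c\<close> in \<open>\<P>erm\<close>, so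
  \<open>e\<^sub>j \<otimes> f \<mapsto> D\<^sub>j f\<close> is an operad morphism \<open>\<P>erm \<otimes> \<P> \<rightarrow> \<E>nd(sA)\<close>.  Its composite with the morphism
  \<open>\<Phi> : \<F>(\<P>erm(2) \<otimes> E) \<rightarrow> \<P>erm \<otimes> \<P>\<close> kills the relations of \<open>\<P>erm \<circ> \<P>\<close>, which are by definition killed
  by \<open>\<Phi>\<close>.
\<close>

section \<open>Linear algebra of finitely supported functions\<close>

text \<open>Composition is where the derivation rule enters. In
  \<open>D\<^sub>a f \<circ>\<^sub>i D\<^sub>b g\<close> the argument i of f is bare if a = i, and
  the bare slot of the composite is then place b in the block of g. If a and i differ, f applies d'
  to the output of \<open>D\<^sub>b g\<close>, and the result has forgotten b, just as a product in
  Perm remembers only its rightmost variable. So the identity for \<open>d D\<^sub>j\<close> must be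
  known for every operation of P and not only for the brackets; it passes through compositions and
  permutations of the arguments, and these generate all tree monomials from the corollas.

  Signs: the only odd object is the bare \<open>s\<^sup>-\<^sup>1\<close>. A permutation changes
  which odd arguments stand to its left, and this matches the change of the Koszul sign when
  argument j is read in sA instead of A.

  The map is built from coordinates on F(Perm(2)) and the action of F(E). A tensor with a relation
  of Perm has zero coordinates; one with a relation of P acts as zero. The morphism \<Phi> is given
  only by a choice, so one has to be constructed: a tree labelled by tensors is split into pairs of
  trees of the same shape.\<close>

abbreviation psc :: "'k \<Rightarrow> ('x \<Rightarrow>\<^sub>0 'k::field) \<Rightarrow> ('x \<Rightarrow>\<^sub>0 'k)" where
  "psc \<equiv> (\<lambda>c. Poly_Mapping.map ((*) c))"

lemma lookup_psc [simp]: "Poly_Mapping.lookup (psc c p) x = c * Poly_Mapping.lookup p x"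
  by (simp add: Poly_Mapping.map.rep_eq when_def)

interpretation pm: vector_space "psc :: 'k \<Rightarrow> ('x \<Rightarrow>\<^sub>0 'k::field) \<Rightarrow> ('x \<Rightarrow>\<^sub>0 'k)"
  by unfold_locales (rule poly_mapping_eqI; simp add: lookup_add algebra_simps)+

text \<open>Linear extension with values in an arbitrary vector space. Both \<open>lin_ext\<close>
  and \<open>bilin_ext\<close> are instances, so their linearity comes from one proof.\<close>

definition pm_lift ::
  "('k \<Rightarrow> 'v \<Rightarrow> 'v) \<Rightarrow> ('x \<Rightarrow> 'v) \<Rightarrow> ('x \<Rightarrow>\<^sub>0 'k::field) \<Rightarrow> 'v::ab_group_add" where
  "pm_lift sc f p = (\<Sum>x\<in>Poly_Mapping.keys p. sc (Poly_Mapping.lookup p x) (f x))"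

context vector_space
begin

text \<open>Supports shrink under cancellation, so sums over different supports are compared on a
  common finite superset.\<close>

lemma pm_lift_superset:
  assumes "finite S" "Poly_Mapping.keys p \<subseteq> S"
  shows "pm_lift scale f p = (\<Sum>x\<in>S. scale (Poly_Mapping.lookup p x) (f x))"
  unfolding pm_lift_def
  by (rule sum.mono_neutral_left) (use assms in \<open>auto simp: in_keys_iff\<close>)

lemma pm_lift_add: "pm_lift scale f (p + q) = pm_lift scale f p + pm_lift scale f q"
proof -
  let ?S = "Poly_Mapping.keys p \<union> Poly_Mapping.keys q"
  have "finite ?S" "Poly_Mapping.keys (p + q) \<subseteq> ?S" using keys_add[of p q] by auto
  then show ?thesis
    by (simp add: pm_lift_superset[of ?S] lookup_add scale_left_distrib sum.distrib)
qed

lemma pm_lift_psc: "pm_lift scale f (psc c p) = scale c (pm_lift scale f p)"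
proof -
  have "Poly_Mapping.keys (psc c p) \<subseteq> Poly_Mapping.keys p"
    by (auto simp: in_keys_iff)
  then show ?thesis
    by (simp add: pm_lift_superset[of "Poly_Mapping.keys p"] scale_sum_right)
qed

lemma pm_lift_single [simp]: "pm_lift scale f (Poly_Mapping.single x c) = scale c (f x)"
  by (simp add: pm_lift_def)

lemma pm_lift_linear: "Vector_Spaces.linear psc scale (pm_lift scale f)"
  unfolding Vector_Spaces.linear_iff
  using vector_space_axioms pm.vector_space_axioms pm_lift_add pm_lift_psc by blast

end

lemma pm_lift_cong:
  "(\<And>x. x \<in> Poly_Mapping.keys p \<Longrightarrow> f x = g x) \<Longrightarrow> pm_lift sc f p = pm_lift sc g p"
  by (simp add: pm_lift_def)

abbreviation plinear :: "(('x \<Rightarrow>\<^sub>0 'k::field) \<Rightarrow> ('y \<Rightarrow>\<^sub>0 'k)) \<Rightarrow> bool" where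
  "plinear \<equiv> Vector_Spaces.linear psc psc"

lemma linear_add': "Vector_Spaces.linear s t f \<Longrightarrow> f (x + y) = f x + f y"
  and linear_diff': "Vector_Spaces.linear s t f \<Longrightarrow> f (x - y) = f x - f y"
  and linear_scale': "Vector_Spaces.linear s t f \<Longrightarrow> f (s c x) = t c (f x)"
  and linear_zero': "Vector_Spaces.linear s t f \<Longrightarrow> f 0 = 0"
  and linear_neg': "Vector_Spaces.linear s t f \<Longrightarrow> f (- x) = - f x"
  and linear_sum': "Vector_Spaces.linear s t f \<Longrightarrow> f (sum g A) = (\<Sum>a\<in>A. f (g a))"
proof -
  assume "Vector_Spaces.linear s t f"
  then interpret Vector_Spaces.linear s t f .
  show "f (x + y) = f x + f y" "f (x - y) = f x - f y" "f (s c x) = t c (f x)" "f 0 = 0"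
    "f (- x) = - f x" "f (sum g A) = (\<Sum>a\<in>A. f (g a))"
    by (rule add diff scale zero neg sum)+
qed

lemma linear_psc: "Vector_Spaces.linear psc sc f \<Longrightarrow> f (psc c p) = sc c (f p)"
  using linear_scale'[of psc sc f] by simp

lemma linear_compose':
  "Vector_Spaces.linear s t f \<Longrightarrow> Vector_Spaces.linear t u g \<Longrightarrow> Vector_Spaces.linear s u (\<lambda>x. g (f x))"
  using Vector_Spaces.linear_compose[of s t f u g] by (simp add: o_def)

lemma linear_sum_fun:
  "(\<And>a. a \<in> A \<Longrightarrow> Vector_Spaces.linear s t (f a)) \<Longrightarrow> vector_space s \<Longrightarrow> vector_space t \<Longrightarrow>
    Vector_Spaces.linear s t (\<lambda>x. \<Sum>a\<in>A. f a x)"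
proof (induction A rule: infinite_finite_induct)
  case (insert a A)
  then show ?case
    unfolding Vector_Spaces.linear_iff
    by (auto simp: algebra_simps vector_space.vector_space_assms(1))
qed (auto simp: Vector_Spaces.linear_iff module.scale_zero_right[OF module_iff_vector_space[THEN iffD2]])

lemma pm_expand: "p = (\<Sum>x\<in>Poly_Mapping.keys p. psc (Poly_Mapping.lookup p x) (basis x))"
  by (rule poly_mapping_eqI)
     (auto simp: lookup_sum lookup_single when_def in_keys_iff sum.delta if_distrib
        cong: if_cong)

lemma linear_pm_expand:
  assumes "Vector_Spaces.linear psc sc f"
  shows "f p = pm_lift sc (\<lambda>x. f (basis x)) p"
  unfolding pm_lift_def
  by (subst pm_expand) (simp only: linear_sum'[OF assms] linear_scale'[OF assms])

lemma linear_eq_on_basis: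
  assumes "Vector_Spaces.linear psc sc f" "Vector_Spaces.linear psc sc g"
    "\<And>x. x \<in> Poly_Mapping.keys p \<Longrightarrow> f (basis x) = g (basis x)"
  shows "f p = g p"
  unfolding linear_pm_expand[OF assms(1), of p] linear_pm_expand[OF assms(2), of p]
  by (rule pm_lift_cong) (rule assms(3))

lemma linear_mem_on_basis:
  assumes "Vector_Spaces.linear psc sc f" "module.subspace sc S"
    "\<And>x. x \<in> Poly_Mapping.keys p \<Longrightarrow> f (basis x) \<in> S"
  shows "f p \<in> S"
proof -
  interpret vector_space sc using assms(1) by (simp add: Vector_Spaces.linear_iff)
  show ?thesis
    unfolding linear_pm_expand[OF assms(1), of p] pm_lift_def
    by (intro subspace_sum subspace_scale assms)
qed

text \<open>The null spaces below are spans of relators. That a map descends to a quotient is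
  thereby reduced to its values on relators.\<close>

lemma linear_span_mem:
  assumes "Vector_Spaces.linear s t f" "module.subspace t U" "\<And>x. x \<in> S \<Longrightarrow> f x \<in> U"
    "x \<in> module.span s S"
  shows "f x \<in> U"
proof -
  interpret f: Vector_Spaces.linear s t f by fact
  from assms(4) show ?thesis
  proof (induction rule: f.vs1.span_induct_alt)
    case base
    then show ?case using f.zero f.vs2.subspace_0[OF assms(2)] by simp
  next
    case (step c x y)
    then show ?case
      using f.add f.scale f.vs2.subspace_add[OF assms(2)] f.vs2.subspace_scale[OF assms(2)]
        assms(3) by simp
  qed
qed

lemma lin_ext_eq: "lin_ext h = pm_lift psc (\<lambda>x. basis (h x))"
  by (rule ext) (simp add: lin_ext_def pm_lift_def)

lemma lin_ext_linear: "plinear (lin_ext h)"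
  unfolding lin_ext_eq by (rule pm.pm_lift_linear)

lemma lin_ext_single [simp]: "lin_ext h (Poly_Mapping.single x c) = Poly_Mapping.single (h x) c"
  unfolding lin_ext_eq by simp

lemmas lin_ext_add = linear_add'[OF lin_ext_linear]
  and lin_ext_diff = linear_diff'[OF lin_ext_linear]
  and lin_ext_psc = linear_scale'[OF lin_ext_linear]
  and lin_ext_zero [simp] = linear_zero'[OF lin_ext_linear]

lemma keys_lin_ext: "Poly_Mapping.keys (lin_ext h p) \<subseteq> h ` Poly_Mapping.keys p"
  unfolding lin_ext_def using keys_sum
  by (smt (verit) UN_iff keys_single image_iff in_mono singletonD empty_iff subsetI)

lemma lin_ext_lin_ext: "lin_ext g (lin_ext h p) = lin_ext (\<lambda>x. g (h x)) p"
  by (rule linear_eq_on_basis[OF linear_compose'[OF lin_ext_linear lin_ext_linear] lin_ext_linear])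
    simp

lemma lin_ext_cong:
  "(\<And>x. x \<in> Poly_Mapping.keys p \<Longrightarrow> h x = g x) \<Longrightarrow> lin_ext h p = lin_ext g p"
  unfolding lin_ext_eq by (rule pm_lift_cong) simp

lemma lin_ext_id: "(\<And>x. x \<in> Poly_Mapping.keys p \<Longrightarrow> h x = x) \<Longrightarrow> lin_ext h p = p"
proof -
  assume "\<And>x. x \<in> Poly_Mapping.keys p \<Longrightarrow> h x = x"
  then have "lin_ext h p = lin_ext (\<lambda>x. x) p" by (rule lin_ext_cong)
  also have "\<dots> = p" unfolding lin_ext_eq pm_lift_def by (rule pm_expand[symmetric])
  finally show ?thesis .
qed

lemma bilin_ext_eq: "bilin_ext h p q = pm_lift psc (\<lambda>x. lin_ext (h x) q) p"
proof -
  have "psc c (lin_ext (h x) q) =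
     (\<Sum>y\<in>Poly_Mapping.keys q. Poly_Mapping.single (h x y) (c * Poly_Mapping.lookup q y))" for c x
    unfolding lin_ext_def by (simp add: pm.scale_sum_right)
  then show ?thesis by (simp add: bilin_ext_def pm_lift_def)
qed

lemma bilin_ext_linear1: "plinear (\<lambda>p. bilin_ext h p q)"
  unfolding bilin_ext_eq by (rule pm.pm_lift_linear)

lemma bilin_ext_linear2: "plinear (\<lambda>q. bilin_ext h p q)"
  unfolding bilin_ext_eq pm_lift_def
  by (intro linear_sum_fun pm.vector_space_axioms)
    (simp add: Vector_Spaces.linear_iff pm.vector_space_axioms lin_ext_add lin_ext_psc
      pm.scale_right_distrib mult.commute)

lemma bilin_ext_single [simp]:
  "bilin_ext h (Poly_Mapping.single x b) (Poly_Mapping.single y c) = Poly_Mapping.single (h x y) (b * c)"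
  unfolding bilin_ext_eq by simp

lemma bilin_ext_basis1: "bilin_ext h (basis x) q = lin_ext (h x) q"
  unfolding bilin_ext_eq by simp

lemma bilin_ext_basis2: "bilin_ext h p (basis y) = lin_ext (\<lambda>x. h x y) p"
  by (rule linear_eq_on_basis[OF bilin_ext_linear1 lin_ext_linear]) simp

lemmas bilin_ext_add1 = linear_add'[OF bilin_ext_linear1]
  and bilin_ext_add2 = linear_add'[OF bilin_ext_linear2]

lemma bilinear_eq_on_basis:
  assumes "\<And>q. Vector_Spaces.linear psc sc (\<lambda>p. F p q)" "\<And>p. Vector_Spaces.linear psc sc (F p)"
    "\<And>q. Vector_Spaces.linear psc sc (\<lambda>p. G p q)" "\<And>p. Vector_Spaces.linear psc sc (G p)"
    "\<And>x y. x \<in> Poly_Mapping.keys p \<Longrightarrow> y \<in> Poly_Mapping.keys q \<Longrightarrow>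
       F (basis x) (basis y) = G (basis x) (basis y)"
  shows "F p q = G p q"
  by (rule linear_eq_on_basis[OF assms(1,3)])
    (rule linear_eq_on_basis[OF assms(2,4)], rule assms(5))

lemma subspace_keys: "pm.subspace {p. Poly_Mapping.keys p \<subseteq> X}"
  unfolding pm.subspace_def
proof (intro conjI ballI allI; unfold mem_Collect_eq)
  show "Poly_Mapping.keys (p + q) \<subseteq> X" if "Poly_Mapping.keys p \<subseteq> X" "Poly_Mapping.keys q \<subseteq> X" for p q
    using that keys_add[of p q] by blast
  show "Poly_Mapping.keys (psc c p) \<subseteq> X" if "Poly_Mapping.keys p \<subseteq> X" for c p
    using that by (auto simp: in_keys_iff)
qed simp

lemma keys_diff_subset:
  fixes p q :: "'x \<Rightarrow>\<^sub>0 'k::field"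
  shows "Poly_Mapping.keys p \<subseteq> X \<Longrightarrow> Poly_Mapping.keys q \<subseteq> X \<Longrightarrow> Poly_Mapping.keys (p - q) \<subseteq> X"
  using pm.subspace_diff[OF subspace_keys, of p X q] by simp

section \<open>Subspaces, quotients and linear maps on carriers\<close>

context vspace
begin

lemma zero_eq: "x \<in> carr V \<Longrightarrow> vsmul V 0 x = vzero V"
  by (metis add_inverse add_zero smul_one smul_add_left smul_closed add.right_inverse)

lemma add_zero_right: "x \<in> carr V \<Longrightarrow> vadd V x (vzero V) = x"
  using add_commute[of x "vzero V"] by (simp add: add_zero zero_closed)

lemma smul_zero: "vsmul V c (vzero V) = vzero V"
  by (metis zero_closed zero_eq smul_smul mult_zero_right)

lemma add_left_commute:
  "\<lbrakk>x \<in> carr V; y \<in> carr V; z \<in> carr V\<rbrakk> \<Longrightarrow> vadd V x (vadd V y z) = vadd V y (vadd V x z)"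
  by (metis add_assoc add_commute)

lemma subspace_carr: "vsubspace V (carr V)"
  by (simp add: vsubspace_def zero_closed add_closed smul_closed)

lemma subspace_vspan:
  assumes "X \<subseteq> carr V"
  shows "vsubspace V (vspan V X)"
proof -
  have "vspan V X \<subseteq> carr V"
    unfolding vspan_def using subspace_carr assms by blast
  then show ?thesis unfolding vspan_def vsubspace_def by blast
qed

end

lemma vspan_superset: "X \<subseteq> vspan V X"
  by (auto simp: vspan_def)

lemma vspan_minimal: "\<lbrakk>vsubspace V U; X \<subseteq> U\<rbrakk> \<Longrightarrow> vspan V X \<subseteq> U"
  by (auto simp: vspan_def)

lemma vlinearD:
  assumes "vlinear V W f"
  shows "x \<in> carr V \<Longrightarrow> f x \<in> carr W"
    and "x \<in> carr V \<Longrightarrow> y \<in> carr V \<Longrightarrow> f (vadd V x y) = vadd W (f x) (f y)"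
    and "x \<in> carr V \<Longrightarrow> f (vsmul V c x) = vsmul W c (f x)"
  using assms by (auto simp: vlinear_def)

lemma vlinear_zero: "\<lbrakk>vlinear V W f; vspace V; vspace W\<rbrakk> \<Longrightarrow> f (vzero V) = vzero W"
  by (metis vlinearD(1,3) vspace.zero_closed vspace.zero_eq)

lemma vlinear_compose: "\<lbrakk>vlinear U V f; vlinear V W g\<rbrakk> \<Longrightarrow> vlinear U W (\<lambda>x. g (f x))"
  by (simp add: vlinear_def)

lemma kernel_subspace:
  assumes "vlinear V W f" "vspace V" "vspace W"
  shows "vsubspace V {x \<in> carr V. f x = vzero W}"
  unfolding vsubspace_def
  using vlinearD[OF assms(1)] vlinear_zero[OF assms] vspace.zero_closed[OF assms(2)]
    vspace.add_closed[OF assms(2)] vspace.smul_closed[OF assms(2)]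
    vspace.add_zero[OF assms(3) vspace.zero_closed[OF assms(3)]] vspace.smul_zero[OF assms(3)]
  by auto

text \<open>Operations on a quotient are unions over representatives. Such a union collapses once
  there is a representative and all of them give the same coset.\<close>

lemma UN_const: "\<lbrakk>a \<in> X; \<And>x. x \<in> X \<Longrightarrow> F x = C\<rbrakk> \<Longrightarrow> (\<Union>x\<in>X. F x) = C"
  by auto

lemma UN_const2:
  assumes "a \<in> X" "b \<in> Y" "\<And>x y. x \<in> X \<Longrightarrow> y \<in> Y \<Longrightarrow> F x y = C"
  shows "(\<Union>x\<in>X. \<Union>y\<in>Y. F x y) = C"
  using assms by (intro UN_const[OF assms(1)] UN_const[OF assms(2)])

locale vsub = vspace V for V :: "('k::field, 'v, 'z) vs_scheme" +
  fixes U
  assumes sub: "vsubspace V U"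
begin

lemma U_carr: "u \<in> U \<Longrightarrow> u \<in> carr V"
  and U_zero: "vzero V \<in> U"
  and U_add: "u \<in> U \<Longrightarrow> w \<in> U \<Longrightarrow> vadd V u w \<in> U"
  and U_smul: "u \<in> U \<Longrightarrow> vsmul V c u \<in> U"
  using sub by (auto simp: vsubspace_def)

lemma mem_coset: "x \<in> carr V \<Longrightarrow> x \<in> vcoset V U x"
  unfolding vcoset_def using U_zero add_zero_right[symmetric] by blast

lemma coset_carr: "x \<in> carr V \<Longrightarrow> vcoset V U x \<subseteq> carr V"
  by (auto simp: vcoset_def add_closed U_carr)

lemma coset_eqI: "x \<in> carr V \<Longrightarrow> y \<in> vcoset V U x \<Longrightarrow> vcoset V U y = vcoset V U x"
proof -
  assume x: "x \<in> carr V" and "y \<in> vcoset V U x"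
  then obtain u where u: "u \<in> U" "y = vadd V x u" by (auto simp: vcoset_def)
  have "\<exists>u'\<in>U. vadd V y w = vadd V x u'" if "w \<in> U" for w
    using that x u by (metis add_assoc U_add U_carr)
  moreover have "\<exists>u'\<in>U. vadd V x w = vadd V y u'" if w: "w \<in> U" for w
  proof
    show "vadd V (vsmul V (- 1) u) w \<in> U" using u w by (simp add: U_add U_smul)
    have "vadd V u (vadd V (vsmul V (- 1) u) w) = w"
      using u w by (metis add_assoc add_inverse add_zero U_carr smul_closed)
    then show "vadd V x w = vadd V y (vadd V (vsmul V (- 1) u) w)"
      using u x w by (metis add_assoc U_carr U_add U_smul)
  qed
  ultimately show ?thesis unfolding vcoset_def by blast
qed

lemma coset_zero: "u \<in> U \<Longrightarrow> vcoset V U u = U"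
proof -
  assume "u \<in> U"
  then have "u \<in> vcoset V U (vzero V)"
    unfolding vcoset_def using add_zero[symmetric] U_carr by blast
  then have "vcoset V U u = vcoset V U (vzero V)" by (rule coset_eqI[OF zero_closed])
  also have "\<dots> = U" unfolding vcoset_def using add_zero U_carr by force
  finally show ?thesis .
qed

lemma coset_eq_iff:
  "x \<in> carr V \<Longrightarrow> y \<in> carr V \<Longrightarrow>
    vcoset V U x = vcoset V U y \<longleftrightarrow> vadd V x (vsmul V (- 1) y) \<in> U"
proof
  assume x: "x \<in> carr V" "y \<in> carr V" and "vcoset V U x = vcoset V U y"
  then obtain u where u: "u \<in> U" "x = vadd V y u" using mem_coset by (force simp: vcoset_def)
  then have "vadd V x (vsmul V (- 1) y) = u"
    using x by (metis U_carr add_assoc add_commute add_inverse add_zero smul_closed)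
  then show "vadd V x (vsmul V (- 1) y) \<in> U" using u by simp
next
  assume x: "x \<in> carr V" "y \<in> carr V" and u: "vadd V x (vsmul V (- 1) y) \<in> U"
  have "x = vadd V y (vadd V x (vsmul V (- 1) y))"
    using x by (metis add_assoc add_commute add_inverse add_zero_right smul_closed)
  then have "x \<in> vcoset V U y" unfolding vcoset_def using u by blast
  then show "vcoset V U x = vcoset V U y" using coset_eqI x by blast
qed

lemma quot_add:
  assumes "x \<in> carr V" "y \<in> carr V"
  shows "vadd (vquot V U) (vcoset V U x) (vcoset V U y) = vcoset V U (vadd V x y)"
proof -
  have e: "vcoset V U (vadd V x' y') = vcoset V U (vadd V x y)"
    if "x' \<in> vcoset V U x" "y' \<in> vcoset V U y" for x' y'
  proof -
    obtain u w where uw: "u \<in> U" "x' = vadd V x u" "w \<in> U" "y' = vadd V y w"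
      using \<open>x' \<in> vcoset V U x\<close> \<open>y' \<in> vcoset V U y\<close> by (auto simp: vcoset_def)
    then have "vadd V x' y' = vadd V (vadd V x y) (vadd V u w)"
      using assms by (smt (verit) U_carr add_assoc add_closed add_left_commute)
    then have "vadd V x' y' \<in> vcoset V U (vadd V x y)"
      unfolding vcoset_def using uw U_add by blast
    then show ?thesis using coset_eqI assms add_closed by blast
  qed
  show ?thesis
    unfolding vquot_def vs.simps by (rule UN_const2[OF mem_coset mem_coset e]) (use assms in auto)
qed

lemma quot_smul:
  assumes "x \<in> carr V"
  shows "vsmul (vquot V U) c (vcoset V U x) = vcoset V U (vsmul V c x)"
proof -
  have "vsmul V c x' \<in> vcoset V U (vsmul V c x)" if x': "x' \<in> vcoset V U x" for x'
  proof -
    obtain u where "u \<in> U" "x' = vadd V x u" using x' by (auto simp: vcoset_def)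
    then show ?thesis
      using assms U_carr U_smul smul_add_right unfolding vcoset_def by blast
  qed
  then have e: "vcoset V U (vsmul V c x') = vcoset V U (vsmul V c x)" if "x' \<in> vcoset V U x" for x'
    using that coset_eqI assms smul_closed by blast
  show ?thesis
    unfolding vquot_def vs.simps by (rule UN_const[OF mem_coset e]) (use assms in auto)
qed

lemma quot_carr: "carr (vquot V U) = vcoset V U ` carr V"
  and quot_zero: "vzero (vquot V U) = vcoset V U (vzero V)"
  by (simp_all add: vquot_def coset_zero U_zero)

lemma quot_vspace: "vspace (vquot V U)"
proof -
  note simps = quot_add quot_smul quot_zero add_closed zero_closed smul_closed
    add_zero add_inverse smul_add_right smul_add_left smul_smul smul_one
  show ?thesis
  proof (unfold_locales, unfold quot_carr, goal_cases)
    case (4 X Y Z)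
    then show ?case by (elim imageE) (simp add: simps add_assoc)
  next
    case (5 X Y)
    then show ?case by (elim imageE) (simp add: simps add_commute)
  qed (elim imageE, simp add: simps | simp add: simps)+
qed

lemma coset_linear: "vlinear V (vquot V U) (vcoset V U)"
  by (simp add: vlinear_def quot_carr quot_add quot_smul)

end

text \<open>Maps out of a quotient are written as \<open>f (rep X)\<close>. If f kills the subspace,
  the chosen representative does not influence the value, by \<open>lift_coset\<close>.\<close>

definition rep :: "'v set \<Rightarrow> 'v" where "rep X = (SOME x. x \<in> X)"

context vsub
begin

lemma rep_coset: "x \<in> carr V \<Longrightarrow> rep (vcoset V U x) \<in> vcoset V U x"
  unfolding rep_def using mem_coset someI by metis

lemma rep_mem: "X \<in> carr (vquot V U) \<Longrightarrow> rep X \<in> carr V \<and> vcoset V U (rep X) = X"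
  unfolding quot_carr using rep_coset coset_carr coset_eqI by fast

lemma lift_coset:
  assumes f: "vlinear V W f" and W: "vspace W" and z: "\<And>u. u \<in> U \<Longrightarrow> f u = vzero W"
    and x: "x \<in> carr V"
  shows "f (rep (vcoset V U x)) = f x"
proof -
  obtain u where "u \<in> U" "rep (vcoset V U x) = vadd V x u"
    using rep_coset[OF x] by (auto simp: vcoset_def)
  then show ?thesis
    using vlinearD[OF f] x z U_carr vspace.add_zero_right[OF W] by simp
qed

lemma lift_linear:
  assumes "vlinear V W f" "vspace W" "\<And>u. u \<in> U \<Longrightarrow> f u = vzero W"
  shows "vlinear (vquot V U) W (\<lambda>X. f (rep X))"
  unfolding vlinear_def quot_carr
  by (auto simp: quot_add quot_smul lift_coset[OF assms] add_closed smul_closed vlinearD[OF assms(1)])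

end

subsection \<open>Free vector spaces and tensor products\<close>

lemma free_vs_simps [simp]:
  "carr (free_vs X) = {p. Poly_Mapping.keys p \<subseteq> X}" "vzero (free_vs X) = 0"
  "vadd (free_vs X) = (+)" "vsmul (free_vs X) = psc"
  by (simp_all add: free_vs_def)

lemma free_vspace: "vspace (free_vs X)"
  using pm.subspace_add[OF subspace_keys[of X]] pm.subspace_scale[OF subspace_keys[of X]]
  by unfold_locales (simp_all add: pm.scale_right_distrib pm.scale_left_distrib add_ac)

lemma free_subspace_iff:
  "vsubspace (free_vs X) U \<longleftrightarrow> U \<subseteq> {p. Poly_Mapping.keys p \<subseteq> X} \<and> pm.subspace U"
  by (auto simp: vsubspace_def pm.subspace_def)

text \<open>On free spaces \<open>vspan\<close> agrees with the span in the ambient type, which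
  opens the span induction of the library to all null spaces.\<close>

lemma free_vspan:
  assumes "S \<subseteq> {p. Poly_Mapping.keys p \<subseteq> X}"
  shows "vspan (free_vs X) S = pm.span S"
proof
  have "vsubspace (free_vs X) (pm.span S)"
    unfolding free_subspace_iff
    using pm.span_minimal[OF assms subspace_keys] pm.subspace_span by blast
  then show "vspan (free_vs X) S \<subseteq> pm.span S" by (rule vspan_minimal[OF _ pm.span_superset])
  have "pm.span S \<subseteq> U" if "vsubspace (free_vs X) U" "S \<subseteq> U" for U
    using that pm.span_minimal unfolding free_subspace_iff by blast
  then show "pm.span S \<subseteq> vspan (free_vs X) S" unfolding vspan_def by blast
qed

lemma plinear_vlinear:
  assumes "plinear f" "\<And>x. x \<in> X \<Longrightarrow> Poly_Mapping.keys (f (basis x)) \<subseteq> Y"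
  shows "vlinear (free_vs X) (free_vs Y) f"
proof -
  have "f p \<in> {p. Poly_Mapping.keys p \<subseteq> Y}" if "Poly_Mapping.keys p \<subseteq> X" for p
    using linear_mem_on_basis[OF assms(1) subspace_keys, of p Y] assms(2) that by blast
  then show ?thesis by (simp add: vlinear_def linear_add'[OF assms(1)] linear_psc[OF assms(1)])
qed

lemma free_coset_eq_iff:
  assumes "vsubspace (free_vs X) U" "Poly_Mapping.keys p \<subseteq> X" "Poly_Mapping.keys q \<subseteq> X"
  shows "vcoset (free_vs X) U p = vcoset (free_vs X) U q \<longleftrightarrow> p - q \<in> U"
proof -
  interpret vsub "free_vs X" U by (simp add: vsub_def vsub_axioms_def free_vspace assms(1))
  show ?thesis using coset_eq_iff[of p q] assms by simp
qed

lemma rep_free_coset: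
  assumes "vsubspace (free_vs X) U" "Poly_Mapping.keys p \<subseteq> X"
  shows "rep (vcoset (free_vs X) U p) - p \<in> U" "Poly_Mapping.keys (rep (vcoset (free_vs X) U p)) \<subseteq> X"
proof -
  interpret vsub "free_vs X" U by (simp add: vsub_def vsub_axioms_def free_vspace assms(1))
  show "rep (vcoset (free_vs X) U p) - p \<in> U" 
    using rep_coset[of p] assms by (auto simp: vcoset_def)
  show "Poly_Mapping.keys (rep (vcoset (free_vs X) U p)) \<subseteq> X"
    using rep_coset[of p] assms coset_carr[of p] by auto
qed

lemma bilinear_relators_carr:
  assumes "vspace V" "vspace W"
  shows "bilinear_relators V W \<subseteq> {p. Poly_Mapping.keys p \<subseteq> carr V \<times> carr W}"
proof
  fix p assume "p \<in> bilinear_relators V W"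
  then show "p \<in> {p. Poly_Mapping.keys p \<subseteq> carr V \<times> carr W}"
    unfolding bilinear_relators_def mem_Collect_eq
    by (elim UnE CollectE exE conjE)
      (simp_all add: keys_diff_subset vspace.add_closed[OF assms(1)] vspace.add_closed[OF assms(2)]
      vspace.smul_closed[OF assms(1)] vspace.smul_closed[OF assms(2)])
qed

lemma tensor_null_eq:
  "\<lbrakk>vspace V; vspace W\<rbrakk> \<Longrightarrow> tensor_null V W = pm.span (bilinear_relators V W)"
  unfolding tensor_null_def by (rule free_vspan[OF bilinear_relators_carr])

lemma tensor_null_subspace:
  "\<lbrakk>vspace V; vspace W\<rbrakk> \<Longrightarrow> vsubspace (free_vs (carr V \<times> carr W)) (tensor_null V W)"
  unfolding tensor_null_def
  by (rule vspace.subspace_vspan[OF free_vspace]) (simp add: bilinear_relators_carr)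

lemma vtensor_vspace: "\<lbrakk>vspace V; vspace W\<rbrakk> \<Longrightarrow> vspace (vtensor V W)"
  unfolding vtensor_def
  by (rule vsub.quot_vspace) (simp add: vsub_def vsub_axioms_def free_vspace tensor_null_subspace)

section \<open>Quotients of operads\<close>

lemma arity_pos: "1 \<le> m \<Longrightarrow> 1 \<le> n \<Longrightarrow> 1 \<le> m + n - (1::nat)"
  by simp

text \<open>Only the linear part of the operad axioms is recorded; kernels, generated ideals,
  quotients and lifts of morphisms rest on it alone.\<close>

locale linear_operad =
  fixes P :: "('k::field, 'p, 'z) operad_scheme"
  assumes opsp_vspace: "1 \<le> n \<Longrightarrow> vspace (opsp P n)"
    and unit_closed: "ounit P \<in> carr (opsp P 1)"
    and comp_linear1: "\<lbrakk>1 \<le> m; 1 \<le> n; i \<in> {1..m}; g \<in> carr (opsp P n)\<rbrakk> \<Longrightarrow>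
      vlinear (opsp P m) (opsp P (m + n - 1)) (\<lambda>f. ocomp P m n i f g)"
    and comp_linear2: "\<lbrakk>1 \<le> m; 1 \<le> n; i \<in> {1..m}; f \<in> carr (opsp P m)\<rbrakk> \<Longrightarrow>
      vlinear (opsp P n) (opsp P (m + n - 1)) (\<lambda>g. ocomp P m n i f g)"
    and act_linear: "\<lbrakk>1 \<le> n; \<sigma> permutes {1..n}\<rbrakk> \<Longrightarrow>
      vlinear (opsp P n) (opsp P n) (\<lambda>f. oact P n f \<sigma>)"
begin

lemma comp_closed:
  "\<lbrakk>1 \<le> m; 1 \<le> n; i \<in> {1..m}; f \<in> carr (opsp P m); g \<in> carr (opsp P n)\<rbrakk> \<Longrightarrow>
    ocomp P m n i f g \<in> carr (opsp P (m + n - 1))"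
  by (rule vlinearD(1)[OF comp_linear1])

lemma comp_add1:
  "\<lbrakk>1 \<le> m; 1 \<le> n; i \<in> {1..m}; f \<in> carr (opsp P m); f' \<in> carr (opsp P m); g \<in> carr (opsp P n)\<rbrakk> \<Longrightarrow>
    ocomp P m n i (vadd (opsp P m) f f') g =
      vadd (opsp P (m + n - 1)) (ocomp P m n i f g) (ocomp P m n i f' g)"
  by (rule vlinearD(2)[OF comp_linear1])

lemma comp_add2:
  "\<lbrakk>1 \<le> m; 1 \<le> n; i \<in> {1..m}; f \<in> carr (opsp P m); g \<in> carr (opsp P n); g' \<in> carr (opsp P n)\<rbrakk> \<Longrightarrow>
    ocomp P m n i f (vadd (opsp P n) g g') =
      vadd (opsp P (m + n - 1)) (ocomp P m n i f g) (ocomp P m n i f g')"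
  by (rule vlinearD(2)[OF comp_linear2])

lemma comp_smul1:
  "\<lbrakk>1 \<le> m; 1 \<le> n; i \<in> {1..m}; f \<in> carr (opsp P m); g \<in> carr (opsp P n)\<rbrakk> \<Longrightarrow>
    ocomp P m n i (vsmul (opsp P m) c f) g = vsmul (opsp P (m + n - 1)) c (ocomp P m n i f g)"
  by (rule vlinearD(3)[OF comp_linear1])

lemma comp_smul2:
  "\<lbrakk>1 \<le> m; 1 \<le> n; i \<in> {1..m}; f \<in> carr (opsp P m); g \<in> carr (opsp P n)\<rbrakk> \<Longrightarrow>
    ocomp P m n i f (vsmul (opsp P n) c g) = vsmul (opsp P (m + n - 1)) c (ocomp P m n i f g)"
  by (rule vlinearD(3)[OF comp_linear2])

lemma comp_zero1:
  "\<lbrakk>1 \<le> m; 1 \<le> n; i \<in> {1..m}; g \<in> carr (opsp P n)\<rbrakk> \<Longrightarrow>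
    ocomp P m n i (vzero (opsp P m)) g = vzero (opsp P (m + n - 1))"
  by (rule vlinear_zero[OF comp_linear1 opsp_vspace opsp_vspace]) auto

lemma comp_zero2:
  "\<lbrakk>1 \<le> m; 1 \<le> n; i \<in> {1..m}; f \<in> carr (opsp P m)\<rbrakk> \<Longrightarrow>
    ocomp P m n i f (vzero (opsp P n)) = vzero (opsp P (m + n - 1))"
  by (rule vlinear_zero[OF comp_linear2 opsp_vspace opsp_vspace]) auto

lemma act_closed:
  "\<lbrakk>1 \<le> n; \<sigma> permutes {1..n}; f \<in> carr (opsp P n)\<rbrakk> \<Longrightarrow> oact P n f \<sigma> \<in> carr (opsp P n)"
  by (rule vlinearD(1)[OF act_linear])

lemma act_zero:
  "\<lbrakk>1 \<le> n; \<sigma> permutes {1..n}\<rbrakk> \<Longrightarrow> oact P n (vzero (opsp P n)) \<sigma> = vzero (opsp P n)"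
  by (rule vlinear_zero[OF act_linear]) (simp_all add: opsp_vspace)

text \<open>With this ideal in the family, the intersection defining \<open>gen_ideal\<close> stays
  inside the carriers.\<close>

lemma carr_ideal: "operadic_ideal P (\<lambda>n. carr (opsp P n))"
  unfolding operadic_ideal_def
  using comp_closed act_closed opsp_vspace vspace.subspace_carr by blast

end

lemma operad_homD:
  assumes "operad_hom P Q \<phi>"
  shows "1 \<le> n \<Longrightarrow> vlinear (opsp P n) (opsp Q n) (\<phi> n)"
    and "\<phi> 1 (ounit P) = ounit Q"
    and "\<lbrakk>1 \<le> m; 1 \<le> n; i \<in> {1..m}; f \<in> carr (opsp P m); g \<in> carr (opsp P n)\<rbrakk> \<Longrightarrow>
        \<phi> (m + n - 1) (ocomp P m n i f g) = ocomp Q m n i (\<phi> m f) (\<phi> n g)"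
    and "\<lbrakk>1 \<le> n; \<sigma> permutes {1..n}; f \<in> carr (opsp P n)\<rbrakk> \<Longrightarrow>
        \<phi> n (oact P n f \<sigma>) = oact Q n (\<phi> n f) \<sigma>"
  using assms unfolding operad_hom_def by blast+

lemma operadic_idealD:
  assumes "operadic_ideal P I"
  shows "1 \<le> n \<Longrightarrow> vsubspace (opsp P n) (I n)"
    and "\<lbrakk>1 \<le> m; 1 \<le> n; i \<in> {1..m}; f \<in> I m; g \<in> carr (opsp P n)\<rbrakk> \<Longrightarrow>
        ocomp P m n i f g \<in> I (m + n - 1)"
    and "\<lbrakk>1 \<le> m; 1 \<le> n; i \<in> {1..m}; f \<in> carr (opsp P m); g \<in> I n\<rbrakk> \<Longrightarrow>
        ocomp P m n i f g \<in> I (m + n - 1)"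
    and "\<lbrakk>1 \<le> n; \<sigma> permutes {1..n}; f \<in> I n\<rbrakk> \<Longrightarrow> oact P n f \<sigma> \<in> I n"
  using assms unfolding operadic_ideal_def by (simp_all add: vsubspace_def subset_iff)

lemma operad_hom_compose:
  assumes "operad_hom P Q \<phi>" "operad_hom Q S \<chi>"
  shows "operad_hom P S (\<lambda>n x. \<chi> n (\<phi> n x))"
  unfolding operad_hom_def
proof (intro conjI allI impI ballI)
  show "vlinear (opsp P n) (opsp S n) (\<lambda>x. \<chi> n (\<phi> n x))" if "1 \<le> n" for n
    by (rule vlinear_compose[OF operad_homD(1)[OF assms(1) that] operad_homD(1)[OF assms(2) that]])
  show "\<chi> 1 (\<phi> 1 (ounit P)) = ounit S"
    using operad_homD(2)[OF assms(1)] operad_homD(2)[OF assms(2)] by simp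
  have c: "\<phi> n f \<in> carr (opsp Q n)" if "1 \<le> n" "f \<in> carr (opsp P n)" for n f
    using vlinearD(1)[OF operad_homD(1)[OF assms(1)]] that by blast
  show "\<chi> (m + n - 1) (\<phi> (m + n - 1) (ocomp P m n i f g)) = ocomp S m n i (\<chi> m (\<phi> m f)) (\<chi> n (\<phi> n g))"
    if "1 \<le> m" "1 \<le> n" "i \<in> {1..m}" "f \<in> carr (opsp P m)" "g \<in> carr (opsp P n)" for m n i f g
    using that operad_homD(3)[OF assms(1)] operad_homD(3)[OF assms(2)] c by simp
  show "\<chi> n (\<phi> n (oact P n f \<sigma>)) = oact S n (\<chi> n (\<phi> n f)) \<sigma>"
    if "1 \<le> n" "\<sigma> permutes {1..n}" "f \<in> carr (opsp P n)" for n \<sigma> f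
    using that operad_homD(4)[OF assms(1)] operad_homD(4)[OF assms(2)] c by simp
qed

text \<open>Together with \<open>gen_ideal_minimal\<close> this gives: a morphism that kills the
  generating relations kills the ideal in every arity.\<close>

lemma kernel_ideal:
  assumes h: "operad_hom P Q \<phi>" and P: "linear_operad P" and Q: "linear_operad Q"
  shows "operadic_ideal P (\<lambda>n. {x \<in> carr (opsp P n). \<phi> n x = vzero (opsp Q n)})"
proof -
  interpret P: linear_operad P by fact
  interpret Q: linear_operad Q by fact
  have c: "\<phi> n f \<in> carr (opsp Q n)" if "1 \<le> n" "f \<in> carr (opsp P n)" for n f
    using vlinearD(1)[OF operad_homD(1)[OF h]] that by blast
  show ?thesis
    unfolding operadic_ideal_def
  proof (intro conjI allI impI ballI)
    fix n :: nat assume "1 \<le> n"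
    then show "vsubspace (opsp P n) {x \<in> carr (opsp P n). \<phi> n x = vzero (opsp Q n)}"
      by (intro kernel_subspace operad_homD(1)[OF h] P.opsp_vspace Q.opsp_vspace)
  next
    fix m n i :: nat and f g
    assume a: "1 \<le> m" "1 \<le> n" "i \<in> {1..m}" "f \<in> carr (opsp P m)" "g \<in> carr (opsp P n)"
      and "f \<in> {x \<in> carr (opsp P m). \<phi> m x = vzero (opsp Q m)} \<or>
         g \<in> {x \<in> carr (opsp P n). \<phi> n x = vzero (opsp Q n)}"
    then have "ocomp Q m n i (\<phi> m f) (\<phi> n g) = vzero (opsp Q (m + n - 1))"
      using Q.comp_zero1[OF a(1-3) c[OF a(2,5)]] Q.comp_zero2[OF a(1-3) c[OF a(1,4)]] by auto
    then show "ocomp P m n i f g \<in> {x \<in> carr (opsp P (m + n - 1)). \<phi> (m + n - 1) x = vzero (opsp Q (m + n - 1))}"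
      using operad_homD(3)[OF h a] P.comp_closed[OF a] by simp
  next
    fix n :: nat and \<sigma> f
    assume "1 \<le> n" "\<sigma> permutes {1..n}" "f \<in> {x \<in> carr (opsp P n). \<phi> n x = vzero (opsp Q n)}"
    then show "oact P n f \<sigma> \<in> {x \<in> carr (opsp P n). \<phi> n x = vzero (opsp Q n)}"
      using operad_homD(4)[OF h] P.act_closed Q.act_zero by simp
  qed
qed

lemma gen_ideal_minimal: "\<lbrakk>operadic_ideal P I; R \<subseteq> I k\<rbrakk> \<Longrightarrow> gen_ideal P k R n \<subseteq> I n"
  unfolding gen_ideal_def by blast

lemma gen_ideal_superset: "R \<subseteq> gen_ideal P k R k"
  unfolding gen_ideal_def by blast

lemma gen_ideal_ideal:
  assumes "linear_operad P" "R \<subseteq> carr (opsp P k)"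
  shows "operadic_ideal P (gen_ideal P k R)"
proof -
  interpret linear_operad P by fact
  have sub: "gen_ideal P k R n \<subseteq> carr (opsp P n)" for n
    by (rule gen_ideal_minimal[OF carr_ideal assms(2)])
  have mem: "x \<in> gen_ideal P k R n" if "\<And>I. operadic_ideal P I \<Longrightarrow> R \<subseteq> I k \<Longrightarrow> x \<in> I n" for x n
    unfolding gen_ideal_def using that by blast
  have in_I: "x \<in> I n" if "x \<in> gen_ideal P k R n" "operadic_ideal P I" "R \<subseteq> I k" for x n I
    using that gen_ideal_minimal by blast
  show ?thesis
    unfolding operadic_ideal_def
  proof (intro conjI allI impI ballI)
    fix n :: nat assume n: "1 \<le> n"
    show "vsubspace (opsp P n) (gen_ideal P k R n)"
      unfolding vsubspace_def
    proof (intro conjI allI ballI sub; rule mem)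
      fix J assume J: "operadic_ideal P J" "R \<subseteq> J k"
      have "vsubspace (opsp P n) (J n)" by (rule operadic_idealD(1)[OF J(1) n])
      then show "vzero (opsp P n) \<in> J n"
        and "x \<in> gen_ideal P k R n \<Longrightarrow> y \<in> gen_ideal P k R n \<Longrightarrow> vadd (opsp P n) x y \<in> J n"
        and "x \<in> gen_ideal P k R n \<Longrightarrow> vsmul (opsp P n) b x \<in> J n" for x y b
        using in_I[OF _ J] unfolding vsubspace_def by blast+
    qed
  next
    fix m n i :: nat and f g
    assume a: "1 \<le> m" "1 \<le> n" "i \<in> {1..m}" "f \<in> carr (opsp P m)" "g \<in> carr (opsp P n)"
      and "f \<in> gen_ideal P k R m \<or> g \<in> gen_ideal P k R n"
    then show "ocomp P m n i f g \<in> gen_ideal P k R (m + n - 1)"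
      using operadic_idealD(2,3)[OF _ a(1-3)] in_I by (metis mem)
  next
    fix n :: nat and \<sigma> f
    assume "1 \<le> n" "\<sigma> permutes {1..n}" "f \<in> gen_ideal P k R n"
    then show "oact P n f \<sigma> \<in> gen_ideal P k R n"
      using operadic_idealD(4) in_I by (metis mem)
  qed
qed

locale operad_quotient = linear_operad P for P :: "('k::field, 'p, 'z) operad_scheme" +
  fixes I
  assumes ideal: "operadic_ideal P I"
begin

abbreviation "cs n \<equiv> vcoset (opsp P n) (I n)"

lemma vsub: "1 \<le> n \<Longrightarrow> vsub (opsp P n) (I n)"
  by (simp add: vsub_def vsub_axioms_def opsp_vspace operadic_idealD(1)[OF ideal])

lemma quot_opsp: "opsp (quot_operad P I) n = vquot (opsp P n) (I n)"
  by (simp add: quot_operad_def)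

lemma in_coset: "y \<in> cs n x \<longleftrightarrow> (\<exists>u\<in>I n. y = vadd (opsp P n) x u)"
  by (auto simp: vcoset_def)

text \<open>Replacing f, g by f + u, g + w with u, w in the ideal changes the composite by the
  composites of u with g and of f + u with w, and both lie in the ideal.\<close>

lemma quot_comp:
  assumes a: "1 \<le> m" "1 \<le> n" "i \<in> {1..m}" "f \<in> carr (opsp P m)" "g \<in> carr (opsp P n)"
  shows "ocomp (quot_operad P I) m n i (cs m f) (cs n g) = cs (m + n - 1) (ocomp P m n i f g)"
proof -
  interpret m: vsub "opsp P m" "I m" by (rule vsub[OF a(1)])
  interpret n: vsub "opsp P n" "I n" by (rule vsub[OF a(2)])
  interpret mn: vsub "opsp P (m + n - 1)" "I (m + n - 1)" by (rule vsub[OF arity_pos[OF a(1,2)]])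
  have e: "cs (m + n - 1) (ocomp P m n i f' g') = cs (m + n - 1) (ocomp P m n i f g)"
    if fg: "f' \<in> cs m f" "g' \<in> cs n g" for f' g'
  proof -
    obtain u w where u: "u \<in> I m" "f' = vadd (opsp P m) f u" and w: "w \<in> I n" "g' = vadd (opsp P n) g w"
      using fg unfolding in_coset by blast
    have f': "f' \<in> carr (opsp P m)" using u a m.U_carr m.add_closed by simp
    have "ocomp P m n i f' g' =
        vadd (opsp P (m + n - 1)) (ocomp P m n i f' g) (ocomp P m n i f' w)"
      using w comp_add2[OF a(1-3) f' a(5)] n.U_carr by simp
    also have "ocomp P m n i f' g = vadd (opsp P (m + n - 1)) (ocomp P m n i f g) (ocomp P m n i u g)"
      using u comp_add1[OF a(1-4) _ a(5)] m.U_carr by simp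
    finally have "ocomp P m n i f' g' = vadd (opsp P (m + n - 1)) (ocomp P m n i f g)
        (vadd (opsp P (m + n - 1)) (ocomp P m n i u g) (ocomp P m n i f' w))"
      using mn.add_assoc comp_closed[OF a] comp_closed[OF a(1-3) _ a(5)] m.U_carr u(1)
        comp_closed[OF a(1-3) f'] n.U_carr w(1) by simp
    moreover have "ocomp P m n i u g \<in> I (m + n - 1)" "ocomp P m n i f' w \<in> I (m + n - 1)"
      using operadic_idealD(2,3)[OF ideal a(1-3)] u w f' a by blast+
    ultimately show ?thesis
      using mn.coset_eqI[OF comp_closed[OF a]] in_coset mn.U_add by blast
  qed
  show ?thesis
    unfolding quot_operad_def operad.simps
    by (rule UN_const2[OF m.mem_coset[OF a(4)] n.mem_coset[OF a(5)] e])
qed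

lemma quot_act:
  assumes a: "1 \<le> n" "\<sigma> permutes {1..n}" "f \<in> carr (opsp P n)"
  shows "oact (quot_operad P I) n (cs n f) \<sigma> = cs n (oact P n f \<sigma>)"
proof -
  interpret n: vsub "opsp P n" "I n" by (rule vsub[OF a(1)])
  have e: "cs n (oact P n f' \<sigma>) = cs n (oact P n f \<sigma>)" if f: "f' \<in> cs n f" for f'
  proof -
    obtain u where u: "u \<in> I n" "f' = vadd (opsp P n) f u" using f unfolding in_coset by blast
    then have "oact P n f' \<sigma> = vadd (opsp P n) (oact P n f \<sigma>) (oact P n u \<sigma>)"
      using vlinearD(2)[OF act_linear[OF a(1,2)]] a n.U_carr by simp
    then show ?thesis
      using n.coset_eqI[OF act_closed[OF a]] in_coset operadic_idealD(4)[OF ideal a(1,2) u(1)] by blast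
  qed
  show ?thesis
    unfolding quot_operad_def operad.simps
    by (rule UN_const[OF n.mem_coset[OF a(3)] e])
qed

lemma quot_carrE:
  assumes "1 \<le> n" "X \<in> carr (opsp (quot_operad P I) n)"
  obtains x where "x \<in> carr (opsp P n)" "X = cs n x"
  using assms vsub.quot_carr[OF vsub] by (auto simp: quot_opsp)

lemma quot_linear_operad: "linear_operad (quot_operad P I)"
proof (rule linear_operad.intro)
  show "vspace (opsp (quot_operad P I) n)" if "1 \<le> n" for n
    unfolding quot_opsp by (rule vsub.quot_vspace[OF vsub[OF that]])
  show "ounit (quot_operad P I) \<in> carr (opsp (quot_operad P I) 1)"
    unfolding quot_opsp using vsub.quot_carr[OF vsub[of 1]] unit_closed
    by (simp add: quot_operad_def)
next
  fix m n i :: nat and X assume a: "1 \<le> m" "1 \<le> n" "i \<in> {1..m}" and X: "X \<in> carr (opsp (quot_operad P I) n)"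
  obtain g where g: "g \<in> carr (opsp P n)" "X = cs n g" using quot_carrE[OF a(2) X] .
  note [simp] = vsub.quot_carr[OF vsub] vsub.quot_add[OF vsub] vsub.quot_smul[OF vsub]
    vspace.add_closed[OF opsp_vspace] vspace.smul_closed[OF opsp_vspace]
  show "vlinear (opsp (quot_operad P I) m) (opsp (quot_operad P I) (m + n - 1))
      (\<lambda>Y. ocomp (quot_operad P I) m n i Y X)"
    unfolding vlinear_def quot_opsp
    using a g(1) comp_closed[OF a _ g(1)] comp_add1[OF a _ _ g(1)] comp_smul1[OF a _ g(1)] 
    by (auto simp: quot_comp g(2))
next
  fix m n i :: nat and X assume a: "1 \<le> m" "1 \<le> n" "i \<in> {1..m}" and X: "X \<in> carr (opsp (quot_operad P I) m)"
  obtain f where f: "f \<in> carr (opsp P m)" "X = cs m f" using quot_carrE[OF a(1) X] .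
  note [simp] = vsub.quot_carr[OF vsub] vsub.quot_add[OF vsub] vsub.quot_smul[OF vsub]
    vspace.add_closed[OF opsp_vspace] vspace.smul_closed[OF opsp_vspace]
  show "vlinear (opsp (quot_operad P I) n) (opsp (quot_operad P I) (m + n - 1))
      (\<lambda>Y. ocomp (quot_operad P I) m n i X Y)"
    unfolding vlinear_def quot_opsp
    using a f(1) comp_closed[OF a f(1)] comp_add2[OF a f(1)] comp_smul2[OF a f(1)] 
    by (auto simp: quot_comp f(2))
next
  fix n :: nat and \<sigma> assume a: "1 \<le> n" "\<sigma> permutes {1..n}"
  note [simp] = vsub.quot_carr[OF vsub] vsub.quot_add[OF vsub] vsub.quot_smul[OF vsub]
    vspace.add_closed[OF opsp_vspace] vspace.smul_closed[OF opsp_vspace]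
  show "vlinear (opsp (quot_operad P I) n) (opsp (quot_operad P I) n) (\<lambda>f. oact (quot_operad P I) n f \<sigma>)"
    unfolding vlinear_def quot_opsp
    using a act_closed[OF a] vlinearD(2,3)[OF act_linear[OF a]]
    by (auto simp: quot_act)
qed

lemma coset_hom: "operad_hom P (quot_operad P I) (\<lambda>n. cs n)"
  unfolding operad_hom_def quot_opsp
proof (intro conjI allI impI ballI)
  show "cs 1 (ounit P) = ounit (quot_operad P I)" by (simp add: quot_operad_def)
qed (use vsub.coset_linear[OF vsub] in \<open>simp_all add: quot_comp quot_act\<close>)

context
  fixes Q :: "('k, 'q, 'y) operad_scheme" and \<phi>
  assumes hom: "operad_hom P Q \<phi>" and Q: "linear_operad Q"
    and kills: "\<And>n x. 1 \<le> n \<Longrightarrow> x \<in> I n \<Longrightarrow> \<phi> n x = vzero (opsp Q n)"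
begin

lemma lift_hom_coset: "1 \<le> n \<Longrightarrow> x \<in> carr (opsp P n) \<Longrightarrow> \<phi> n (rep (cs n x)) = \<phi> n x"
  by (rule vsub.lift_coset[OF vsub operad_homD(1)[OF hom] linear_operad.opsp_vspace[OF Q] kills])

text \<open>The universal property of the quotient operad. Every composite of classes is the class
  of a composite of representatives, and there \<phi> can be evaluated.\<close>

lemma lift_hom: "operad_hom (quot_operad P I) Q (\<lambda>n X. \<phi> n (rep X))"
  unfolding operad_hom_def
proof (intro conjI allI impI ballI)
  show "vlinear (opsp (quot_operad P I) n) (opsp Q n) (\<lambda>X. \<phi> n (rep X))" if "1 \<le> n" for n
    unfolding quot_opsp
    by (rule vsub.lift_linear[OF vsub operad_homD(1)[OF hom] linear_operad.opsp_vspace[OF Q] kills])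
      (use that in auto)
  have "\<phi> 1 (rep (cs 1 (ounit P))) = ounit Q"
    using lift_hom_coset unit_closed operad_homD(2)[OF hom] by simp
  then show "\<phi> 1 (rep (ounit (quot_operad P I))) = ounit Q" by (simp add: quot_operad_def)
next
  fix m n i :: nat and X Y
  assume a: "1 \<le> m" "1 \<le> n" "i \<in> {1..m}"
    and X: "X \<in> carr (opsp (quot_operad P I) m)" and Y: "Y \<in> carr (opsp (quot_operad P I) n)"
  obtain f where f: "f \<in> carr (opsp P m)" "X = cs m f" using quot_carrE[OF a(1) X] .
  obtain g where g: "g \<in> carr (opsp P n)" "Y = cs n g" using quot_carrE[OF a(2) Y] .
  show "\<phi> (m + n - 1) (rep (ocomp (quot_operad P I) m n i X Y)) = ocomp Q m n i (\<phi> m (rep X)) (\<phi> n (rep Y))"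
    unfolding f(2) g(2) quot_comp[OF a f(1) g(1)] lift_hom_coset[OF arity_pos[OF a(1,2)] comp_closed[OF a f(1) g(1)]]
      lift_hom_coset[OF a(1) f(1)] lift_hom_coset[OF a(2) g(1)]
    by (rule operad_homD(3)[OF hom a f(1) g(1)])
next
  fix n :: nat and \<sigma> X
  assume a: "1 \<le> n" "\<sigma> permutes {1..n}" and X: "X \<in> carr (opsp (quot_operad P I) n)"
  obtain f where f: "f \<in> carr (opsp P n)" "X = cs n f" using quot_carrE[OF a(1) X] .
  show "\<phi> n (rep (oact (quot_operad P I) n X \<sigma>)) = oact Q n (\<phi> n (rep X)) \<sigma>"
    unfolding f(2) quot_act[OF a f(1)] lift_hom_coset[OF a(1) act_closed[OF a f(1)]]
      lift_hom_coset[OF a(1) f(1)]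
    by (rule operad_homD(4)[OF hom a f(1)])
qed

end

end

text \<open>The target of a \<open>vlinear\<close> map has its own \<open>vadd\<close>, so a linear
  combination is pushed through such a map one term at a time.\<close>

lemma pm_induct [consumes 1, case_names zero add]:
  assumes "Poly_Mapping.keys p \<subseteq> X" "Q 0"
    "\<And>p b x. Poly_Mapping.keys p \<subseteq> X \<Longrightarrow> x \<in> X \<Longrightarrow> Q p \<Longrightarrow> Q (p + psc b (basis x))"
  shows "Q (p :: 'x \<Rightarrow>\<^sub>0 'k::field)"
proof -
  \<comment> \<open>The induction runs over partial sums of the basis expansion of p, all of which
    keep their support in X.\<close>
  have "Poly_Mapping.keys (\<Sum>x\<in>S. psc (Poly_Mapping.lookup p x) (basis x)) \<subseteq> X \<and>
      Q (\<Sum>x\<in>S. psc (Poly_Mapping.lookup p x) (basis x))"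
    if "S \<subseteq> Poly_Mapping.keys p" for S
    using finite_subset[OF that finite_keys] that
  proof (induction S rule: finite_induct)
    case empty
    then show ?case using assms(2) by simp
  next
    case (insert x S)
    let ?s = "\<Sum>x\<in>S. psc (Poly_Mapping.lookup p x) (basis x)"
    have x: "x \<in> X" and s: "Poly_Mapping.keys ?s \<subseteq> X" "Q ?s" using insert assms(1) by auto
    have "Poly_Mapping.keys (?s + psc (Poly_Mapping.lookup p x) (basis x)) \<subseteq> X"
      using pm.subspace_add[OF subspace_keys, of ?s X] s(1) x by simp
    then show ?case
      using assms(3)[OF s(1) x s(2), of "Poly_Mapping.lookup p x"]
      unfolding sum.insert[OF insert.hyps] by (simp only: add.commute)
  qed
  from this[OF order_refl] show ?thesis using pm_expand[of p] by simp
qed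

section \<open>Operads with a basis stable under composition\<close>

text \<open>Common frame for \<open>tree_operad\<close> and \<open>pair_operad\<close>: composition
  and action send basis elements to basis elements, so morphisms and ideals can be tested on
  them.\<close>

locale basis_operad =
  fixes P :: "('k::field, 'x \<Rightarrow>\<^sub>0 'k) operad" and B u c a
  assumes P_def: "P = \<lparr> opsp = (\<lambda>n. free_vs (B n)), ounit = basis u,
      ocomp = (\<lambda>m n i. bilin_ext (c m n i)), oact = (\<lambda>n p \<sigma>. lin_ext (a n \<sigma>) p) \<rparr>"
    and u_closed: "u \<in> B 1"
    and c_closed: "\<lbrakk>1 \<le> m; 1 \<le> n; i \<in> {1..m}; x \<in> B m; y \<in> B n\<rbrakk> \<Longrightarrow> c m n i x y \<in> B (m + n - 1)"
    and a_closed: "\<lbrakk>1 \<le> n; \<sigma> permutes {1..n}; x \<in> B n\<rbrakk> \<Longrightarrow> a n \<sigma> x \<in> B n"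
begin

lemma P_simps [simp]: "opsp P n = free_vs (B n)" "ounit P = basis u"
  "ocomp P m n i = bilin_ext (c m n i)" "oact P n p \<sigma> = lin_ext (a n \<sigma>) p"
  by (simp_all add: P_def)

lemma is_linear_operad: "linear_operad P"
proof (rule linear_operad.intro)
  fix m n i :: nat and g :: "'x \<Rightarrow>\<^sub>0 'k" assume h: "1 \<le> m" "1 \<le> n" "i \<in> {1..m}" "g \<in> carr (opsp P n)"
  show "vlinear (opsp P m) (opsp P (m + n - 1)) (\<lambda>f. ocomp P m n i f g)"
    unfolding P_simps
    by (rule plinear_vlinear[OF bilin_ext_linear1])
      (use h c_closed[OF h(1-3)] keys_lin_ext in \<open>fastforce simp: bilin_ext_basis1\<close>)
next
  fix m n i :: nat and f :: "'x \<Rightarrow>\<^sub>0 'k" assume h: "1 \<le> m" "1 \<le> n" "i \<in> {1..m}" "f \<in> carr (opsp P m)"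
  show "vlinear (opsp P n) (opsp P (m + n - 1)) (\<lambda>g. ocomp P m n i f g)"
    unfolding P_simps
    by (rule plinear_vlinear[OF bilin_ext_linear2])
      (use h c_closed[OF h(1-3)] keys_lin_ext in \<open>fastforce simp: bilin_ext_basis2\<close>)
next
  fix n :: nat and \<sigma> assume h: "1 \<le> n" "\<sigma> permutes {1..n}"
  show "vlinear (opsp P n) (opsp P n) (\<lambda>f. oact P n f \<sigma>)"
    unfolding P_simps
    by (rule plinear_vlinear[OF lin_ext_linear]) (use h a_closed in auto)
qed (use u_closed in \<open>auto simp: free_vspace\<close>)

lemma homI:
  assumes Q: "linear_operad Q"
    and lin: "\<And>n. 1 \<le> n \<Longrightarrow> vlinear (free_vs (B n)) (opsp Q n) (\<phi> n)"
    and unit: "\<phi> 1 (basis u) = ounit Q"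
    and comp: "\<And>m n i x y. \<lbrakk>1 \<le> m; 1 \<le> n; i \<in> {1..m}; x \<in> B m; y \<in> B n\<rbrakk> \<Longrightarrow>
      \<phi> (m + n - 1) (basis (c m n i x y)) = ocomp Q m n i (\<phi> m (basis x)) (\<phi> n (basis y))"
    and act: "\<And>n \<sigma> x. \<lbrakk>1 \<le> n; \<sigma> permutes {1..n}; x \<in> B n\<rbrakk> \<Longrightarrow>
      \<phi> n (basis (a n \<sigma> x)) = oact Q n (\<phi> n (basis x)) \<sigma>"
  shows "operad_hom P Q \<phi>"
proof -
  interpret Q: linear_operad Q by fact
  interpret P: linear_operad P by (rule is_linear_operad)
  have z: "\<phi> n 0 = vzero (opsp Q n)" if "1 \<le> n" for n
    using vlinear_zero[OF lin[OF that] free_vspace Q.opsp_vspace[OF that]] by simp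
  have cl: "\<phi> n p \<in> carr (opsp Q n)" if "1 \<le> n" "Poly_Mapping.keys p \<subseteq> B n" for n p
    using vlinearD(1)[OF lin[OF that(1)]] that(2) by simp
  have step: "\<phi> n (p + psc b q) = vadd (opsp Q n) (\<phi> n p) (vsmul (opsp Q n) b (\<phi> n q))"
    if "1 \<le> n" "Poly_Mapping.keys p \<subseteq> B n" "Poly_Mapping.keys q \<subseteq> B n" for n p b q
    using vlinearD(2,3)[OF lin[OF that(1)]] that pm.subspace_scale[OF subspace_keys, of q "B n" b] by simp
  have k: "Poly_Mapping.keys (bilin_ext (c m n i) p q) \<subseteq> B (m + n - 1)"
    if "1 \<le> m" "1 \<le> n" "i \<in> {1..m}" "Poly_Mapping.keys p \<subseteq> B m" "Poly_Mapping.keys q \<subseteq> B n" for m n i and p q :: "'x \<Rightarrow>\<^sub>0 'k"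
    using P.comp_closed[OF that(1-3), of p q] that(4,5) unfolding P_simps by simp
  have ka: "Poly_Mapping.keys (lin_ext (a n \<sigma>) p) \<subseteq> B n"
    if "1 \<le> n" "\<sigma> permutes {1..n}" "Poly_Mapping.keys p \<subseteq> B n" for n \<sigma> and p :: "'x \<Rightarrow>\<^sub>0 'k"
    using P.act_closed[OF that(1,2), of p] that(3) unfolding P_simps by simp
  note [simp] = Q.opsp_vspace vspace.smul_closed[OF Q.opsp_vspace]
  \<comment> \<open>Bilinearity is used one factor at a time: first q varies against a basis
    element, then p against an arbitrary q.\<close>
  have comp1: "\<phi> (m + n - 1) (bilin_ext (c m n i) (basis x) q) = ocomp Q m n i (\<phi> m (basis x)) (\<phi> n q)"
    if h: "1 \<le> m" "1 \<le> n" "i \<in> {1..m}" and x: "x \<in> B m" and q: "Poly_Mapping.keys q \<subseteq> B n" for m n i x q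
    using q
  proof (induction q rule: pm_induct)
    case zero
    then show ?case using z[OF arity_pos] z h Q.comp_zero2[OF h cl] x arity_pos[of m n]
      by (simp add: linear_zero'[OF bilin_ext_linear2] z)
  next
    case (add q b y)
    have "\<phi> (m + n - 1) (bilin_ext (c m n i) (basis x) (q + psc b (basis y))) =
        \<phi> (m + n - 1) (bilin_ext (c m n i) (basis x) q + psc b (basis (c m n i x y)))"
      by (simp add: bilin_ext_add2)
    also have "\<dots> = vadd (opsp Q (m + n - 1)) (\<phi> (m + n - 1) (bilin_ext (c m n i) (basis x) q))
       (vsmul (opsp Q (m + n - 1)) b (\<phi> (m + n - 1) (basis (c m n i x y))))"
      using h x add k[OF h] c_closed[OF h] arity_pos[of m n] by (intro step) auto
    also have "\<dots> = ocomp Q m n i (\<phi> m (basis x)) (\<phi> n (q + psc b (basis y)))"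
    proof -
      have e: "\<phi> n (q + psc b (basis y)) = vadd (opsp Q n) (\<phi> n q) (vsmul (opsp Q n) b (\<phi> n (basis y)))"
        using h add by (intro step) auto
      have c: "\<phi> m (basis x) \<in> carr (opsp Q m)" "\<phi> n (basis y) \<in> carr (opsp Q n)" "\<phi> n q \<in> carr (opsp Q n)"
        using h x add cl by simp_all
      show ?thesis
        unfolding e comp[OF h x add(2)] add(3)
        using c h by (simp add: Q.comp_add2[OF h] Q.comp_smul2[OF h])
    qed
    finally show ?case .
  qed
  have comp2: "\<phi> (m + n - 1) (bilin_ext (c m n i) p q) = ocomp Q m n i (\<phi> m p) (\<phi> n q)"
    if h: "1 \<le> m" "1 \<le> n" "i \<in> {1..m}" and p: "Poly_Mapping.keys p \<subseteq> B m" and q: "Poly_Mapping.keys q \<subseteq> B n"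
    for m n i p q
    using p
  proof (induction p rule: pm_induct)
    case zero
    then show ?case using z[OF arity_pos] z h Q.comp_zero1[OF h cl] q arity_pos[of m n]
      by (simp add: linear_zero'[OF bilin_ext_linear1] z)
  next
    case (add p b x)
    have "\<phi> (m + n - 1) (bilin_ext (c m n i) (p + psc b (basis x)) q) =
        \<phi> (m + n - 1) (bilin_ext (c m n i) p q + psc b (bilin_ext (c m n i) (basis x) q))"
      by (simp only: bilin_ext_add1 linear_psc[OF bilin_ext_linear1])
    also have "\<dots> = vadd (opsp Q (m + n - 1)) (\<phi> (m + n - 1) (bilin_ext (c m n i) p q))
       (vsmul (opsp Q (m + n - 1)) b (\<phi> (m + n - 1) (bilin_ext (c m n i) (basis x) q)))"
      using h add q k[OF h] arity_pos[of m n] by (intro step) auto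
    also have "\<dots> = ocomp Q m n i (\<phi> m (p + psc b (basis x))) (\<phi> n q)"
    proof -
      have e: "\<phi> m (p + psc b (basis x)) = vadd (opsp Q m) (\<phi> m p) (vsmul (opsp Q m) b (\<phi> m (basis x)))"
        using h add by (intro step) auto
      have c: "\<phi> m (basis x) \<in> carr (opsp Q m)" "\<phi> n q \<in> carr (opsp Q n)" "\<phi> m p \<in> carr (opsp Q m)"
        using h q add cl by simp_all
      show ?thesis
        unfolding e comp1[OF h add(2) q] add(3)
        using c h by (simp add: Q.comp_add1[OF h] Q.comp_smul1[OF h])
    qed
    finally show ?case .
  qed
  have act2: "\<phi> n (lin_ext (a n \<sigma>) p) = oact Q n (\<phi> n p) \<sigma>"
    if h: "1 \<le> n" "\<sigma> permutes {1..n}" and p: "Poly_Mapping.keys p \<subseteq> B n" for n \<sigma> p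
    using p
  proof (induction p rule: pm_induct)
    case zero
    then show ?case using z h Q.act_zero by simp
  next
    case (add p b x)
    have "\<phi> n (lin_ext (a n \<sigma>) (p + psc b (basis x))) = \<phi> n (lin_ext (a n \<sigma>) p + psc b (basis (a n \<sigma> x)))"
      by (simp add: lin_ext_add)
    also have "\<dots> = vadd (opsp Q n) (\<phi> n (lin_ext (a n \<sigma>) p)) (vsmul (opsp Q n) b (\<phi> n (basis (a n \<sigma> x))))"
      using h add ka[OF h] a_closed[OF h] by (intro step) auto
    also have "\<dots> = oact Q n (vadd (opsp Q n) (\<phi> n p) (vsmul (opsp Q n) b (\<phi> n (basis x)))) \<sigma>"
      using h add cl by (simp add: vlinearD(2,3)[OF Q.act_linear[OF h]] act)
    also have "\<dots> = oact Q n (\<phi> n (p + psc b (basis x))) \<sigma>"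
      using h add by (subst step) auto
    finally show ?case .
  qed
  show ?thesis
    unfolding operad_hom_def P_simps
    using lin unit comp2 act2 by auto
qed

text \<open>Composition being bilinear, it suffices to compose a spanning element with a basis
  element on either side.\<close>

lemma span_idealI:
  assumes S: "\<And>n. 1 \<le> n \<Longrightarrow> S n \<subseteq> {p. Poly_Mapping.keys p \<subseteq> B n}"
    and comp1: "\<And>m n i p y. \<lbrakk>1 \<le> m; 1 \<le> n; i \<in> {1..m}; p \<in> S m; y \<in> B n\<rbrakk> \<Longrightarrow>
      lin_ext (\<lambda>x. c m n i x y) p \<in> pm.span (S (m + n - 1))"
    and comp2: "\<And>m n i x q. \<lbrakk>1 \<le> m; 1 \<le> n; i \<in> {1..m}; x \<in> B m; q \<in> S n\<rbrakk> \<Longrightarrow>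
      lin_ext (c m n i x) q \<in> pm.span (S (m + n - 1))"
    and act: "\<And>n \<sigma> p. \<lbrakk>1 \<le> n; \<sigma> permutes {1..n}; p \<in> S n\<rbrakk> \<Longrightarrow> lin_ext (a n \<sigma>) p \<in> pm.span (S n)"
    and I: "\<And>n. 1 \<le> n \<Longrightarrow> I n = pm.span (S n)"
  shows "operadic_ideal P I"
  unfolding operadic_ideal_def P_simps
proof (intro conjI allI impI ballI)
  fix n :: nat assume "1 \<le> n"
  then show "vsubspace (free_vs (B n)) (I n)"
    using pm.span_minimal[OF S subspace_keys] I pm.subspace_span by (simp add: free_subspace_iff)
next
  fix m n i :: nat and p q :: "'x \<Rightarrow>\<^sub>0 'k"
  assume h: "1 \<le> m" "1 \<le> n" "i \<in> {1..m}" and p: "p \<in> carr (free_vs (B m))" and q: "q \<in> carr (free_vs (B n))"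
    and "p \<in> I m \<or> q \<in> I n"
  then show "bilin_ext (c m n i) p q \<in> I (m + n - 1)"
    unfolding I[OF h(1)] I[OF h(2)] I[OF arity_pos[OF h(1,2)]]
  proof (elim disjE)
    assume p: "p \<in> pm.span (S m)"
    show "bilin_ext (c m n i) p q \<in> pm.span (S (m + n - 1))"
    proof (rule linear_mem_on_basis[OF bilin_ext_linear2 pm.subspace_span])
      fix y assume "y \<in> Poly_Mapping.keys q"
      then have y: "y \<in> B n" using q by auto
      then show "bilin_ext (c m n i) p (basis y) \<in> pm.span (S (m + n - 1))"
        unfolding bilin_ext_basis2
        by - (rule linear_span_mem[OF lin_ext_linear pm.subspace_span _ p], rule comp1[OF h _ y])
    qed
  next
    assume q: "q \<in> pm.span (S n)"
    show "bilin_ext (c m n i) p q \<in> pm.span (S (m + n - 1))"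
    proof (rule linear_mem_on_basis[OF bilin_ext_linear1 pm.subspace_span])
      fix x assume "x \<in> Poly_Mapping.keys p"
      then have x: "x \<in> B m" using p by auto
      then show "bilin_ext (c m n i) (basis x) q \<in> pm.span (S (m + n - 1))"
        unfolding bilin_ext_basis1
        by - (rule linear_span_mem[OF lin_ext_linear pm.subspace_span _ q], rule comp2[OF h x])
    qed
  qed
next
  fix n \<sigma> and p :: "'x \<Rightarrow>\<^sub>0 'k" assume h: "1 \<le> n" "\<sigma> permutes {1..n}" "p \<in> I n"
  then show "lin_ext (a n \<sigma>) p \<in> I n"
    unfolding I[OF h(1)]
    using linear_span_mem[OF lin_ext_linear pm.subspace_span act[OF h(1,2)]] by simp
qed

end

section \<open>Grafting and the free operad\<close>

lemma leaves_graft: "leaves (graft \<rho> t) = concat (map (\<lambda>k. leaves (\<rho> k)) (leaves t))"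
  by (induction t) auto

lemma set_btree_graft:
  "set_btree (graft \<rho> t) = set_btree t \<union> (\<Union>k\<in>set (leaves t). set_btree (\<rho> k))"
  by (induction t) auto

lemma graft_graft: "graft \<rho> (graft \<sigma> t) = graft (\<lambda>k. graft \<rho> (\<sigma> k)) t"
  by (induction t) auto

lemma graft_cong: "(\<And>k. k \<in> set (leaves t) \<Longrightarrow> \<rho> k = \<rho>' k) \<Longrightarrow> graft \<rho> t = graft \<rho>' t"
  by (induction t) auto

lemma graft_Lf: "graft Lf t = t"
  by (induction t) auto

lemma distinct_concat_map:
  assumes "distinct xs" "\<And>k. k \<in> set xs \<Longrightarrow> distinct (g k)"
    "\<And>k k'. \<lbrakk>k \<in> set xs; k' \<in> set xs; k \<noteq> k'\<rbrakk> \<Longrightarrow> set (g k) \<inter> set (g k') = {}"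
  shows "distinct (concat (map g xs))"
  using assms
proof (induction xs)
  case (Cons x xs)
  have "set (g x) \<inter> set (g k) = {}" if "k \<in> set xs" for k
    using Cons.prems(3)[of x k] Cons.prems(1) that by auto
  moreover have "distinct (concat (map g xs))" using Cons by auto
  ultimately show ?case using Cons.prems(2) by auto
qed simp

lemma trees_perm:
  assumes "t \<in> trees E n" "\<pi> permutes {1..n}"
  shows "graft (\<lambda>k. Lf (\<pi> k)) t \<in> trees E n"
proof -
  have "distinct (concat (map (\<lambda>k. [\<pi> k]) (leaves t)))"
    using assms permutes_inj[OF assms(2)]
    by (intro distinct_concat_map) (auto simp: trees_def inj_eq)
  moreover have "\<pi> ` {1..n} = {1..n}" by (rule permutes_image[OF assms(2)])
  ultimately show ?thesis
    using assms(1) by (auto simp: trees_def leaves_graft set_btree_graft)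
qed

lemma trees_comp:
  assumes "1 \<le> n" "i \<in> {1..m}" "S \<in> trees E m" "T \<in> trees E n"
  shows "tree_comp n i S T \<in> trees E (m + n - 1)"
proof -
  \<comment> \<open>\<open>g k\<close> lists the labels into which leaf k of S turns. They form
    disjoint blocks that fill {1..m + n - 1}.\<close>
  define g where "g k = (if k < i then [k] else if k = i then map (\<lambda>j. j + i - 1) (leaves T) else [k + n - 1])" for k
  have S: "distinct (leaves S)" "set (leaves S) = {1..m}" "set_btree S \<subseteq> carr E"
    and T: "distinct (leaves T)" "set (leaves T) = {1..n}" "set_btree T \<subseteq> carr E"
    using assms by (auto simp: trees_def)
  have l: "leaves (tree_comp n i S T) = concat (map g (leaves S))"
    unfolding tree_comp_def leaves_graft
    by (intro arg_cong[where f = concat] map_cong refl) (auto simp: g_def leaves_graft concat_map_singleton)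
  have gs: "set (g k) = (if k < i then {k} else if k = i then {i..i + n - 1} else {k + n - 1})" for k
  proof -
    have "(\<lambda>j. j + i - 1) ` {1..n} = {i..i + n - 1}"
    proof
      show "{i..i + n - 1} \<subseteq> (\<lambda>j. j + i - 1) ` {1..n}"
      proof
        fix x assume "x \<in> {i..i + n - 1}"
        then show "x \<in> (\<lambda>j. j + i - 1) ` {1..n}"
          using assms(1,2) by (intro image_eqI[of _ _ "x + 1 - i"]) auto
      qed
    qed (use assms(1,2) in auto)
    then show ?thesis by (simp add: g_def T)
  qed
  have "distinct (leaves (tree_comp n i S T))"
    unfolding l
  proof (rule distinct_concat_map[OF S(1)])
    show "distinct (g k)" for k
      using T(1) assms(2) by (auto simp: g_def distinct_map inj_on_def)
    show "set (g k) \<inter> set (g k') = {}" if "k \<noteq> k'" for k k'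
      using that assms(1,2) by (auto simp: gs)
  qed
  moreover have "set (leaves (tree_comp n i S T)) = {1..m + n - 1}"
  proof
    show "set (leaves (tree_comp n i S T)) \<subseteq> {1..m + n - 1}"
      using assms(1,2) by (auto simp: l gs S split: if_splits)
    show "{1..m + n - 1} \<subseteq> set (leaves (tree_comp n i S T))"
    proof
      fix x assume x: "x \<in> {1..m + n - 1}"
      \<comment> \<open>The leaf of S whose block contains x. Labels from i + n on were shifted by n
        - 1, hence x + 1 - n.\<close>
      define k where "k = (if x < i then x else if x < i + n then i else x + 1 - n)"
      have "k \<in> {1..m}" "x \<in> set (g k)" using x assms(1,2) by (auto simp: k_def gs)
      then show "x \<in> set (leaves (tree_comp n i S T))" by (auto simp: l S)
    qed
  qed
  moreover have "set_btree (tree_comp n i S T) \<subseteq> carr E"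
    using S T by (auto simp: tree_comp_def set_btree_graft split: if_splits)
  ultimately show ?thesis by (simp add: trees_def)
qed

interpretation tree: basis_operad "tree_operad E" "trees E" "Lf 1" "\<lambda>m n i. tree_comp n i"
    "\<lambda>n \<sigma>. graft (\<lambda>k. Lf (inv \<sigma> k))"
  for E :: "('k::field, 'e, 'z) vs_scheme"
proof
  show "Lf 1 \<in> trees E 1" by (simp add: trees_def)
  show "graft (\<lambda>k. Lf (inv \<sigma> k)) t \<in> trees E n" if "\<sigma> permutes {1..n}" "t \<in> trees E n" for n \<sigma> t
    using trees_perm[OF that(2) permutes_inv[OF that(1)]] .
qed (use trees_comp in \<open>simp_all add: tree_operad_def\<close>)

lemma trees_arity: "t \<in> trees E n \<Longrightarrow> 1 \<le> n"
proof -
  assume t: "t \<in> trees E n"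
  have "leaves t \<noteq> []" by (induction t) auto
  then have "set (leaves t) \<noteq> {}" by simp
  then show "1 \<le> n" using t by (cases n) (auto simp: trees_def)
qed

text \<open>Tree monomials are generated from the unit and the corollas by composition and
  permutation. This carries properties of the generating brackets to all operations.\<close>

lemma trees_induct [consumes 1, case_names unit corolla comp act]:
  fixes E :: "('k::field, 'e, 'z) vs_scheme"
  assumes t: "t \<in> trees E n"
    and unit: "P 1 (Lf 1)"
    and corolla: "\<And>e. e \<in> carr E \<Longrightarrow> P 2 (Nd e (Lf 1) (Lf 2))"
    and comp: "\<And>m n i S T. \<lbrakk>1 \<le> m; 1 \<le> n; i \<in> {1..m}; S \<in> trees E m; T \<in> trees E n; P m S; P n T\<rbrakk> \<Longrightarrow>
      P (m + n - 1) (tree_comp n i S T)"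
    and act: "\<And>n \<sigma> t. \<lbrakk>1 \<le> n; \<sigma> permutes {1..n}; t \<in> trees E n; P n t\<rbrakk> \<Longrightarrow> P n (graft (\<lambda>k. Lf (inv \<sigma> k)) t)"
  shows "P n t"
proof -
  \<comment> \<open>The leaves of a subtree are not numbered from 1, so the claim is generalised to
    all relabellings \<beta> of a tree onto {1..n}.\<close>
  have "P n (graft (\<lambda>k. Lf (\<beta> k)) t) \<and> graft (\<lambda>k. Lf (\<beta> k)) t \<in> trees E n"
    if "distinct (leaves t)" "set_btree t \<subseteq> carr E" "bij_betw \<beta> (set (leaves t)) {1..n}" for \<beta>
    using that
  proof (induction t arbitrary: n \<beta>)
    case (Lf j)
    then have "{1..n} = {\<beta> j}" by (auto simp: bij_betw_def)
    moreover have "card {1..n} = 1" unfolding calculation by simp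
    ultimately have "n = 1" "\<beta> j = 1" by auto
    then show ?case using unit by (simp add: trees_def)
  next
    case (Nd e l r)
    let ?L = "set (leaves l)" and ?R = "set (leaves r)"
    have LR: "?L \<inter> ?R = {}" and dl: "distinct (leaves l)" and dr: "distinct (leaves r)"
      using Nd.prems by auto
    define a b where "a = card ?L" and "b = card ?R"
    obtain h1 where h1: "bij_betw h1 {1..a} ?L" using ex_bij_betw_nat_finite_1[of ?L] a_def by auto
    obtain h2 where h2: "bij_betw h2 {1..b} ?R" using ex_bij_betw_nat_finite_1[of ?R] b_def by auto
    define b1 b2 where "b1 = inv_into {1..a} h1" and "b2 = inv_into {1..b} h2"
    have b1: "bij_betw b1 ?L {1..a}" and b2: "bij_betw b2 ?R {1..b}"
      using bij_betw_inv_into[OF h1] bij_betw_inv_into[OF h2] by (simp_all add: b1_def b2_def)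
    define l0 r0 where "l0 = graft (\<lambda>k. Lf (b1 k)) l" and "r0 = graft (\<lambda>k. Lf (b2 k)) r"
    have l0: "P a l0" "l0 \<in> trees E a" and r0: "P b r0" "r0 \<in> trees E b"
      using Nd.IH(1)[OF dl _ b1] Nd.IH(2)[OF dr _ b2] Nd.prems(2) by (auto simp: l0_def r0_def)
    have e: "e \<in> carr E" using Nd.prems by simp
    have ab: "1 \<le> a" "1 \<le> b" using l0 r0 trees_arity by auto
    let ?c = "Nd e (Lf 1) (Lf 2)"
    have c: "?c \<in> trees E 2" using e by (auto simp: trees_def)
    \<comment> \<open>Slot 2 of the corolla is filled first, so that slot 1 keeps its number. The
      leaves from l then occupy 1..a and those from r occupy a + 1..a + b.\<close>
    define u where "u = tree_comp a 1 (tree_comp b 2 ?c r0) l0"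
    have s: "tree_comp b 2 ?c r0 \<in> trees E (2 + b - 1)"
      using trees_comp[OF ab(2) _ c r0(2), of 2] by simp
    have Ps: "P (2 + b - 1) (tree_comp b 2 ?c r0)"
      using comp[OF _ ab(2) _ c r0(2) corolla[OF e] r0(1), of 2] by simp
    have u: "u \<in> trees E (2 + b - 1 + a - 1)" "P (2 + b - 1 + a - 1) u"
      unfolding u_def using trees_comp[OF ab(1) _ s l0(2), of 1] comp[OF _ ab(1) _ s l0(2) Ps l0(1), of 1] by simp_all
    have u_eq: "u = Nd e l0 (graft (\<lambda>j. Lf (j + a)) r0)"
    proof -
      have "\<forall>j\<in>set (leaves r0). 1 \<le> j" using r0 by (auto simp: trees_def)
      then show ?thesis
        by (auto simp: u_def tree_comp_def graft_graft graft_Lf intro!: graft_cong)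
    qed
    \<comment> \<open>The number in u of the leaf that is called x in the original tree.\<close>
    define \<delta> where "\<delta> x = (if x \<in> ?L then b1 x else b2 x + a)" for x
    have d: "bij_betw \<delta> (?L \<union> ?R) {1..a + b}"
    proof -
      have "bij_betw \<delta> ?L {1..a}"
        using b1 by (subst bij_betw_cong[of _ _ b1]) (auto simp: \<delta>_def)
      moreover have "bij_betw \<delta> ?R {a + 1..a + b}"
      proof -
        have "bij_betw (\<lambda>x. x + a) {1..b} {a + 1..a + b}"
          by (rule bij_betwI[where g = "\<lambda>x. x - a"]) auto
        from bij_betw_trans[OF b2 this] show ?thesis
          by (rule bij_betw_cong[THEN iffD1, rotated]) (use LR in \<open>auto simp: \<delta>_def\<close>)
      qed
      moreover have "{1..a} \<union> {a + 1..a + b} = {1..a + b}" by auto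
      ultimately show ?thesis using bij_betw_combine[of \<delta> ?L "{1..a}" ?R "{a + 1..a + b}"] by simp
    qed
    have n: "n = a + b"
      using bij_betw_same_card[OF Nd.prems(3)] bij_betw_same_card[OF d] by simp
    \<comment> \<open>The permutation that sends the number \<delta> x to the prescribed label
      \<beta> x. Since the action relabels by the inverse, it is \<open>inv \<gamma>\<close> that
      acts on u below.\<close>
    define \<gamma> where "\<gamma> k = (if k \<in> {1..n} then \<beta> (inv_into (?L \<union> ?R) \<delta> k) else k)" for k
    have "bij_betw \<gamma> {1..n} {1..n}"
    proof -
      have "bij_betw (\<beta> \<circ> inv_into (?L \<union> ?R) \<delta>) {1..n} {1..n}"
        using bij_betw_trans[OF bij_betw_inv_into[OF d]] Nd.prems(3) n by simp
      then show ?thesis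
        by (rule bij_betw_cong[THEN iffD1, rotated]) (auto simp: \<gamma>_def)
    qed
    then have \<gamma>: "\<gamma> permutes {1..n}" by (rule bij_imp_permutes) (auto simp: \<gamma>_def)
    have g\<delta>: "\<gamma> (\<delta> x) = \<beta> x" if "x \<in> ?L \<union> ?R" for x
    proof -
      have "\<delta> x \<in> {1..n}" using bij_betw_apply[OF d that] n by simp
      moreover have "inv_into (?L \<union> ?R) \<delta> (\<delta> x) = x"
        using bij_betw_imp_inj_on[OF d] that by (rule inv_into_f_f)
      ultimately show ?thesis by (simp add: \<gamma>_def)
    qed
    have "graft (\<lambda>k. Lf (inv (inv \<gamma>) k)) u = Nd e (graft (\<lambda>k. Lf (\<gamma> (b1 k))) l) (graft (\<lambda>k. Lf (\<gamma> (b2 k + a))) r)"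
      by (simp add: u_eq l0_def r0_def graft_graft permutes_inv_inv[OF \<gamma>])
    also have "\<dots> = graft (\<lambda>k. Lf (\<beta> k)) (Nd e l r)"
    proof -
      have "\<gamma> (b1 k) = \<beta> k" if "k \<in> ?L" for k using g\<delta>[of k] that by (simp add: \<delta>_def)
      moreover have "\<gamma> (b2 k + a) = \<beta> k" if "k \<in> ?R" for k
      proof -
        have "k \<notin> ?L" using that LR by blast
        then show ?thesis using g\<delta>[of k] that by (simp add: \<delta>_def)
      qed
      ultimately show ?thesis by (auto intro!: graft_cong)
    qed
    finally have g: "graft (\<lambda>k. Lf (\<beta> k)) (Nd e l r) = graft (\<lambda>k. Lf (inv (inv \<gamma>) k)) u" by simp
    have u': "u \<in> trees E n" "P n u" using u n by (simp_all add: add.commute)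
    show ?case
      unfolding g using act[OF trees_arity[OF u'(1)] permutes_inv[OF \<gamma>] u'] tree.a_closed[OF trees_arity[OF u'(1)] permutes_inv[OF \<gamma>] u'(1)] by simp
  qed
  from this[of "\<lambda>x. x"] show ?thesis
    using t by (simp add: trees_def graft_Lf bij_betw_def)
qed

section \<open>Stability of the tree relators under grafting\<close>

lemma graft_relators: "p \<in> tree_relators E \<Longrightarrow> lin_ext (graft \<rho>) p \<in> tree_relators E"
proof (induction rule: tree_relators.induct)
  case (rel_left p e r)
  then show ?case
    using tree_relators.rel_left[OF rel_left.IH, of e "graft \<rho> r"] by (simp add: lin_ext_lin_ext)
next
  case (rel_right p e l)
  then show ?case
    using tree_relators.rel_right[OF rel_right.IH, of e "graft \<rho> l"] by (simp add: lin_ext_lin_ext)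
qed (auto simp: lin_ext_diff intro: tree_relators.intros)

text \<open>The path from the root of S to leaf i becomes a chain of \<open>rel_left\<close> and
  \<open>rel_right\<close>. Distinct leaves make the path unique; a tree with two copies of leaf i
  would not be linear in T.\<close>

lemma graft_into_relators:
  assumes "q \<in> tree_relators E"
  shows "distinct (leaves S) \<Longrightarrow> i \<in> set (leaves S) \<Longrightarrow>
    lin_ext (\<lambda>T. graft (\<lambda>k. if k = i then T else \<rho> k) S) q \<in> tree_relators E"
proof (induction S)
  case (Lf j)
  then show ?case using assms by (simp add: lin_ext_id)
next
  case (Nd e l r)
  have c: "graft (\<lambda>k. if k = i then T else \<rho> k) s = graft \<rho> s" if "i \<notin> set (leaves s)" for s T
    by (rule graft_cong) (use that in auto)
  show ?case
  proof (cases "i \<in> set (leaves l)")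
    case True
    then have "i \<notin> set (leaves r)" using Nd.prems by auto
    then show ?thesis
      using tree_relators.rel_left[OF Nd.IH(1), of e "graft \<rho> r"] True Nd.prems
      by (simp add: c lin_ext_lin_ext)
  next
    case False
    then show ?thesis
      using tree_relators.rel_right[OF Nd.IH(2), of e "graft \<rho> l"] Nd.prems
      by (simp add: c lin_ext_lin_ext)
  qed
qed

lemma comp_relators1:
  "p \<in> tree_relators E \<Longrightarrow> lin_ext (\<lambda>S. tree_comp n i S T) p \<in> tree_relators E"
  unfolding tree_comp_def by (rule graft_relators)

lemma comp_relators2:
  assumes "q \<in> tree_relators E" "S \<in> trees E m" "i \<in> {1..m}"
  shows "lin_ext (tree_comp n i S) q \<in> tree_relators E"
proof -
  \<comment> \<open>Composition is factored into a relabelling of T and the insertion of the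
    relabelled tree at the single leaf i.\<close>
  have "lin_ext (tree_comp n i S) q = lin_ext (\<lambda>T. graft (\<lambda>k. if k = i then T
      else if k < i then Lf k else Lf (k + n - 1)) S) (lin_ext (graft (\<lambda>j. Lf (j + i - 1))) q)"
    unfolding lin_ext_lin_ext
    by (intro lin_ext_cong) (auto simp: tree_comp_def intro!: graft_cong)
  then show ?thesis
    using graft_into_relators[OF graft_relators[OF assms(1)], of S i] assms(2,3) by (simp add: trees_def)
qed

lemma free_null_eq: "free_null E n = pm.span (tree_relators E \<inter> {p. Poly_Mapping.keys p \<subseteq> trees E n})"
  unfolding free_null_def by (subst free_vspan) auto

lemma free_null_ideal: "operadic_ideal (tree_operad E) (free_null E)"
proof (rule tree.span_idealI[where S = "\<lambda>n. tree_relators E \<inter> {p. Poly_Mapping.keys p \<subseteq> trees E n}"])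
  fix m n i p T
  assume "1 \<le> m" "1 \<le> n" "i \<in> {1..m}" "p \<in> tree_relators E \<inter> {p. Poly_Mapping.keys p \<subseteq> trees E m}" "T \<in> trees E n"
  then show "lin_ext (\<lambda>S. tree_comp n i S T) p \<in>
      pm.span (tree_relators E \<inter> {p. Poly_Mapping.keys p \<subseteq> trees E (m + n - 1)})"
    using keys_lin_ext[of "\<lambda>S. tree_comp n i S T" p] trees_comp[of n i m]
    by (intro pm.span_base) (fastforce intro: comp_relators1)
next
  fix m n i S p
  assume "1 \<le> m" "1 \<le> n" "i \<in> {1..m}" "S \<in> trees E m" "p \<in> tree_relators E \<inter> {p. Poly_Mapping.keys p \<subseteq> trees E n}"
  then show "lin_ext (tree_comp n i S) p \<in>
      pm.span (tree_relators E \<inter> {p. Poly_Mapping.keys p \<subseteq> trees E (m + n - 1)})"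
    using keys_lin_ext[of "tree_comp n i S" p] trees_comp[of n i m]
    by (intro pm.span_base) (fastforce intro: comp_relators2)
next
  fix n \<sigma> p
  assume "1 \<le> n" "\<sigma> permutes {1..n}" "p \<in> tree_relators E \<inter> {p. Poly_Mapping.keys p \<subseteq> trees E n}"
  then show "lin_ext (graft (\<lambda>k. Lf (inv \<sigma> k))) p \<in> pm.span (tree_relators E \<inter> {p. Poly_Mapping.keys p \<subseteq> trees E n})"
    using keys_lin_ext[of "graft (\<lambda>k. Lf (inv \<sigma> k))" p] tree.a_closed[of n \<sigma>]
    by (intro pm.span_base) (fastforce intro: graft_relators)
qed (auto simp: free_null_eq)

interpretation free: operad_quotient "tree_operad E" "free_null E"
  rewrites "quot_operad (tree_operad E) (free_null E) = free_operad E"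
  for E :: "('k::field, 'e, 'z) s2mod_scheme"
  by (simp_all add: operad_quotient_def operad_quotient_axioms_def tree.is_linear_operad free_null_ideal free_operad_def)

text \<open>All trees of a relator share the multiset of leaves and the answer to whether every
  label lies in E. Relators of all arities live in one set; this lets them be sorted when the
  splitting is cut down to one arity.\<close>

lemma relators_homogeneous:
  fixes E :: "('k::field, 'e, 'z) s2mod_scheme"
  assumes "s2_module E" "p \<in> tree_relators E"
  shows "Poly_Mapping.keys p \<subseteq> trees E n \<or> Poly_Mapping.keys p \<inter> trees E n = {}"
proof -
  interpret s2_module E by fact
  define Q where "Q M b t \<longleftrightarrow> mset (leaves t) = M \<and> (set_btree t \<subseteq> carr E \<longleftrightarrow> b)" for M b t
  have ex: "\<exists>M b. \<forall>t\<in>Poly_Mapping.keys p. Q M b t"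
    if "Poly_Mapping.keys p \<subseteq> X" "\<And>t. t \<in> X \<Longrightarrow> Q M b t" for p :: "'e btree \<Rightarrow>\<^sub>0 'k" and X M b
    using that by blast
  have "\<exists>M b. \<forall>t\<in>Poly_Mapping.keys p. Q M b t"
    using assms(2)
  proof (induction rule: tree_relators.induct)
    case (rel_add e e' l r)
    show ?case
      by (rule ex[OF keys_diff_subset[OF keys_diff_subset], where X = "{Nd (vadd E e e') l r, Nd e l r, Nd e' l r}"
            and M = "mset (leaves l) + mset (leaves r)" and b = "set_btree l \<subseteq> carr E \<and> set_btree r \<subseteq> carr E"])
        (use rel_add add_closed in \<open>auto simp: Q_def\<close>)
  next
    case (rel_smul e c l r)
    show ?case
      by (rule ex[OF keys_diff_subset, where X = "{Nd (vsmul E c e) l r, Nd e l r}"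
            and M = "mset (leaves l) + mset (leaves r)" and b = "set_btree l \<subseteq> carr E \<and> set_btree r \<subseteq> carr E"])
        (use rel_smul smul_closed in \<open>auto simp: Q_def split: if_splits\<close>)
  next
    case (rel_swp e l r)
    show ?case
      by (rule ex[OF keys_diff_subset, where X = "{Nd (swp E e) l r, Nd e r l}"
            and M = "mset (leaves l) + mset (leaves r)" and b = "set_btree l \<subseteq> carr E \<and> set_btree r \<subseteq> carr E"])
        (use rel_swp vlinearD(1)[OF swp_linear] in \<open>auto simp: Q_def\<close>)
  next
    case (rel_left p e r)
    then obtain M b where M: "\<forall>t\<in>Poly_Mapping.keys p. Q M b t" by blast
    show ?case
    proof (rule ex[OF keys_lin_ext, where M = "M + mset (leaves r)" and b = "e \<in> carr E \<and> b \<and> set_btree r \<subseteq> carr E"])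
      fix t assume "t \<in> (\<lambda>l. Nd e l r) ` Poly_Mapping.keys p"
      then obtain l where "l \<in> Poly_Mapping.keys p" "t = Nd e l r" by blast
      then show "Q (M + mset (leaves r)) (e \<in> carr E \<and> b \<and> set_btree r \<subseteq> carr E) t"
        using bspec[OF M, of l] by (auto simp: Q_def)
    qed
  next
    case (rel_right p e l)
    then obtain M b where M: "\<forall>t\<in>Poly_Mapping.keys p. Q M b t" by blast
    show ?case
    proof (rule ex[OF keys_lin_ext, where M = "mset (leaves l) + M" and b = "e \<in> carr E \<and> b \<and> set_btree l \<subseteq> carr E"])
      fix t assume "t \<in> (\<lambda>r. Nd e l r) ` Poly_Mapping.keys p"
      then obtain r where "r \<in> Poly_Mapping.keys p" "t = Nd e l r" by blast
      then show "Q (mset (leaves l) + M) (e \<in> carr E \<and> b \<and> set_btree l \<subseteq> carr E) t"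
        using bspec[OF M, of r] by (auto simp: Q_def)
    qed
  qed
  then obtain M b where Q: "\<And>t. t \<in> Poly_Mapping.keys p \<Longrightarrow> Q M b t" by blast
  have "t \<in> trees E n \<longleftrightarrow> t' \<in> trees E n" if "t \<in> Poly_Mapping.keys p" "t' \<in> Poly_Mapping.keys p" for t t'
  proof -
    have "mset (leaves t) = mset (leaves t')" "set_btree t \<subseteq> carr E \<longleftrightarrow> set_btree t' \<subseteq> carr E"
      using Q[OF that(1)] Q[OF that(2)] by (simp_all add: Q_def)
    then show ?thesis
      unfolding trees_def mem_Collect_eq using mset_eq_imp_distinct_iff mset_eq_setD by metis
  qed
  then show ?thesis by blast
qed

section \<open>Tensor products of operads\<close>

lemma bilinear_relators_intros:
  "\<lbrakk>v \<in> carr V; v' \<in> carr V; w \<in> carr W\<rbrakk> \<Longrightarrow>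
    basis (vadd V v v', w) - basis (v, w) - basis (v', w) \<in> bilinear_relators V W"
  "\<lbrakk>v \<in> carr V; w \<in> carr W; w' \<in> carr W\<rbrakk> \<Longrightarrow>
    basis (v, vadd W w w') - basis (v, w) - basis (v, w') \<in> bilinear_relators V W"
  "\<lbrakk>v \<in> carr V; w \<in> carr W\<rbrakk> \<Longrightarrow>
    basis (vsmul V c v, w) - Poly_Mapping.single (v, w) c \<in> bilinear_relators V W"
  "\<lbrakk>v \<in> carr V; w \<in> carr W\<rbrakk> \<Longrightarrow>
    basis (v, vsmul W c w) - Poly_Mapping.single (v, w) c \<in> bilinear_relators V W"
  unfolding bilinear_relators_def by blast+

lemma bilinear_relators_cases [consumes 1, case_names add1 add2 smul1 smul2]:
  assumes "p \<in> bilinear_relators V W"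
  obtains v v' w where "v \<in> carr V" "v' \<in> carr V" "w \<in> carr W"
      "p = basis (vadd V v v', w) - basis (v, w) - basis (v', w)"
    | v w w' where "v \<in> carr V" "w \<in> carr W" "w' \<in> carr W"
      "p = basis (v, vadd W w w') - basis (v, w) - basis (v, w')"
    | c v w where "v \<in> carr V" "w \<in> carr W" "p = basis (vsmul V c v, w) - Poly_Mapping.single (v, w) c"
    | c v w where "v \<in> carr V" "w \<in> carr W" "p = basis (v, vsmul W c w) - Poly_Mapping.single (v, w) c"
  using assms unfolding bilinear_relators_def by (elim UnE CollectE exE conjE) metis+

text \<open>Each of the four kinds of relators is preserved. Applied to composition with a fixed
  pair and to the action, this makes the tensor null spaces an ideal.\<close>

lemma bilinear_relators_map:
  assumes p: "p \<in> bilinear_relators V W" and f: "vlinear V V' f" and g: "vlinear W W' g"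
  shows "lin_ext (\<lambda>(v, w). (f v, g w)) p \<in> bilinear_relators V' W'"
  using p
proof (cases rule: bilinear_relators_cases)
qed (use vlinearD[OF f] vlinearD[OF g] in \<open>auto simp: lin_ext_diff intro: bilinear_relators_intros\<close>)

locale operad_pair = P: linear_operad P + Q: linear_operad Q
  for P :: "('k::field, 'p, 'y) operad_scheme" and Q :: "('k, 'q, 'z) operad_scheme"
begin

sublocale pair: basis_operad "pair_operad P Q" "\<lambda>n. carr (opsp P n) \<times> carr (opsp Q n)" "(ounit P, ounit Q)"
  "\<lambda>m n i (f, f') (g, g'). (ocomp P m n i f g, ocomp Q m n i f' g')"
  "\<lambda>n \<sigma> (f, f'). (oact P n f \<sigma>, oact Q n f' \<sigma>)"
  by unfold_locales
    (use P.unit_closed Q.unit_closed P.comp_closed Q.comp_closed P.act_closed Q.act_closed in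
      \<open>auto simp: pair_operad_def\<close>)

lemma tensor_ideal: "operadic_ideal (pair_operad P Q) (\<lambda>n. tensor_null (opsp P n) (opsp Q n))"
proof (rule pair.span_idealI[where S = "\<lambda>n. bilinear_relators (opsp P n) (opsp Q n)"])
  fix m n i p y
  assume h: "1 \<le> m" "1 \<le> n" "i \<in> {1..m}" and p: "p \<in> bilinear_relators (opsp P m) (opsp Q m)"
    and "y \<in> carr (opsp P n) \<times> carr (opsp Q n)"
  then obtain g g' where g: "y = (g, g')" "g \<in> carr (opsp P n)" "g' \<in> carr (opsp Q n)" by auto
  have e: "(case x of (f, f') \<Rightarrow> \<lambda>(g, g'). (ocomp P m n i f g, ocomp Q m n i f' g')) y =
      (case x of (f, f') \<Rightarrow> (ocomp P m n i f g, ocomp Q m n i f' g'))" for x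
    by (cases x) (simp add: g(1))
  show "lin_ext (\<lambda>x. (case x of (f, f') \<Rightarrow> \<lambda>(g, g'). (ocomp P m n i f g, ocomp Q m n i f' g')) y) p
    \<in> pm.span (bilinear_relators (opsp P (m + n - 1)) (opsp Q (m + n - 1)))"
    unfolding e by (intro pm.span_base bilinear_relators_map[OF p] P.comp_linear1 Q.comp_linear1 h g)
next
  fix m n i x p
  assume h: "1 \<le> m" "1 \<le> n" "i \<in> {1..m}" and p: "p \<in> bilinear_relators (opsp P n) (opsp Q n)"
    and "x \<in> carr (opsp P m) \<times> carr (opsp Q m)"
  then obtain f f' where f: "x = (f, f')" "f \<in> carr (opsp P m)" "f' \<in> carr (opsp Q m)" by auto
  show "lin_ext (case x of (f, f') \<Rightarrow> \<lambda>(g, g'). (ocomp P m n i f g, ocomp Q m n i f' g')) p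
    \<in> pm.span (bilinear_relators (opsp P (m + n - 1)) (opsp Q (m + n - 1)))"
    unfolding f(1) prod.case
    by (intro pm.span_base bilinear_relators_map[OF p] P.comp_linear2 Q.comp_linear2 h f)
next
  fix n \<sigma> p
  assume h: "1 \<le> n" "\<sigma> permutes {1..n}" and p: "p \<in> bilinear_relators (opsp P n) (opsp Q n)"
  show "lin_ext (\<lambda>(f, f'). (oact P n f \<sigma>, oact Q n f' \<sigma>)) p \<in> pm.span (bilinear_relators (opsp P n) (opsp Q n))"
    by (intro pm.span_base bilinear_relators_map[OF p] P.act_linear Q.act_linear h)
qed (simp_all add: bilinear_relators_carr tensor_null_eq P.opsp_vspace Q.opsp_vspace)

sublocale tensor: operad_quotient "pair_operad P Q" "\<lambda>n. tensor_null (opsp P n) (opsp Q n)"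
  rewrites "quot_operad (pair_operad P Q) (\<lambda>n. tensor_null (opsp P n) (opsp Q n)) = tensor_operad P Q"
  by (simp_all add: operad_quotient_def operad_quotient_axioms_def pair.is_linear_operad tensor_ideal
      tensor_operad_def)

lemma opsp_tensor: "opsp (tensor_operad P Q) n = vtensor (opsp P n) (opsp Q n)"
  by (simp add: tensor.quot_opsp vtensor_def)

end

lemma tensor_null_zero:
  assumes "vspace V" "vspace W" "v \<in> carr V" "w \<in> carr W"
  shows "basis (vzero V, w) \<in> tensor_null V W" "basis (v, vzero W) \<in> tensor_null V W"
proof -
  \<comment> \<open>Relators for the scalar 0: their second term vanishes.\<close>
  have "basis (vsmul V 0 v, w) - Poly_Mapping.single (v, w) 0 \<in> tensor_null V W"
    "basis (v, vsmul W 0 w) - Poly_Mapping.single (v, w) 0 \<in> tensor_null V W"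
    unfolding tensor_null_eq[OF assms(1,2)]
    by (intro pm.span_base bilinear_relators_intros assms)+
  then show "basis (vzero V, w) \<in> tensor_null V W" "basis (v, vzero W) \<in> tensor_null V W"
    using vspace.zero_eq[OF assms(1,3)] vspace.zero_eq[OF assms(2,4)] by simp_all
qed

text \<open>A combination of formal pairs and the pair of the combined vector are different elements
  of the free space; their difference is a sum of bilinear relators, collected term by term.\<close>

lemma tensor_linear1:
  assumes V: "vspace V" and W: "vspace W" and f: "vlinear (free_vs X) V f"
    and p: "Poly_Mapping.keys p \<subseteq> X" and w: "w \<in> carr W"
  shows "lin_ext (\<lambda>a. (f (basis a), w)) p - basis (f p, w) \<in> tensor_null V W"
  using p
proof (induction p rule: pm_induct)
  case zero
  have "f 0 = vzero V" using vlinear_zero[OF f free_vspace V] by simp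
  then show ?case
    using tensor_null_zero(1)[OF V W vspace.zero_closed[OF V] w]
    by (simp add: tensor_null_eq[OF V W] pm.span_neg)
next
  case (add p b x)
  let ?g = "\<lambda>a. (f (basis a), w)"
  have c: "f p \<in> carr V" "f (basis x) \<in> carr V"
    using vlinearD(1)[OF f] add by simp_all
  have e: "f (p + psc b (basis x)) = vadd V (f p) (vsmul V b (f (basis x)))"
    using vlinearD(2)[OF f, of p "psc b (basis x)"] vlinearD(3)[OF f, of "basis x" b] add
      pm.subspace_scale[OF subspace_keys, of "basis x" X b] by simp
  have 1: "basis (vadd V (f p) (vsmul V b (f (basis x))), w) - basis (f p, w) -
      basis (vsmul V b (f (basis x)), w) \<in> pm.span (bilinear_relators V W)" (is "?A \<in> _")
    by (intro pm.span_base bilinear_relators_intros c vspace.smul_closed[OF V] w)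
  have 2: "basis (vsmul V b (f (basis x)), w) - Poly_Mapping.single (f (basis x), w) b
      \<in> pm.span (bilinear_relators V W)" (is "?B \<in> _")
    by (intro pm.span_base bilinear_relators_intros c w)
  have eq: "lin_ext ?g (p + psc b (basis x)) - basis (f (p + psc b (basis x)), w) =
    (lin_ext ?g p - basis (f p, w)) - ?A - ?B"
    unfolding e by (simp add: lin_ext_add)
  show ?case
    unfolding eq tensor_null_eq[OF V W]
    by (intro pm.span_diff 1 2 add(3)[unfolded tensor_null_eq[OF V W]])
qed

text \<open>By symmetry, statements about the first factor carry over to the second.\<close>

lemma tensor_null_swap:
  assumes "vspace V" "vspace W" "p \<in> tensor_null V W"
  shows "lin_ext prod.swap p \<in> tensor_null W V"
  using assms(3) unfolding tensor_null_eq[OF assms(1,2)] tensor_null_eq[OF assms(2,1)]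
proof (rule linear_span_mem[OF lin_ext_linear pm.subspace_span, rotated])
  fix q assume "q \<in> bilinear_relators V W"
  then have "lin_ext prod.swap q \<in> bilinear_relators W V"
    by (cases rule: bilinear_relators_cases)
      (auto simp: lin_ext_diff intro: bilinear_relators_intros)
  then show "lin_ext prod.swap q \<in> pm.span (bilinear_relators W V)" by (rule pm.span_base)
qed

lemma tensor_linear2:
  assumes V: "vspace V" and W: "vspace W" and f: "vlinear (free_vs X) W f"
    and p: "Poly_Mapping.keys p \<subseteq> X" and v: "v \<in> carr V"
  shows "lin_ext (\<lambda>a. (v, f (basis a))) p - basis (v, f p) \<in> tensor_null V W"
  using tensor_null_swap[OF W V tensor_linear1[OF W V f p v]]
  by (simp add: lin_ext_diff lin_ext_lin_ext)

lemma s2_tensor_simps: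
  "carr (s2_tensor E1 E2) = carr (vtensor E1 E2)" "vzero (s2_tensor E1 E2) = vzero (vtensor E1 E2)"
  "vadd (s2_tensor E1 E2) = vadd (vtensor E1 E2)" "vsmul (s2_tensor E1 E2) = vsmul (vtensor E1 E2)"
  "swp (s2_tensor E1 E2) X = (\<Union>p\<in>X. vcoset (free_vs (carr E1 \<times> carr E2)) (tensor_null E1 E2)
        (lin_ext (map_prod (swp E1) (swp E2)) p))"
  by (simp_all add: s2_tensor_def vs.extend_def s2mod.fields_def)

section \<open>The operad morphism of the Manin product\<close>

text \<open>The generator e \<otimes> f acting on a pair of trees in each component, extended to a
  trilinear map on representatives.\<close>

definition node :: "('e \<times> 'f \<Rightarrow>\<^sub>0 'k) \<Rightarrow> ('e btree \<times> 'f btree \<Rightarrow>\<^sub>0 'k) \<Rightarrow> ('e btree \<times> 'f btree \<Rightarrow>\<^sub>0 'k) \<Rightarrow>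
    ('e btree \<times> 'f btree \<Rightarrow>\<^sub>0 'k::field)" where
  "node c L R = pm_lift psc (\<lambda>(e, f). bilin_ext (\<lambda>(l, l') (r, r'). (Nd e l r, Nd f l' r')) L R) c"

lemma node_linear1: "plinear (\<lambda>c. node c L R)"
  unfolding node_def by (rule pm.pm_lift_linear)

lemma pm_lift_linear_param:
  assumes "\<And>x. plinear (\<lambda>q. f x q)"
  shows "plinear (\<lambda>q. pm_lift psc (\<lambda>x. f x q) p)"
  unfolding pm_lift_def
  by (intro linear_sum_fun pm.vector_space_axioms)
    (simp add: Vector_Spaces.linear_iff pm.vector_space_axioms linear_add'[OF assms] linear_psc[OF assms]
      pm.scale_right_distrib mult.commute)

lemma node_linear2: "plinear (\<lambda>L. node c L R)"
  unfolding node_def by (rule pm_lift_linear_param) (auto intro: bilin_ext_linear1 split: prod.split)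

lemma node_linear3: "plinear (\<lambda>R. node c L R)"
  unfolding node_def by (rule pm_lift_linear_param) (auto intro: bilin_ext_linear2 split: prod.split)

lemma node_basis [simp]:
  "node (Poly_Mapping.single (e, f) a) (Poly_Mapping.single (l, l') b) (Poly_Mapping.single (r, r') c) =
    Poly_Mapping.single (Nd e l r, Nd f l' r') (a * b * c)"
  by (simp add: node_def mult.assoc)

lemma node_eqI:
  assumes F: "\<And>L R. plinear (\<lambda>c. F c L R)" "\<And>c R. plinear (\<lambda>L. F c L R)" "\<And>c L. plinear (\<lambda>R. F c L R)"
    and G: "\<And>L R. plinear (\<lambda>c. G c L R)" "\<And>c R. plinear (\<lambda>L. G c L R)" "\<And>c L. plinear (\<lambda>R. G c L R)"
    and "\<And>x y z. \<lbrakk>x \<in> Poly_Mapping.keys c; y \<in> Poly_Mapping.keys L; z \<in> Poly_Mapping.keys R\<rbrakk> \<Longrightarrow>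
      F (basis x) (basis y) (basis z) = G (basis x) (basis y) (basis z)"
  shows "F c L R = G c L R"
  by (rule linear_eq_on_basis[OF F(1) G(1)], rule linear_eq_on_basis[OF F(2) G(2)],
      rule linear_eq_on_basis[OF F(3) G(3)]) (rule assms(7))

lemma node_mem:
  assumes S: "pm.subspace S"
    and "\<And>x y z. \<lbrakk>x \<in> Poly_Mapping.keys c; y \<in> Poly_Mapping.keys L; z \<in> Poly_Mapping.keys R\<rbrakk> \<Longrightarrow>
      node (basis x) (basis y) (basis z) \<in> S"
  shows "node c L R \<in> S"
  by (rule linear_mem_on_basis[OF node_linear1 S], rule linear_mem_on_basis[OF node_linear2 S],
      rule linear_mem_on_basis[OF node_linear3 S]) (rule assms(2))

text \<open>The value of \<open>split\<close> is independent of the representatives \<open>rep X\<close> only modulo \<open>pair_null\<close> below.\<close>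

primrec split :: "('e \<times> 'f \<Rightarrow>\<^sub>0 'k) set btree \<Rightarrow> ('e btree \<times> 'f btree \<Rightarrow>\<^sub>0 'k::field)" where
  "split (Lf j) = basis (Lf j, Lf j)"
| "split (Nd X l r) = node (rep X) (split l) (split r)"

lemma plinear_diff: "plinear f \<Longrightarrow> plinear g \<Longrightarrow> plinear (\<lambda>x. f x - g x)"
  unfolding Vector_Spaces.linear_iff by (simp add: pm.scale_right_diff_distrib)

section \<open>Splitting a tree labelled by tensors into pairs of trees\<close>

locale s2_pair = E1: s2_module E1 + E2: s2_module E2
  for E1 :: "('k::field, 'e, 'y) s2mod_scheme" and E2 :: "('k, 'f, 'z) s2mod_scheme"
begin

sublocale F: operad_pair "free_operad E1" "free_operad E2"
  by (simp add: operad_pair_def free.quot_linear_operad)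

abbreviation "ET \<equiv> s2_tensor E1 E2"

lemma vspaces: "vspace E1" "vspace E2"
  by unfold_locales

lemma null_subspace: "vsubspace (free_vs (carr E1 \<times> carr E2)) (tensor_null E1 E2)"
  by (rule tensor_null_subspace[OF vspaces])

lemma null_pm_subspace: "pm.subspace (tensor_null E1 E2)"
  using null_subspace by (simp add: free_subspace_iff)

interpretation T: vsub "free_vs (carr E1 \<times> carr E2)" "tensor_null E1 E2"
  by (simp add: vsub_def vsub_axioms_def free_vspace null_subspace)

lemma rep_ET:
  assumes "X \<in> carr ET"
  shows "Poly_Mapping.keys (rep X) \<subseteq> carr E1 \<times> carr E2"
    "vcoset (free_vs (carr E1 \<times> carr E2)) (tensor_null E1 E2) (rep X) = X"
  using T.rep_mem[of X] assms by (simp_all add: s2_tensor_simps vtensor_def)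

lemma rep_coset_diff:
  assumes "Poly_Mapping.keys p \<subseteq> carr E1 \<times> carr E2"
  shows "rep (vcoset (free_vs (carr E1 \<times> carr E2)) (tensor_null E1 E2) p) - p \<in> tensor_null E1 E2"
  by (rule rep_free_coset(1)[OF null_subspace assms])

lemma rep_tens:
  "e \<in> carr E1 \<Longrightarrow> f \<in> carr E2 \<Longrightarrow> rep (tens E1 E2 e f) - basis (e, f) \<in> tensor_null E1 E2"
  unfolding tens_def by (rule rep_coset_diff) simp

text \<open>The choice \<open>rep\<close> is not additive. It commutes with addition, scalars and
  the swap modulo the null space, which is the precision needed for the relators of trees.\<close>

lemma rep_add:
  assumes "X \<in> carr ET" "Y \<in> carr ET"
  shows "rep (vadd ET X Y) - rep X - rep Y \<in> tensor_null E1 E2"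
proof -
  have "vadd ET X Y = vcoset (free_vs (carr E1 \<times> carr E2)) (tensor_null E1 E2) (rep X + rep Y)"
    using T.quot_add[of "rep X" "rep Y"] rep_ET[OF assms(1)] rep_ET[OF assms(2)]
    by (simp add: s2_tensor_simps vtensor_def)
  moreover have "Poly_Mapping.keys (rep X + rep Y) \<subseteq> carr E1 \<times> carr E2"
    using pm.subspace_add[OF subspace_keys, of "rep X" _ "rep Y"] rep_ET(1)[OF assms(1)] rep_ET(1)[OF assms(2)] by simp
  ultimately show ?thesis using rep_coset_diff[of "rep X + rep Y"] by (simp add: diff_diff_eq)
qed

lemma rep_smul:
  assumes "X \<in> carr ET"
  shows "rep (vsmul ET a X) - psc a (rep X) \<in> tensor_null E1 E2"
proof -
  have "vsmul ET a X = vcoset (free_vs (carr E1 \<times> carr E2)) (tensor_null E1 E2) (psc a (rep X))"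
    using T.quot_smul[of "rep X" a] rep_ET[OF assms] by (simp add: s2_tensor_simps vtensor_def)
  moreover have "Poly_Mapping.keys (psc a (rep X)) \<subseteq> carr E1 \<times> carr E2"
    using pm.subspace_scale[OF subspace_keys, of "rep X"] rep_ET(1)[OF assms] by simp
  ultimately show ?thesis using rep_coset_diff[of "psc a (rep X)"] by simp
qed

lemma rep_swp:
  assumes X: "X \<in> carr ET"
  shows "rep (swp ET X) - lin_ext (map_prod (swp E1) (swp E2)) (rep X) \<in> tensor_null E1 E2"
proof -
  let ?s = "lin_ext (map_prod (swp E1) (swp E2)) :: ('e \<times> 'f \<Rightarrow>\<^sub>0 'k) \<Rightarrow> _"
  let ?U = "tensor_null E1 E2"
  have k: "Poly_Mapping.keys (?s p) \<subseteq> carr E1 \<times> carr E2" if "Poly_Mapping.keys p \<subseteq> carr E1 \<times> carr E2" for p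
    using keys_lin_ext[of "map_prod (swp E1) (swp E2)" p] that
      vlinearD(1)[OF E1.swp_linear] vlinearD(1)[OF E2.swp_linear] by fastforce
  \<comment> \<open>As the swap of both factors preserves the null space, all members of X
    contribute the same coset to the union that defines \<open>swp ET X\<close>.\<close>
  have n: "?s q \<in> ?U" if "q \<in> ?U" for q
  proof (rule linear_span_mem[OF lin_ext_linear null_pm_subspace])
    show "q \<in> pm.span (bilinear_relators E1 E2)" using that tensor_null_eq[OF vspaces] by simp
    show "?s p \<in> ?U" if "p \<in> bilinear_relators E1 E2" for p
      using bilinear_relators_map[OF that E1.swp_linear E2.swp_linear]
      unfolding tensor_null_eq[OF vspaces] map_prod_def by (rule pm.span_base)
  qed
  have "swp ET X = vcoset (free_vs (carr E1 \<times> carr E2)) ?U (?s (rep X))"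
    unfolding s2_tensor_simps
  proof (rule UN_const)
    show "rep X \<in> X" using T.mem_coset[of "rep X"] rep_ET[OF X] by simp
    fix p assume "p \<in> X"
    then have "p \<in> vcoset (free_vs (carr E1 \<times> carr E2)) ?U (rep X)" using rep_ET(2)[OF X] by simp
    then obtain u where u: "u \<in> ?U" "p = rep X + u" by (auto simp: vcoset_def)
    have "Poly_Mapping.keys p \<subseteq> carr E1 \<times> carr E2"
      using T.coset_carr[of "rep X"] rep_ET[OF X] \<open>p \<in> X\<close> by auto
    moreover have "?s p - ?s (rep X) \<in> ?U" using n[OF u(1)] by (simp add: u(2) lin_ext_add)
    ultimately show "vcoset (free_vs (carr E1 \<times> carr E2)) ?U (?s p) = vcoset (free_vs (carr E1 \<times> carr E2)) ?U (?s (rep X))"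
      using free_coset_eq_iff[OF null_subspace k k] rep_ET(1)[OF X] by blast
  qed
  then show ?thesis using rep_coset_diff[OF k[OF rep_ET(1)[OF X]]] by simp
qed

text \<open>Consequently each term is a pair of tree monomials of the arity of t, and leaf i is
  found in the same subtree of t and of both components.\<close>

lemma split_keys:
  assumes "set_btree t \<subseteq> carr ET" "(t1, t2) \<in> Poly_Mapping.keys (split t)"
  shows "leaves t1 = leaves t \<and> leaves t2 = leaves t \<and> set_btree t1 \<subseteq> carr E1 \<and> set_btree t2 \<subseteq> carr E2"
  using assms
proof (induction t arbitrary: t1 t2)
  case (Nd X l r)
  let ?G = "\<lambda>t. {(t1, t2). leaves t1 = leaves t \<and> leaves t2 = leaves t \<and> set_btree t1 \<subseteq> carr E1 \<and> set_btree t2 \<subseteq> carr E2}"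
  have "node (rep X) (split l) (split r) \<in> {p. Poly_Mapping.keys p \<subseteq> ?G (Nd X l r)}"
  proof (rule node_mem[OF subspace_keys])
    fix x y z
    assume x: "x \<in> Poly_Mapping.keys (rep X)" and y: "y \<in> Poly_Mapping.keys (split l)"
      and z: "z \<in> Poly_Mapping.keys (split r)"
    obtain e f l1 l2 r1 r2 where s: "x = (e, f)" "y = (l1, l2)" "z = (r1, r2)" by (metis surj_pair)
    have "e \<in> carr E1" "f \<in> carr E2" using x rep_ET(1)[of X] Nd.prems(1) by (auto simp: s)
    then show "node (basis x) (basis y) (basis z) \<in> {p. Poly_Mapping.keys p \<subseteq> ?G (Nd X l r)}"
      using Nd.IH(1)[of l1 l2] Nd.IH(2)[of r1 r2] y z Nd.prems(1) by (auto simp: s)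
  qed
  then show ?case using Nd.prems(2) by auto
qed simp

lemma split_trees:
  "t \<in> trees ET n \<Longrightarrow> Poly_Mapping.keys (split t) \<subseteq> trees E1 n \<times> trees E2 n"
  using split_keys[of t] by (auto simp: trees_def)

lemma split_relabel:
  "split (graft (\<lambda>k. Lf (\<beta> k)) t) = lin_ext (\<lambda>(a, b). (graft (\<lambda>k. Lf (\<beta> k)) a, graft (\<lambda>k. Lf (\<beta> k)) b)) (split t)"
proof (induction t)
  case (Nd X l r)
  let ?g = "\<lambda>(a, b). (graft (\<lambda>k. Lf (\<beta> k)) a, graft (\<lambda>k. Lf (\<beta> k)) b)"
  have "node c (lin_ext ?g L) (lin_ext ?g R) = lin_ext ?g (node c L R)" for c L R
    by (rule node_eqI)
      (auto intro: linear_compose'[OF lin_ext_linear node_linear2] linear_compose'[OF lin_ext_linear node_linear3]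
        linear_compose'[OF node_linear1 lin_ext_linear] linear_compose'[OF node_linear2 lin_ext_linear]
        linear_compose'[OF node_linear3 lin_ext_linear] node_linear1)
  then show ?case using Nd by simp
qed simp

text \<open>Composition with the shift of T pulled out and an arbitrary relabelling of the other
  leaves, a form that is inherited by the subtrees of S.\<close>

definition graft_at :: "(nat \<Rightarrow> nat) \<Rightarrow> nat \<Rightarrow> 'x btree \<Rightarrow> 'x btree \<Rightarrow> 'x btree" where
  "graft_at \<beta> i S T = graft (\<lambda>k. if k = i then T else Lf (\<beta> k)) S"

lemma graft_at_outside: "i \<notin> set (leaves S) \<Longrightarrow> graft_at \<beta> i S T = graft (\<lambda>k. Lf (\<beta> k)) S"
  unfolding graft_at_def by (rule graft_cong) auto

text \<open>Leaf i lies in exactly one of the two subtrees and the other one is merely relabelled.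
  Thus T enters once, and both sides are linear in it.\<close>

lemma split_graft_at:
  assumes "set_btree S \<subseteq> carr ET" "distinct (leaves S)" "i \<in> set (leaves S)"
  shows "split (graft_at \<beta> i S T) =
    bilin_ext (\<lambda>(s, s') (t, t'). (graft_at \<beta> i s t, graft_at \<beta> i s' t')) (split S) (split T)"
  using assms
proof (induction S)
  case (Lf j)
  then show ?case by (simp add: graft_at_def bilin_ext_basis1 lin_ext_id split: prod.split)
next
  case (Nd X l r)
  let ?h = "\<lambda>(s, s') (t, t'). (graft_at \<beta> i s t, graft_at \<beta> i s' t')"
  let ?g = "\<lambda>(a, b). (graft (\<lambda>k. Lf (\<beta> k)) a, graft (\<lambda>k. Lf (\<beta> k)) b)"
  have k: "i \<notin> set (leaves s1)" "i \<notin> set (leaves s2)"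
    if "i \<notin> set (leaves s)" "set_btree s \<subseteq> carr ET" "(s1, s2) \<in> Poly_Mapping.keys (split s)" for s s1 s2
    using split_keys[OF that(2,3)] that(1) by simp_all
  have Nd_at: "graft_at \<beta> i (Nd e a b) t = Nd e (graft_at \<beta> i a t) (graft_at \<beta> i b t)" for e :: 'x and a b t
    by (simp add: graft_at_def)
  note lin = linear_compose'[OF lin_ext_linear node_linear2] linear_compose'[OF lin_ext_linear node_linear3]
    linear_compose'[OF node_linear1 bilin_ext_linear1] linear_compose'[OF node_linear2 bilin_ext_linear1]
    linear_compose'[OF node_linear3 bilin_ext_linear1] linear_compose'[OF bilin_ext_linear1 node_linear2]
    linear_compose'[OF bilin_ext_linear1 node_linear3] node_linear1 node_linear2 node_linear3
  have lT: "plinear (\<lambda>T. bilin_ext ?h p T)" "plinear (\<lambda>T. node c (bilin_ext ?h L T) R)"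
     "plinear (\<lambda>T. node c L (bilin_ext ?h R T))" for p c L R
    by (intro bilin_ext_linear2 linear_compose'[OF bilin_ext_linear2 node_linear2]
      linear_compose'[OF bilin_ext_linear2 node_linear3])+
  consider "i \<in> set (leaves l)" "i \<notin> set (leaves r)" | "i \<in> set (leaves r)" "i \<notin> set (leaves l)"
    using Nd.prems by auto
  then show ?case
  proof cases
    case 1
    \<comment> \<open>T is reduced to a basis element first. The identity is then trilinear in the
      label and the two subtrees and may be checked on basis elements.\<close>
    have "node c (bilin_ext ?h L T) (lin_ext ?g (split r)) = bilin_ext ?h (node c L (split r)) T" for c L T
    proof (rule linear_eq_on_basis[OF lT(2) lT(1), where p = T])
      fix t
      show "node c (bilin_ext ?h L (basis t)) (lin_ext ?g (split r)) = bilin_ext ?h (node c L (split r)) (basis t)"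
      proof (rule node_eqI[where F = "\<lambda>c L R. node c (bilin_ext ?h L (basis t)) (lin_ext ?g R)"
            and G = "\<lambda>c L R. bilin_ext ?h (node c L R) (basis t)"])
        fix x y z assume z: "z \<in> Poly_Mapping.keys (split r)"
        show "node (basis x) (bilin_ext ?h (basis y) (basis t)) (lin_ext ?g (basis z)) =
           bilin_ext ?h (node (basis x) (basis y) (basis z)) (basis t)"
          using k[OF 1(2), of "fst z" "snd z"] z Nd.prems(1)
          by (cases x; cases y; cases z; cases t) (simp add: Nd_at graft_at_outside)
      qed (rule lin)+
    qed
    then show ?thesis
      using Nd.IH(1) Nd.prems 1 by (simp add: Nd_at graft_at_outside split_relabel)
  next
    case 2
    have "node c (lin_ext ?g (split l)) (bilin_ext ?h R T) = bilin_ext ?h (node c (split l) R) T" for c R T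
    proof (rule linear_eq_on_basis[OF lT(3) lT(1), where p = T])
      fix t
      show "node c (lin_ext ?g (split l)) (bilin_ext ?h R (basis t)) = bilin_ext ?h (node c (split l) R) (basis t)"
      proof (rule node_eqI[where F = "\<lambda>c L R. node c (lin_ext ?g L) (bilin_ext ?h R (basis t))"
            and G = "\<lambda>c L R. bilin_ext ?h (node c L R) (basis t)"])
        fix x y z assume y: "y \<in> Poly_Mapping.keys (split l)"
        show "node (basis x) (lin_ext ?g (basis y)) (bilin_ext ?h (basis z) (basis t)) =
           bilin_ext ?h (node (basis x) (basis y) (basis z)) (basis t)"
          using k[OF 2(2), of "fst y" "snd y"] y Nd.prems(1)
          by (cases x; cases y; cases z; cases t) (simp add: Nd_at graft_at_outside)
      qed (rule lin)+
    qed
    then show ?thesis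
      using Nd.IH(2) Nd.prems 2 by (simp add: Nd_at graft_at_outside split_relabel)
  qed
qed

lemma split_comp:
  assumes "S \<in> trees ET m" "i \<in> {1..m}"
  shows "split (tree_comp n i S T) =
    bilin_ext (\<lambda>(s, s') (t, t'). (tree_comp n i s t, tree_comp n i s' t')) (split S) (split T)"
proof -
  let ?\<beta> = "\<lambda>k. if k < i then k else k + n - 1" and ?s = "\<lambda>j. j + i - 1"
  have c: "tree_comp n i A B = graft_at ?\<beta> i A (graft (\<lambda>j. Lf (?s j)) B)" for A B :: "'x btree"
    unfolding tree_comp_def graft_at_def by (rule graft_cong) auto
  have "split (tree_comp n i S T) = bilin_ext (\<lambda>(s, s') (t, t'). (graft_at ?\<beta> i s t, graft_at ?\<beta> i s' t')) (split S)
      (lin_ext (\<lambda>(a, b). (graft (\<lambda>k. Lf (?s k)) a, graft (\<lambda>k. Lf (?s k)) b)) (split T))"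
    unfolding c using assms
    by (subst split_graft_at) (auto simp: trees_def split_relabel)
  also have "\<dots> = bilin_ext (\<lambda>(s, s') (t, t'). (tree_comp n i s t, tree_comp n i s' t')) (split S) (split T)"
    unfolding c
    by (rule bilinear_eq_on_basis)
      (auto intro: bilin_ext_linear1 bilin_ext_linear2 linear_compose'[OF lin_ext_linear bilin_ext_linear2])
  finally show ?thesis .
qed

text \<open>The kernel of the projection of pairs of trees to \<open>\<F>(E\<^sub>1) \<otimes> \<F>(E\<^sub>2)\<close>, in all arities at once.\<close>

definition pair_null :: "('e btree \<times> 'f btree \<Rightarrow>\<^sub>0 'k) set" where
  "pair_null = pm.span ({lin_ext (\<lambda>a. (a, t)) p | p t. p \<in> tree_relators E1} \<union>
     {lin_ext (\<lambda>b. (t, b)) p | p t. p \<in> tree_relators E2})"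

lemma pair_null1: "p \<in> tree_relators E1 \<Longrightarrow> lin_ext (\<lambda>a. (a, t)) p \<in> pair_null"
  and pair_null2: "q \<in> tree_relators E2 \<Longrightarrow> lin_ext (\<lambda>b. (s, b)) q \<in> pair_null"
  unfolding pair_null_def by (rule pm.span_base, blast)+

lemma pair_null_subspace: "pm.subspace pair_null"
  unfolding pair_null_def by (rule pm.subspace_span)

text \<open>A bilinear relator in the label is linear in one of the two components, so it becomes a
  label relator of the tree in that component, with the other tree fixed.\<close>

lemma node_null1:
  assumes "c \<in> tensor_null E1 E2"
  shows "node c L R \<in> pair_null"
proof (rule linear_span_mem[OF node_linear1 pair_null_subspace])
  show "c \<in> pm.span (bilinear_relators E1 E2)" using assms tensor_null_eq[OF vspaces] by simp
next
  fix c assume c: "c \<in> bilinear_relators E1 E2"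
  show "node c L R \<in> pair_null"
  proof (rule linear_mem_on_basis[OF node_linear2 pair_null_subspace],
      rule linear_mem_on_basis[OF node_linear3 pair_null_subspace])
    fix x y :: "'e btree \<times> 'f btree"
    obtain l l' r r' where s: "x = (l, l')" "y = (r, r')" by (metis surj_pair)
    note d = linear_diff'[OF node_linear1]
    show "node c (basis x) (basis y) \<in> pair_null"
      using c
    proof (cases rule: bilinear_relators_cases)
      case (add1 v v' w)
      then show ?thesis
        using pair_null1[OF tree_relators.rel_add[OF add1(1,2), of l r], of "Nd w l' r'"]
        by (simp add: d s lin_ext_diff)
    next
      case (add2 v w w')
      then show ?thesis
        using pair_null2[OF tree_relators.rel_add[OF add2(2,3), of l' r'], of "Nd v l r"]
        by (simp add: d s lin_ext_diff)
    next
      case (smul1 a v w)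
      then show ?thesis
        using pair_null1[OF tree_relators.rel_smul[OF smul1(1), of a l r], of "Nd w l' r'"]
        by (simp add: d s lin_ext_diff)
    next
      case (smul2 a v w)
      then show ?thesis
        using pair_null2[OF tree_relators.rel_smul[OF smul2(2), of a l' r'], of "Nd v l r"]
        by (simp add: d s lin_ext_diff)
    qed
  qed
qed

lemma node_null2:
  assumes "L \<in> pair_null"
  shows "node c L R \<in> pair_null"
proof (rule linear_span_mem[OF node_linear2 pair_null_subspace _ assms[unfolded pair_null_def]])
  fix L assume L: "L \<in> {lin_ext (\<lambda>a. (a, t)) p | p t. p \<in> tree_relators E1} \<union>
     {lin_ext (\<lambda>b. (t, b)) p | p t. p \<in> tree_relators E2}"
  show "node c L R \<in> pair_null"
  proof (rule linear_mem_on_basis[OF node_linear1 pair_null_subspace],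
      rule linear_mem_on_basis[OF node_linear3 pair_null_subspace])
    fix x :: "'e \<times> 'f" and y :: "'e btree \<times> 'f btree"
    obtain e f r r' where s: "x = (e, f)" "y = (r, r')" by (metis surj_pair)
    \<comment> \<open>The new node pushes the relator down into a left subtree of its own component
      (\<open>rel_left\<close>) and enlarges the fixed tree of the other component.\<close>
    have 1: "node (basis (e, f)) (lin_ext (\<lambda>a. (a, t)) p) (basis (r, r')) =
       lin_ext (\<lambda>a. (a, Nd f t r')) (lin_ext (\<lambda>l. Nd e l r) p)" for p t
      unfolding lin_ext_lin_ext
      by (rule linear_eq_on_basis[OF linear_compose'[OF lin_ext_linear node_linear2] lin_ext_linear]) simp
    have 2: "node (basis (e, f)) (lin_ext (\<lambda>b. (t, b)) p) (basis (r, r')) =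
       lin_ext (\<lambda>b. (Nd e t r, b)) (lin_ext (\<lambda>l. Nd f l r') p)" for p t
      unfolding lin_ext_lin_ext
      by (rule linear_eq_on_basis[OF linear_compose'[OF lin_ext_linear node_linear2] lin_ext_linear]) simp
    show "node (basis x) L (basis y) \<in> pair_null"
      using L
    proof (elim UnE CollectE exE conjE)
      fix p t assume "L = lin_ext (\<lambda>a. (a, t)) p" "p \<in> tree_relators E1"
      then show ?thesis by (simp only: s 1 pair_null1 tree_relators.rel_left)
    next
      fix p t assume "L = lin_ext (\<lambda>b. (t, b)) p" "p \<in> tree_relators E2"
      then show ?thesis by (simp only: s 2 pair_null2 tree_relators.rel_left)
    qed
  qed
qed

lemma node_null3:
  assumes "R \<in> pair_null"
  shows "node c L R \<in> pair_null"
proof (rule linear_span_mem[OF node_linear3 pair_null_subspace _ assms[unfolded pair_null_def]])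
  fix R assume R: "R \<in> {lin_ext (\<lambda>a. (a, t)) p | p t. p \<in> tree_relators E1} \<union>
     {lin_ext (\<lambda>b. (t, b)) p | p t. p \<in> tree_relators E2}"
  show "node c L R \<in> pair_null"
  proof (rule linear_mem_on_basis[OF node_linear1 pair_null_subspace],
      rule linear_mem_on_basis[OF node_linear2 pair_null_subspace])
    fix x :: "'e \<times> 'f" and y :: "'e btree \<times> 'f btree"
    obtain e f l l' where s: "x = (e, f)" "y = (l, l')" by (metis surj_pair)
    have 1: "node (basis (e, f)) (basis (l, l')) (lin_ext (\<lambda>a. (a, t)) p) =
       lin_ext (\<lambda>a. (a, Nd f l' t)) (lin_ext (\<lambda>r. Nd e l r) p)" for p t
      unfolding lin_ext_lin_ext
      by (rule linear_eq_on_basis[OF linear_compose'[OF lin_ext_linear node_linear3] lin_ext_linear]) simp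
    have 2: "node (basis (e, f)) (basis (l, l')) (lin_ext (\<lambda>b. (t, b)) p) =
       lin_ext (\<lambda>b. (Nd e l t, b)) (lin_ext (\<lambda>r. Nd f l' r) p)" for p t
      unfolding lin_ext_lin_ext
      by (rule linear_eq_on_basis[OF linear_compose'[OF lin_ext_linear node_linear3] lin_ext_linear]) simp
    show "node (basis x) (basis y) R \<in> pair_null"
      using R
    proof (elim UnE CollectE exE conjE)
      fix p t assume "R = lin_ext (\<lambda>a. (a, t)) p" "p \<in> tree_relators E1"
      then show ?thesis by (simp only: s 1 pair_null1 tree_relators.rel_right)
    next
      fix p t assume "R = lin_ext (\<lambda>b. (t, b)) p" "p \<in> tree_relators E2"
      then show ?thesis by (simp only: s 2 pair_null2 tree_relators.rel_right)
    qed
  qed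
qed

lemma node_swp:
  assumes "Poly_Mapping.keys c \<subseteq> carr E1 \<times> carr E2"
  shows "node (lin_ext (map_prod (swp E1) (swp E2)) c) L R - node c R L \<in> pair_null"
proof -
  define F where "F c L R = node (lin_ext (map_prod (swp E1) (swp E2)) c) L R - node c R L" for c :: "'e \<times> 'f \<Rightarrow>\<^sub>0 'k" and L R
  have l: "plinear (\<lambda>c. F c L R)" "plinear (\<lambda>L. F c L R)" "plinear (\<lambda>R. F c L R)" for c L R
    unfolding F_def
    by (intro plinear_diff node_linear1 node_linear2 node_linear3 linear_compose'[OF lin_ext_linear node_linear1])+
  have "F c L R \<in> pair_null"
  proof (rule linear_mem_on_basis[OF l(1) pair_null_subspace],
      rule linear_mem_on_basis[OF l(2) pair_null_subspace], rule linear_mem_on_basis[OF l(3) pair_null_subspace])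
    fix x and y z :: "'e btree \<times> 'f btree" assume "x \<in> Poly_Mapping.keys c"
    then obtain e f where x: "x = (e, f)" "e \<in> carr E1" "f \<in> carr E2" using assms by auto
    obtain l l' r r' where s: "y = (l, l')" "z = (r, r')" by (metis surj_pair)
    \<comment> \<open>The two components are swapped one after the other: A' \<otimes> B' - A
      \<otimes> B = (A' - A) \<otimes> B' + A \<otimes> (B' - B).\<close>
    have "F (basis x) (basis y) (basis z) =
       lin_ext (\<lambda>a. (a, Nd (swp E2 f) l' r')) (basis (Nd (swp E1 e) l r) - basis (Nd e r l)) +
       lin_ext (\<lambda>b. (Nd e r l, b)) (basis (Nd (swp E2 f) l' r') - basis (Nd f r' l'))"
      by (simp add: F_def x(1) s lin_ext_diff)
    then show "F (basis x) (basis y) (basis z) \<in> pair_null"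
      using pm.subspace_add[OF pair_null_subspace pair_null1[OF tree_relators.rel_swp[OF x(2)]]
          pair_null2[OF tree_relators.rel_swp[OF x(3)]]] by simp
  qed
  then show ?thesis by (simp add: F_def)
qed

definition lsplit :: "(('e \<times> 'f \<Rightarrow>\<^sub>0 'k) set btree \<Rightarrow>\<^sub>0 'k) \<Rightarrow> ('e btree \<times> 'f btree \<Rightarrow>\<^sub>0 'k)" where
  "lsplit p = pm_lift psc split p"

lemma lsplit_linear: "plinear lsplit"
  unfolding lsplit_def[abs_def] by (rule pm.pm_lift_linear)

lemma lsplit_single [simp]: "lsplit (Poly_Mapping.single t c) = psc c (split t)"
  unfolding lsplit_def by (rule pm.pm_lift_single)

lemma lsplit_relators: "p \<in> tree_relators ET \<Longrightarrow> lsplit p \<in> pair_null"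
proof (induction rule: tree_relators.induct)
  case (rel_add X Y l r)
  then show ?case
    using node_null1[OF rep_add[OF rel_add], of "split l" "split r"]
    by (simp add: linear_diff'[OF lsplit_linear] linear_diff'[OF node_linear1])
next
  case (rel_smul X c l r)
  then show ?case
    using node_null1[OF rep_smul[OF rel_smul, of c], of "split l" "split r"]
    by (simp add: linear_diff'[OF lsplit_linear] linear_diff'[OF node_linear1] linear_psc[OF node_linear1])
next
  case (rel_swp X l r)
  \<comment> \<open>The intermediate term has the swapped representative of X as label. The first
    difference measures the choice of \<open>rep\<close>, the second is the swap itself.\<close>
  have "lsplit (basis (Nd (swp ET X) l r) - basis (Nd X r l)) =
     node (rep (swp ET X) - lin_ext (map_prod (swp E1) (swp E2)) (rep X)) (split l) (split r) +
     (node (lin_ext (map_prod (swp E1) (swp E2)) (rep X)) (split l) (split r) - node (rep X) (split r) (split l))"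
    by (simp add: linear_diff'[OF lsplit_linear] linear_diff'[OF node_linear1])
  then show ?case
    using pm.subspace_add[OF pair_null_subspace node_null1[OF rep_swp[OF rel_swp]] node_swp[OF rep_ET(1)[OF rel_swp]]]
    by simp
next
  case (rel_left p X r)
  have "lsplit (lin_ext (\<lambda>l. Nd X l r) p) = node (rep X) (lsplit p) (split r)"
    by (rule linear_eq_on_basis[OF linear_compose'[OF lin_ext_linear lsplit_linear]
          linear_compose'[OF lsplit_linear node_linear2]]) simp
  then show ?case using node_null2[OF rel_left.IH] by simp
next
  case (rel_right p X l)
  have "lsplit (lin_ext (\<lambda>r. Nd X l r) p) = node (rep X) (split l) (lsplit p)"
    by (rule linear_eq_on_basis[OF linear_compose'[OF lin_ext_linear lsplit_linear]
          linear_compose'[OF lsplit_linear node_linear3]]) simp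
  then show ?case using node_null3[OF rel_right.IH] by simp
qed

end

section \<open>Descent of the splitting to classes in the free operads\<close>

lemma free_class_linear: "1 \<le> n \<Longrightarrow> vlinear (free_vs (trees E n)) (opsp (free_operad E) n) (free_class E n)"
  using operad_homD(1)[OF free.coset_hom, of n E] by (simp add: free_class_def[abs_def])

lemma free_class_unit: "ounit (free_operad E) = free_class E 1 (basis (Lf 1))"
  by (simp add: free_operad_def quot_operad_def free_class_def)

lemma free_class_comp:
  assumes "1 \<le> m" "1 \<le> n" "i \<in> {1..m}" "S \<in> trees E m" "T \<in> trees E n"
  shows "ocomp (free_operad E) m n i (free_class E m (basis S)) (free_class E n (basis T)) =
    free_class E (m + n - 1) (basis (tree_comp n i S T))"
  using free.quot_comp[OF assms(1-3), of "basis S" E "basis T"] assms(4,5) by (simp add: free_class_def)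

lemma free_class_act:
  assumes "1 \<le> n" "\<sigma> permutes {1..n}" "T \<in> trees E n"
  shows "oact (free_operad E) n (free_class E n (basis T)) \<sigma> =
    free_class E n (basis (graft (\<lambda>k. Lf (inv \<sigma> k)) T))"
  using free.quot_act[OF assms(1,2), of "basis T" E] assms(3) by (simp add: free_class_def)

lemma free_class_closed: "1 \<le> n \<Longrightarrow> t \<in> trees E n \<Longrightarrow> free_class E n (basis t) \<in> carr (opsp (free_operad E) n)"
  using vlinearD(1)[OF free_class_linear, of n "basis t" E] by simp

lemma free_class_null:
  assumes "1 \<le> n" "p \<in> free_null E n"
  shows "free_class E n p = vzero (opsp (free_operad E) n)"
  using vsub.coset_zero[OF free.vsub[OF assms(1)] assms(2)]
  by (simp add: free_class_def free.quot_opsp vquot_def)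

lemma vspace_free_operad: "1 \<le> n \<Longrightarrow> vspace (opsp (free_operad E) n)"
  by (rule linear_operad.opsp_vspace[OF free.quot_linear_operad])

context s2_pair
begin

text \<open>The space \<open>pair_null\<close> mixes all arities. Sending every pair outside arity n
  to 0 makes this a total linear map, and homogeneity of relators keeps the cut compatible with
  them.\<close>

definition classes :: "nat \<Rightarrow> ('e btree \<times> 'f btree \<Rightarrow>\<^sub>0 'k) \<Rightarrow>
    (('e btree \<Rightarrow>\<^sub>0 'k) set \<times> ('f btree \<Rightarrow>\<^sub>0 'k) set \<Rightarrow>\<^sub>0 'k)" where
  "classes n p = pm_lift psc (\<lambda>(t, t'). if t \<in> trees E1 n \<and> t' \<in> trees E2 n
     then basis (free_class E1 n (basis t), free_class E2 n (basis t')) else 0) p"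

lemma classes_linear: "plinear (classes n)"
  unfolding classes_def[abs_def] by (rule pm.pm_lift_linear)

lemma classes_single: "classes n (Poly_Mapping.single (t, t') c) =
  (if t \<in> trees E1 n \<and> t' \<in> trees E2 n
   then Poly_Mapping.single (free_class E1 n (basis t), free_class E2 n (basis t')) c else 0)"
  unfolding classes_def pm.pm_lift_single by simp

abbreviation "tnull n \<equiv> tensor_null (opsp (free_operad E1) n) (opsp (free_operad E2) n)"

lemma tnull_subspace: "1 \<le> n \<Longrightarrow> pm.subspace (tnull n)"
  by (simp add: tensor_null_eq vspace_free_operad pm.subspace_span)

lemma relators_free_null:
  "p \<in> tree_relators E \<Longrightarrow> Poly_Mapping.keys p \<subseteq> trees E n \<Longrightarrow> p \<in> free_null E n"
  unfolding free_null_eq by (rule pm.span_base) simp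

text \<open>A relator in one component either lies wholly in arity n, and then its class is zero and
  bilinearity finishes, or it is cut off term by term.\<close>

lemma classes_pair_null:
  assumes n: "1 \<le> n" and q: "q \<in> pair_null"
  shows "classes n q \<in> tnull n"
proof (rule linear_span_mem[OF classes_linear tnull_subspace[OF n] _ q[unfolded pair_null_def]])
  fix q assume "q \<in> {lin_ext (\<lambda>a. (a, t)) p | p t. p \<in> tree_relators E1} \<union>
     {lin_ext (\<lambda>b. (t, b)) p | p t. p \<in> tree_relators E2}"
  then show "classes n q \<in> tnull n"
  proof (elim UnE CollectE exE conjE)
    fix p t assume q: "q = lin_ext (\<lambda>a. (a, t)) p" and p: "p \<in> tree_relators E1"
    let ?w = "free_class E2 n (basis t)"
    show ?thesis
    proof (cases "Poly_Mapping.keys p \<subseteq> trees E1 n \<and> t \<in> trees E2 n")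
      case True
      have A: "classes n (lin_ext (\<lambda>a. (a, t)) p) = lin_ext (\<lambda>a. (free_class E1 n (basis a), ?w)) p"
        by (rule linear_eq_on_basis[OF linear_compose'[OF lin_ext_linear classes_linear] lin_ext_linear])
          (use True in \<open>auto simp: classes_single\<close>)
      have w: "?w \<in> carr (opsp (free_operad E2) n)" using free_class_closed n True by blast
      have D: "lin_ext (\<lambda>a. (free_class E1 n (basis a), ?w)) p - basis (free_class E1 n p, ?w) \<in> tnull n"
        using tensor_linear1[OF vspace_free_operad[OF n] vspace_free_operad[OF n] free_class_linear[OF n] _ w] True by blast
      have B: "basis (free_class E1 n p, ?w) \<in> tnull n"
        using free_class_null[OF n relators_free_null[OF p]] True
          tensor_null_zero(1)[OF vspace_free_operad[OF n] vspace_free_operad[OF n] vspace.zero_closed[OF vspace_free_operad[OF n]] w]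
        by simp
      show ?thesis unfolding q A using pm.subspace_add[OF tnull_subspace[OF n] D B] by simp
    next
      \<comment> \<open>Either t or, by homogeneity, every tree of the relator fails to be a tree
        monomial of arity n, so each term is sent to 0.\<close>
      case False
      then have "a \<notin> trees E1 n \<or> t \<notin> trees E2 n" if "a \<in> Poly_Mapping.keys p" for a
        using relators_homogeneous[OF E1.s2_module_axioms p, of n] that by blast
      then have z: "classes n (lin_ext (\<lambda>a. (a, t)) (basis a)) \<in> tnull n" if "a \<in> Poly_Mapping.keys p" for a
        using that pm.subspace_0[OF tnull_subspace[OF n]] by (auto simp: classes_single)
      have "plinear (\<lambda>p. classes n (lin_ext (\<lambda>a. (a, t)) p))"
        by (rule linear_compose'[OF lin_ext_linear classes_linear])
      from linear_mem_on_basis[OF this tnull_subspace[OF n] z] show ?thesis unfolding q .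
    qed
  next
    fix p t assume q: "q = lin_ext (\<lambda>b. (t, b)) p" and p: "p \<in> tree_relators E2"
    let ?w = "free_class E1 n (basis t)"
    show ?thesis
    proof (cases "Poly_Mapping.keys p \<subseteq> trees E2 n \<and> t \<in> trees E1 n")
      case True
      have A: "classes n (lin_ext (\<lambda>b. (t, b)) p) = lin_ext (\<lambda>b. (?w, free_class E2 n (basis b))) p"
        by (rule linear_eq_on_basis[OF linear_compose'[OF lin_ext_linear classes_linear] lin_ext_linear])
          (use True in \<open>auto simp: classes_single\<close>)
      have w: "?w \<in> carr (opsp (free_operad E1) n)" using free_class_closed n True by blast
      have D: "lin_ext (\<lambda>b. (?w, free_class E2 n (basis b))) p - basis (?w, free_class E2 n p) \<in> tnull n"
        using tensor_linear2[OF vspace_free_operad[OF n] vspace_free_operad[OF n] free_class_linear[OF n] _ w] True by blast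
      have B: "basis (?w, free_class E2 n p) \<in> tnull n"
        using free_class_null[OF n relators_free_null[OF p]] True
          tensor_null_zero(2)[OF vspace_free_operad[OF n] vspace_free_operad[OF n] w vspace.zero_closed[OF vspace_free_operad[OF n]]]
        by simp
      show ?thesis unfolding q A using pm.subspace_add[OF tnull_subspace[OF n] D B] by simp
    next
      case False
      then have "b \<notin> trees E2 n \<or> t \<notin> trees E1 n" if "b \<in> Poly_Mapping.keys p" for b
        using relators_homogeneous[OF E2.s2_module_axioms p, of n] that by blast
      then have z: "classes n (lin_ext (\<lambda>b. (t, b)) (basis b)) \<in> tnull n" if "b \<in> Poly_Mapping.keys p" for b
        using that pm.subspace_0[OF tnull_subspace[OF n]] by (auto simp: classes_single)
      have "plinear (\<lambda>p. classes n (lin_ext (\<lambda>b. (t, b)) p))"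
        by (rule linear_compose'[OF lin_ext_linear classes_linear])
      from linear_mem_on_basis[OF this tnull_subspace[OF n] z] show ?thesis unfolding q .
    qed
  qed
qed

abbreviation "FP \<equiv> pair_operad (free_operad E1) (free_operad E2)"
abbreviation "FT \<equiv> tensor_operad (free_operad E1) (free_operad E2)"

definition manin_tree :: "nat \<Rightarrow> (('e \<times> 'f \<Rightarrow>\<^sub>0 'k) set btree \<Rightarrow>\<^sub>0 'k) \<Rightarrow>
    (('e btree \<Rightarrow>\<^sub>0 'k) set \<times> ('f btree \<Rightarrow>\<^sub>0 'k) set \<Rightarrow>\<^sub>0 'k) set" where
  "manin_tree n p = vcoset (opsp FP n) (tnull n) (classes n (lsplit p))"

lemma classes_keys:
  assumes "1 \<le> n"
  shows "Poly_Mapping.keys (classes n p) \<subseteq> carr (opsp (free_operad E1) n) \<times> carr (opsp (free_operad E2) n)"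
proof -
  have "classes n p \<in> {p. Poly_Mapping.keys p \<subseteq> carr (opsp (free_operad E1) n) \<times> carr (opsp (free_operad E2) n)}"
  proof (rule linear_mem_on_basis[OF classes_linear subspace_keys])
    fix x :: "'e btree \<times> 'f btree"
    obtain t t' where x: "x = (t, t')" by (cases x)
    show "classes n (basis x) \<in> {p. Poly_Mapping.keys p \<subseteq> carr (opsp (free_operad E1) n) \<times> carr (opsp (free_operad E2) n)}"
      using free_class_closed[OF assms, of t E1] free_class_closed[OF assms, of t' E2]
      by (cases "t \<in> trees E1 n \<and> t' \<in> trees E2 n") (simp_all add: x classes_single)
  qed
  then show ?thesis by simp
qed

lemma classes_carr: "1 \<le> n \<Longrightarrow> classes n p \<in> carr (opsp FP n)"
  using classes_keys by simp

lemma classes_comp: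
  assumes h: "1 \<le> m" "1 \<le> n" "i \<in> {1..m}"
    and p: "Poly_Mapping.keys p \<subseteq> trees E1 m \<times> trees E2 m" and q: "Poly_Mapping.keys q \<subseteq> trees E1 n \<times> trees E2 n"
  shows "classes (m + n - 1) (bilin_ext (\<lambda>(s, s') (t, t'). (tree_comp n i s t, tree_comp n i s' t')) p q) =
    ocomp FP m n i (classes m p) (classes n q)"
  unfolding F.pair.P_simps
proof (rule bilinear_eq_on_basis[where p = p and q = q and
      F = "\<lambda>p q. classes (m + n - 1) (bilin_ext (\<lambda>(s, s') (t, t'). (tree_comp n i s t, tree_comp n i s' t')) p q)" and
      G = "\<lambda>p q. bilin_ext (\<lambda>(f, f') (g, g'). (ocomp (free_operad E1) m n i f g, ocomp (free_operad E2) m n i f' g'))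
        (classes m p) (classes n q)"])
  fix x y assume xy: "x \<in> Poly_Mapping.keys p" "y \<in> Poly_Mapping.keys q"
  obtain s s' t t' where e: "x = (s, s')" "y = (t, t')" by (metis surj_pair)
  have tr: "s \<in> trees E1 m" "s' \<in> trees E2 m" "t \<in> trees E1 n" "t' \<in> trees E2 n"
    using xy p q by (auto simp: e)
  then show "classes (m + n - 1) (bilin_ext (\<lambda>(s, s') (t, t'). (tree_comp n i s t, tree_comp n i s' t')) (basis x) (basis y)) =
    bilin_ext (\<lambda>(f, f') (g, g'). (ocomp (free_operad E1) m n i f g, ocomp (free_operad E2) m n i f' g'))
      (classes m (basis x)) (classes n (basis y))"
    using h trees_comp[OF h(2,3) tr(1,3)] trees_comp[OF h(2,3) tr(2,4)] by (simp del: One_nat_def add: e classes_single free_class_comp)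
qed (rule linear_compose'[OF bilin_ext_linear1 classes_linear] linear_compose'[OF bilin_ext_linear2 classes_linear]
    linear_compose'[OF classes_linear bilin_ext_linear1] linear_compose'[OF classes_linear bilin_ext_linear2])+

lemma classes_act:
  assumes h: "1 \<le> n" "\<sigma> permutes {1..n}" and p: "Poly_Mapping.keys p \<subseteq> trees E1 n \<times> trees E2 n"
  shows "classes n (lin_ext (\<lambda>(a, b). (graft (\<lambda>k. Lf (inv \<sigma> k)) a, graft (\<lambda>k. Lf (inv \<sigma> k)) b)) p) =
    oact FP n (classes n p) \<sigma>"
  unfolding F.pair.P_simps
proof (rule linear_eq_on_basis[where p = p and
      f = "\<lambda>p. classes n (lin_ext (\<lambda>(a, b). (graft (\<lambda>k. Lf (inv \<sigma> k)) a, graft (\<lambda>k. Lf (inv \<sigma> k)) b)) p)" and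
      g = "\<lambda>p. lin_ext (\<lambda>(f, f'). (oact (free_operad E1) n f \<sigma>, oact (free_operad E2) n f' \<sigma>)) (classes n p)"])
  fix x assume "x \<in> Poly_Mapping.keys p"
  then show "classes n (lin_ext (\<lambda>(a, b). (graft (\<lambda>k. Lf (inv \<sigma> k)) a, graft (\<lambda>k. Lf (inv \<sigma> k)) b)) (basis x)) =
    lin_ext (\<lambda>(f, f'). (oact (free_operad E1) n f \<sigma>, oact (free_operad E2) n f' \<sigma>)) (classes n (basis x))"
    using p h by (auto simp: classes_single free_class_act tree.a_closed)
qed (rule linear_compose'[OF lin_ext_linear classes_linear] linear_compose'[OF classes_linear lin_ext_linear])+

lemma manin_tree_hom: "operad_hom (tree_operad ET) FT manin_tree"
proof (rule tree.homI)
  show "linear_operad FT" by (rule F.tensor.quot_linear_operad)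
  show "vlinear (free_vs (trees ET n)) (opsp FT n) (manin_tree n)" if "1 \<le> n" for n
  proof -
    have "vlinear (free_vs (trees ET n)) (opsp FP n) (\<lambda>p. classes n (lsplit p))"
      unfolding F.pair.P_simps
      by (rule plinear_vlinear[OF linear_compose'[OF lsplit_linear classes_linear] classes_keys[OF that]])
    from vlinear_compose[OF this operad_homD(1)[OF F.tensor.coset_hom that]]
    show ?thesis by (simp add: manin_tree_def[abs_def])
  qed
  show "manin_tree 1 (basis (Lf 1)) = ounit FT"
    using tree.u_closed[of E1] tree.u_closed[of E2]
    by (simp del: One_nat_def add: manin_tree_def classes_single tensor_operad_def quot_operad_def free_class_unit)
next
  fix m n i S T assume h: "1 \<le> m" "1 \<le> n" "i \<in> {1..m}" and S: "S \<in> trees ET m" and T: "T \<in> trees ET n"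
  show "manin_tree (m + n - 1) (basis (tree_comp n i S T)) = ocomp FT m n i (manin_tree m (basis S)) (manin_tree n (basis T))"
    unfolding manin_tree_def F.tensor.quot_comp[OF h classes_carr[OF h(1)] classes_carr[OF h(2)]]
    using classes_comp[OF h split_trees[OF S] split_trees[OF T]] split_comp[OF S h(3)] by simp
next
  fix n \<sigma> T assume h: "1 \<le> n" "\<sigma> permutes {1..n}" and T: "T \<in> trees ET n"
  show "manin_tree n (basis (graft (\<lambda>k. Lf (inv \<sigma> k)) T)) = oact FT n (manin_tree n (basis T)) \<sigma>"
    unfolding manin_tree_def F.tensor.quot_act[OF h classes_carr[OF h(1)]]
    using classes_act[OF h split_trees[OF T]] by (simp add: split_relabel)
qed

lemma manin_tree_null:
  assumes n: "1 \<le> n" and p: "p \<in> free_null ET n"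
  shows "manin_tree n p = vzero (opsp FT n)"
proof -
  have "lsplit p \<in> pair_null"
    by (rule linear_span_mem[OF lsplit_linear pair_null_subspace _ p[unfolded free_null_eq]])
      (simp add: lsplit_relators)
  then have "classes n (lsplit p) \<in> tnull n" by (rule classes_pair_null[OF n])
  then show ?thesis
    unfolding manin_tree_def using vsub.coset_zero[OF F.tensor.vsub[OF n]]
    by (simp add: F.tensor.quot_opsp vquot_def)
qed

lemma ET_tens: "e \<in> carr E1 \<Longrightarrow> f \<in> carr E2 \<Longrightarrow> tens E1 E2 e f \<in> carr ET"
  unfolding s2_tensor_simps vtensor_def vquot_def tens_def by simp

lemma manin_tree_gen:
  assumes e: "e \<in> carr E1" and f: "f \<in> carr E2"
  shows "manin_tree 2 (basis (Nd (tens E1 E2 e f) (Lf 1) (Lf 2))) =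
     tens (opsp (free_operad E1) 2) (opsp (free_operad E2) 2) (free_gen E1 e) (free_gen E2 f)"
proof -
  let ?L = "basis (Lf 1, Lf 1)" and ?R = "basis (Lf 2, Lf 2)"
  have t: "Nd e (Lf 1) (Lf 2) \<in> trees E1 2" "Nd f (Lf 1) (Lf 2) \<in> trees E2 2"
    using e f by (auto simp: trees_def)
  have n: "(1::nat) \<le> 2" by simp
  \<comment> \<open>The representative of the tensor need not be the basis pair (e, f); the error is
    in the null space and \<open>node_null1\<close> absorbs it.\<close>
  have "classes 2 (node (rep (tens E1 E2 e f)) ?L ?R) - basis (free_gen E1 e, free_gen E2 f) =
    classes 2 (node (rep (tens E1 E2 e f) - basis (e, f)) ?L ?R)"
    using t by (simp add: linear_diff'[OF node_linear1] linear_diff'[OF classes_linear] classes_single free_gen_def)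
  also have "\<dots> \<in> tnull 2" by (rule classes_pair_null[OF n node_null1[OF rep_tens[OF e f]]])
  finally have d: "classes 2 (node (rep (tens E1 E2 e f)) ?L ?R) - basis (free_gen E1 e, free_gen E2 f) \<in> tnull 2" .
  have "Poly_Mapping.keys (basis (free_gen E1 e, free_gen E2 f) :: _ \<Rightarrow>\<^sub>0 'k) \<subseteq>
      carr (opsp (free_operad E1) 2) \<times> carr (opsp (free_operad E2) 2)"
    using free_class_closed[OF n t(1)] free_class_closed[OF n t(2)] by (simp add: free_gen_def)
  then show ?thesis
    using free_coset_eq_iff[OF tensor_null_subspace[OF vspace_free_operad[OF n] vspace_free_operad[OF n]] classes_keys[OF n]] d
    by (simp add: manin_tree_def tens_def)
qed

text \<open>The choice in \<open>manin_map\<close> has the two defining properties as soon as some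
  family has them; \<open>manin_tree\<close> on representatives is such a family.\<close>

lemma manin_map:
  shows manin_map_hom: "operad_hom (free_operad ET) FT (manin_map E1 E2)"
    and manin_map_gen: "\<lbrakk>e \<in> carr E1; f \<in> carr E2\<rbrakk> \<Longrightarrow>
      manin_map E1 E2 2 (free_gen ET (tens E1 E2 e f)) =
        tens (opsp (free_operad E1) 2) (opsp (free_operad E2) 2) (free_gen E1 e) (free_gen E2 f)"
proof -
  let ?\<Phi> = "\<lambda>n X. manin_tree n (rep X)"
  have h: "operad_hom (free_operad ET) FT ?\<Phi>"
    by (rule free.lift_hom[OF manin_tree_hom F.tensor.quot_linear_operad manin_tree_null])
  have g: "?\<Phi> 2 (free_gen ET (tens E1 E2 e f)) =
        tens (opsp (free_operad E1) 2) (opsp (free_operad E2) 2) (free_gen E1 e) (free_gen E2 f)"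
    if "e \<in> carr E1" "f \<in> carr E2" for e f
  proof -
    let ?t = "Nd (tens E1 E2 e f) (Lf 1) (Lf 2)"
    have "?t \<in> trees ET 2" using ET_tens[OF that] by (auto simp: trees_def)
    then have "manin_tree 2 (rep (free_gen ET (tens E1 E2 e f))) = manin_tree 2 (basis ?t)"
      using free.lift_hom_coset[OF manin_tree_hom F.tensor.quot_linear_operad manin_tree_null, of 2 "basis ?t"]
      by (simp add: free_gen_def free_class_def)
    then show ?thesis using manin_tree_gen[OF that] by simp
  qed
  have "\<exists>\<Phi>. operad_hom (free_operad ET) FT \<Phi> \<and> (\<forall>e1\<in>carr E1. \<forall>e2\<in>carr E2.
        \<Phi> 2 (free_gen ET (tens E1 E2 e1 e2)) =
        tens (opsp (free_operad E1) 2) (opsp (free_operad E2) 2) (free_gen E1 e1) (free_gen E2 e2))"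
    using h g by blast
  from someI_ex[OF this] show "operad_hom (free_operad ET) FT (manin_map E1 E2)"
    "\<lbrakk>e \<in> carr E1; f \<in> carr E2\<rbrakk> \<Longrightarrow> manin_map E1 E2 2 (free_gen ET (tens E1 E2 e f)) =
        tens (opsp (free_operad E1) 2) (opsp (free_operad E2) 2) (free_gen E1 e) (free_gen E2 f)"
    unfolding manin_map_def by blast+
qed

end

section \<open>Coordinates on the operad of permutation algebras\<close>

text \<open>The sum of all coordinates of the tree in Perm, see \<open>perm_aug_sum\<close>. In a
  product only the right factor decides the rightmost variable, and the left factor contributes just
  this number.\<close>

primrec perm_aug :: "(nat \<Rightarrow>\<^sub>0 'k) btree \<Rightarrow> 'k::field" where
  "perm_aug (Lf j) = 1"
| "perm_aug (Nd e l r) = (Poly_Mapping.lookup e 1 + Poly_Mapping.lookup e 2) * perm_aug l * perm_aug r"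

text \<open>The coefficient of \<open>e\<^sup>n\<^sub>j\<close>: the rightmost variable of \<open>e\<^sup>2\<^sub>2(l, r) = l * r\<close> is that of \<open>r\<close>.\<close>

primrec perm_coeff :: "(nat \<Rightarrow>\<^sub>0 'k) btree \<Rightarrow> nat \<Rightarrow> 'k::field" where
  "perm_coeff (Lf i) j = (if i = j then 1 else 0)"
| "perm_coeff (Nd e l r) j = Poly_Mapping.lookup e 2 * perm_aug l * perm_coeff r j +
     Poly_Mapping.lookup e 1 * perm_coeff l j * perm_aug r"

text \<open>\<open>e\<^sup>m\<^sub>a \<circ>\<^sub>i e\<^sup>n\<^sub>b = e\<^bsup>m+n-1\<^esup>\<^sub>c\<close> for \<open>c = perm_index n i a b\<close>.\<close>

definition perm_index :: "nat \<Rightarrow> nat \<Rightarrow> nat \<Rightarrow> nat \<Rightarrow> nat" where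
  "perm_index n i a b = (if a < i then a else if a = i then b + i - 1 else a + n - 1)"

text \<open>Perm in coordinates: c stands for the sum of the \<open>c j\<close> times
  \<open>e\<^sup>n\<^sub>j\<close>. The action takes the basis vector with index k to the one with
  index \<open>inv \<sigma> k\<close>, in line with the relabelling of variables.\<close>

definition perm_operad :: "('k::field, nat \<Rightarrow> 'k) operad" where
  "perm_operad = \<lparr>
     opsp = (\<lambda>n. \<lparr> carr = {c. \<forall>j. j \<notin> {1..n} \<longrightarrow> c j = 0}, vzero = (\<lambda>j. 0),
        vadd = (\<lambda>c c' j. c j + c' j), vsmul = (\<lambda>a c j. a * c j) \<rparr>),
     ounit = (\<lambda>j. if j = 1 then 1 else 0),
     ocomp = (\<lambda>m n i c c' j. \<Sum>a=1..m. \<Sum>b=1..n. if perm_index n i a b = j then c a * c' b else 0),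
     oact = (\<lambda>n c \<sigma> j. c (\<sigma> j)) \<rparr>"

lemma perm_index_range:
  "\<lbrakk>i \<in> {1..m}; a \<in> {1..m}; b \<in> {1..n}\<rbrakk> \<Longrightarrow> perm_index n i a b \<in> {1..m + n - 1}"
  by (auto simp: perm_index_def)

lemma perm_sum_zero:
  assumes "i \<in> {1..m}" "j \<notin> {1..m + n - 1}"
  shows "(\<Sum>a=1..m. \<Sum>b=1..n. if perm_index n i a b = j then F a b else 0) = (0 :: 'k::field)"
proof (intro sum.neutral ballI)
  fix a b assume "a \<in> {1..m}" "b \<in> {1..n}"
  then show "(if perm_index n i a b = j then F a b else 0) = 0"
    using perm_index_range[OF assms(1), of a b n] assms(2) by auto
qed

lemma perm_linear_operad: "linear_operad (perm_operad :: ('k::field, nat \<Rightarrow> 'k) operad)"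
proof (rule linear_operad.intro)
  fix n :: nat assume "1 \<le> n"
  show "vspace (opsp (perm_operad :: ('k, nat \<Rightarrow> 'k) operad) n)"
    by unfold_locales (auto simp: perm_operad_def algebra_simps)
next
  show "ounit perm_operad \<in> carr (opsp (perm_operad :: ('k, nat \<Rightarrow> 'k) operad) 1)"
    by (simp add: perm_operad_def)
next
  fix m n i :: nat and g :: "nat \<Rightarrow> 'k" assume h: "1 \<le> m" "1 \<le> n" "i \<in> {1..m}" "g \<in> carr (opsp perm_operad n)"
  show "vlinear (opsp perm_operad m) (opsp perm_operad (m + n - 1)) (\<lambda>f. ocomp perm_operad m n i f g)"
    unfolding vlinear_def perm_operad_def operad.simps vs.simps
  proof (intro conjI ballI allI ext CollectI impI)
    fix c :: 'k and x y :: "nat \<Rightarrow> 'k" and j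
    let ?S = "\<lambda>F. \<Sum>a=1..m. \<Sum>b=1..n. if perm_index n i a b = j then F a b else 0 :: 'k"
    show "j \<notin> {1..m + n - 1} \<Longrightarrow> ?S (\<lambda>a b. x a * g b) = 0" by (rule perm_sum_zero[OF h(3)])
    show "?S (\<lambda>a b. (x a + y a) * g b) = ?S (\<lambda>a b. x a * g b) + ?S (\<lambda>a b. y a * g b)"
      unfolding sum.distrib[symmetric] by (intro sum.cong refl) (simp add: algebra_simps)
    show "?S (\<lambda>a b. (c * x a) * g b) = c * ?S (\<lambda>a b. x a * g b)"
      unfolding sum_distrib_left by (intro sum.cong refl) simp
  qed
next
  fix m n i :: nat and f :: "nat \<Rightarrow> 'k" assume h: "1 \<le> m" "1 \<le> n" "i \<in> {1..m}" "f \<in> carr (opsp perm_operad m)"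
  show "vlinear (opsp perm_operad n) (opsp perm_operad (m + n - 1)) (\<lambda>g. ocomp perm_operad m n i f g)"
    unfolding vlinear_def perm_operad_def operad.simps vs.simps
  proof (intro conjI ballI allI ext CollectI impI)
    fix c :: 'k and x y :: "nat \<Rightarrow> 'k" and j
    let ?S = "\<lambda>F. \<Sum>a=1..m. \<Sum>b=1..n. if perm_index n i a b = j then F a b else 0 :: 'k"
    show "j \<notin> {1..m + n - 1} \<Longrightarrow> ?S (\<lambda>a b. f a * x b) = 0" by (rule perm_sum_zero[OF h(3)])
    show "?S (\<lambda>a b. f a * (x b + y b)) = ?S (\<lambda>a b. f a * x b) + ?S (\<lambda>a b. f a * y b)"
      unfolding sum.distrib[symmetric] by (intro sum.cong refl) (simp add: algebra_simps)
    show "?S (\<lambda>a b. f a * (c * x b)) = c * ?S (\<lambda>a b. f a * x b)"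
      unfolding sum_distrib_left by (intro sum.cong refl) simp
  qed
next
  fix n :: nat and \<sigma> assume h: "1 \<le> n" "\<sigma> permutes {1..n}"
  show "vlinear (opsp (perm_operad :: ('k, nat \<Rightarrow> 'k) operad) n) (opsp perm_operad n) (\<lambda>f. oact perm_operad n f \<sigma>)"
    using permutes_not_in[OF h(2)] unfolding vlinear_def by (auto simp: perm_operad_def)
qed

lemma perm_coeff_outside: "j \<notin> set (leaves t) \<Longrightarrow> perm_coeff t j = 0"
  by (induction t) auto

text \<open>The augmentation is multiplicative over nodes, so a tree grafted at a leaf that occurs
  once contributes one factor.\<close>

lemma perm_aug_graft:
  assumes "distinct (leaves S)" "\<And>k. k \<noteq> i \<Longrightarrow> perm_aug (\<rho> k) = 1"
  shows "perm_aug (graft \<rho> S) = perm_aug S * (if i \<in> set (leaves S) then perm_aug (\<rho> i) else 1)"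
  using assms(1)
proof (induction S)
  case (Lf j)
  then show ?case using assms(2) by auto
next
  case (Nd e l r)
  then show ?case by auto
qed

text \<open>If the rightmost variable comes from leaf k of S, then its final name is found in \<rho>
  k. The tree at leaf i, when it is not this one, enters only through its augmentation.\<close>

lemma perm_coeff_graft:
  assumes "distinct (leaves S)" "\<And>k. k \<noteq> i \<Longrightarrow> perm_aug (\<rho> k) = 1"
  shows "perm_coeff (graft \<rho> S) j = (\<Sum>k\<in>set (leaves S). perm_coeff S k *
     (if k = i \<or> i \<notin> set (leaves S) then 1 else perm_aug (\<rho> i)) * perm_coeff (\<rho> k) j)"
  using assms(1)
proof (induction S)
  case (Nd e l r)
  let ?L = "set (leaves l)" and ?R = "set (leaves r)"
  let ?w = "\<lambda>A k. if k = i \<or> i \<notin> A then 1 else perm_aug (\<rho> i)"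
  have d: "distinct (leaves l)" "distinct (leaves r)" "?L \<inter> ?R = {}" using Nd.prems by auto
  have l: "perm_coeff (Nd e l r) k = Poly_Mapping.lookup e 1 * perm_coeff l k * perm_aug r" if "k \<in> ?L" for k
    using perm_coeff_outside[of k r] that d(3) by auto
  have r: "perm_coeff (Nd e l r) k = Poly_Mapping.lookup e 2 * perm_aug l * perm_coeff r k" if "k \<in> ?R" for k
    using perm_coeff_outside[of k l] that d(3) by auto
  let ?f = "\<lambda>k. perm_coeff (Nd e l r) k * ?w (?L \<union> ?R) k * perm_coeff (\<rho> k) j"
  have al: "perm_aug (graft \<rho> l) = perm_aug l * (if i \<in> ?L then perm_aug (\<rho> i) else 1)"
    and ar: "perm_aug (graft \<rho> r) = perm_aug r * (if i \<in> ?R then perm_aug (\<rho> i) else 1)"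
    by (rule perm_aug_graft[OF d(1) assms(2)], assumption, rule perm_aug_graft[OF d(2) assms(2)])
  have "(\<Sum>k\<in>?L. ?f k) = Poly_Mapping.lookup e 1 * perm_coeff (graft \<rho> l) j * perm_aug (graft \<rho> r)"
    unfolding Nd.IH(1)[OF d(1)] ar sum_distrib_left sum_distrib_right
    by (rule sum.cong[OF refl]) (use d(3) in \<open>auto simp: l simp del: perm_coeff.simps\<close>)
  moreover have "(\<Sum>k\<in>?R. ?f k) = Poly_Mapping.lookup e 2 * perm_aug (graft \<rho> l) * perm_coeff (graft \<rho> r) j"
    unfolding Nd.IH(2)[OF d(2)] al sum_distrib_left sum_distrib_right
    by (rule sum.cong[OF refl]) (use d(3) in \<open>auto simp: r simp del: perm_coeff.simps\<close>)
  moreover have "(\<Sum>k\<in>?L \<union> ?R. ?f k) = (\<Sum>k\<in>?L. ?f k) + (\<Sum>k\<in>?R. ?f k)"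
    by (rule sum.union_disjoint) (use d(3) in auto)
  ultimately show ?case by simp
qed auto

lemma perm_coeff_relabel:
  assumes "distinct (leaves T)"
  shows "perm_coeff (graft (\<lambda>k. Lf (s k)) T) j = (\<Sum>k\<in>set (leaves T). if s k = j then perm_coeff T k else 0)"
  \<comment> \<open>Every relabelled leaf has augmentation 1, so any distinguished leaf serves; 0 is
    as good as any other.\<close>
  by (subst perm_coeff_graft[OF assms, of 0]) (auto intro!: sum.cong)

lemma perm_aug_sum: "distinct (leaves T) \<Longrightarrow> perm_aug T = (\<Sum>k\<in>set (leaves T). perm_coeff T k)"
proof (induction T)
  case (Nd e l r)
  let ?L = "set (leaves l)" and ?R = "set (leaves r)"
  have d: "?L \<inter> ?R = {}" and IH: "perm_aug l = (\<Sum>k\<in>?L. perm_coeff l k)" "perm_aug r = (\<Sum>k\<in>?R. perm_coeff r k)"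
    using Nd by auto
  have "(\<Sum>k\<in>?L. perm_coeff (Nd e l r) k) = (\<Sum>k\<in>?L. Poly_Mapping.lookup e 1 * perm_coeff l k * perm_aug r)"
    by (rule sum.cong) (use d perm_coeff_outside[of _ r] in auto)
  moreover have "(\<Sum>k\<in>?R. perm_coeff (Nd e l r) k) = (\<Sum>k\<in>?R. Poly_Mapping.lookup e 2 * perm_aug l * perm_coeff r k)"
    by (rule sum.cong) (use d perm_coeff_outside[of _ l] in auto)
  moreover have "(\<Sum>k\<in>?L \<union> ?R. perm_coeff (Nd e l r) k) =
      (\<Sum>k\<in>?L. perm_coeff (Nd e l r) k) + (\<Sum>k\<in>?R. perm_coeff (Nd e l r) k)"
    by (rule sum.union_disjoint) (use d in auto)
  ultimately have "(\<Sum>k\<in>?L \<union> ?R. perm_coeff (Nd e l r) k) =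
     Poly_Mapping.lookup e 1 * perm_aug l * perm_aug r + Poly_Mapping.lookup e 2 * perm_aug l * perm_aug r"
    by (simp only: sum_distrib_left[symmetric] sum_distrib_right[symmetric] IH[symmetric])
  then show ?case by (simp add: algebra_simps)
qed simp

lemma perm_coeff_comp:
  assumes h: "i \<in> {1..m}" and S: "S \<in> trees E m" and T: "T \<in> trees E n"
  shows "perm_coeff (tree_comp n i S T) = ocomp perm_operad m n i (perm_coeff S) (perm_coeff T)"
proof
  fix j
  let ?s = "\<lambda>j. j + i - 1"
  let ?\<rho> = "\<lambda>k. if k < i then Lf k else if k = i then graft (\<lambda>j. Lf (?s j)) T else Lf (k + n - 1)"
  have S: "distinct (leaves S)" "set (leaves S) = {1..m}" and T: "distinct (leaves T)" "set (leaves T) = {1..n}"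
    using S T by (auto simp: trees_def)
  have a: "perm_aug (graft (\<lambda>j. Lf (?s j)) T) = (\<Sum>b=1..n. perm_coeff T b)"
    using perm_aug_graft[OF T(1), of 0 "\<lambda>j. Lf (?s j)"] perm_aug_sum[OF T(1)] T(2) by simp
  have "perm_coeff (tree_comp n i S T) j = (\<Sum>k=1..m. perm_coeff S k *
      (if k = i then 1 else perm_aug (?\<rho> i)) * perm_coeff (?\<rho> k) j)"
    unfolding tree_comp_def using h
    by (subst perm_coeff_graft[OF S(1), of i]) (auto simp: S(2))
  also have "\<dots> = (\<Sum>k=1..m. \<Sum>b=1..n. if perm_index n i k b = j then perm_coeff S k * perm_coeff T b else 0)"
  proof (rule sum.cong[OF refl])
    fix k
    show "perm_coeff S k * (if k = i then 1 else perm_aug (?\<rho> i)) * perm_coeff (?\<rho> k) j =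
      (\<Sum>b=1..n. if perm_index n i k b = j then perm_coeff S k * perm_coeff T b else 0)"
    proof (cases "k = i")
      case True
      then show ?thesis
        by (simp add: perm_coeff_relabel[OF T(1)] T(2) perm_index_def sum_distrib_left if_distrib[of "(*) _"] cong: if_cong)
    next
      \<comment> \<open>Here the index of the composite does not depend on b, and the sum over b is
        the augmentation of T.\<close>
      case False
      then show ?thesis by (simp del: One_nat_def add: a perm_index_def sum_distrib_left)
    qed
  qed
  finally show "perm_coeff (tree_comp n i S T) j = ocomp perm_operad m n i (perm_coeff S) (perm_coeff T) j"
    by (simp add: perm_operad_def)
qed

section \<open>The morphism from the free operad to the coordinates of Perm\<close>

definition perm_coord :: "nat \<Rightarrow> ((nat \<Rightarrow>\<^sub>0 'k) btree \<Rightarrow>\<^sub>0 'k) \<Rightarrow> nat \<Rightarrow> 'k::field" where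
  "perm_coord n p j = pm_lift (*) (\<lambda>t. perm_coeff t j) p"

lemma field_vector_space: "vector_space ((*) :: 'k::field \<Rightarrow> 'k \<Rightarrow> 'k)"
  by unfold_locales (simp_all add: algebra_simps)

lemmas scalar_lift_add = vector_space.pm_lift_add[OF field_vector_space]
  and scalar_lift_psc = vector_space.pm_lift_psc[OF field_vector_space]
  and scalar_lift_single [simp] = vector_space.pm_lift_single[OF field_vector_space]
  and scalar_lift_linear = vector_space.pm_lift_linear[OF field_vector_space]

lemma perm_coord_basis [simp]: "perm_coord n (basis t) = perm_coeff t"
  by (rule ext) (simp add: perm_coord_def)

lemma perm_coord_tree_hom: "operad_hom (tree_operad E) perm_operad perm_coord"
proof (rule tree.homI[OF perm_linear_operad])
  fix n :: nat assume "1 \<le> n"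
  have "perm_coord n p j = 0" if p: "Poly_Mapping.keys p \<subseteq> trees E n" and j: "j \<notin> {1..n}" for p j
    unfolding perm_coord_def pm_lift_def
  proof (rule sum.neutral, rule ballI)
    fix t assume "t \<in> Poly_Mapping.keys p"
    then have "perm_coeff t j = 0" using p j by (intro perm_coeff_outside) (auto simp: trees_def)
    then show "Poly_Mapping.lookup p t * perm_coeff t j = 0" by simp
  qed
  then show "vlinear (free_vs (trees E n)) (opsp perm_operad n) (perm_coord n)"
    unfolding vlinear_def
    by (simp add: perm_operad_def perm_coord_def scalar_lift_add scalar_lift_psc fun_eq_iff)
next
  show "perm_coord 1 (basis (Lf 1)) = ounit perm_operad"
    by (auto simp: perm_operad_def)
next
  fix n \<sigma> t assume h: "1 \<le> n" "\<sigma> permutes {1..n}" "t \<in> trees E n"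
  have t: "distinct (leaves t)" "set (leaves t) = {1..n}" using h(3) by (auto simp: trees_def)
  have "perm_coeff (graft (\<lambda>k. Lf (inv \<sigma> k)) t) j = perm_coeff t (\<sigma> j)" for j
  proof -
    have "inv \<sigma> k = j \<longleftrightarrow> k = \<sigma> j" for k using permutes_inverses[OF h(2)] by metis
    then show ?thesis
      using perm_coeff_outside[of "\<sigma> j" t] by (simp add: perm_coeff_relabel[OF t(1)] sum.delta)
  qed
  then show "perm_coord n (basis (graft (\<lambda>k. Lf (inv \<sigma> k)) t)) = oact perm_operad n (perm_coord n (basis t)) \<sigma>"
    by (simp add: perm_operad_def fun_eq_iff)
qed (simp add: perm_coeff_comp)

lemma perm_E_simps [simp]:
  "carr perm_E = {e. Poly_Mapping.keys e \<subseteq> {1, 2}}" "vadd perm_E = (+)" "vsmul perm_E = psc"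
  "vzero perm_E = 0" "swp perm_E = lin_ext (transpose 1 2)"
  by (simp_all add: perm_E_def vs.extend_def s2mod.fields_def)

lemma perm_E_expand:
  assumes "Poly_Mapping.keys e \<subseteq> {1, 2::nat}"
  shows "e = Poly_Mapping.single 1 (Poly_Mapping.lookup e 1) + Poly_Mapping.single 2 (Poly_Mapping.lookup e 2)"
  using assms by (intro poly_mapping_eqI) (auto simp: lookup_add lookup_single when_def in_keys_iff)

lemma perm_E_swap:
  assumes "Poly_Mapping.keys e \<subseteq> {1, 2::nat}"
  shows "lin_ext (transpose 1 2) e = Poly_Mapping.single 2 (Poly_Mapping.lookup e 1) + Poly_Mapping.single 1 (Poly_Mapping.lookup e 2)"
  by (subst perm_E_expand[OF assms]) (simp del: One_nat_def add: lin_ext_add)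

lemma perm_E_module: "s2_module (perm_E :: ('k::field, nat \<Rightarrow>\<^sub>0 'k) s2mod)"
proof (intro s2_module.intro s2_module_axioms.intro)
  let ?E = "perm_E :: ('k, nat \<Rightarrow>\<^sub>0 'k) s2mod"
  show "vspace ?E"
    using free_vspace[of "{1, 2::nat}"] unfolding vspace_def by (simp del: One_nat_def)
  have "vlinear (free_vs {1, 2}) (free_vs {1, 2}) (lin_ext (transpose 1 2) :: (nat \<Rightarrow>\<^sub>0 'k) \<Rightarrow> _)"
    by (rule plinear_vlinear[OF lin_ext_linear]) auto
  then show "vlinear ?E ?E (swp ?E)" by (simp add: vlinear_def del: One_nat_def)
  show "swp ?E (swp ?E x) = x" for x by (simp add: lin_ext_lin_ext lin_ext_id)
qed

lemma scalar_lift_diff: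
  fixes f :: "'x \<Rightarrow> 'k::field"
  shows "pm_lift (*) f (p - q) = pm_lift (*) f p - pm_lift (*) f q"
  by (rule linear_diff'[OF scalar_lift_linear])

lemma scalar_lift_lin_ext:
  fixes f :: "'y \<Rightarrow> 'k::field"
  shows "pm_lift (*) f (lin_ext h p) = (\<Sum>x\<in>Poly_Mapping.keys p. Poly_Mapping.lookup p x * f (h x))"
proof -
  have "pm_lift (*) f (lin_ext h p) = pm_lift (*) (\<lambda>x. pm_lift (*) f (lin_ext h (basis x))) p"
    by (rule linear_pm_expand[OF linear_compose'[OF lin_ext_linear scalar_lift_linear]])
  then show ?thesis by (simp add: pm_lift_def)
qed

text \<open>Coordinate and augmentation are treated together, because the coordinate of a node
  involves the augmentation of a subtree.\<close>

lemma perm_coord_relators: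
  "p \<in> tree_relators perm_E \<Longrightarrow>
    pm_lift (*) (\<lambda>t. perm_coeff t j) p = 0 \<and> pm_lift (*) perm_aug p = 0"
proof (induction rule: tree_relators.induct)
  case (rel_add e e' l r)
  show ?case
    unfolding scalar_lift_diff scalar_lift_single by (simp add: lookup_add algebra_simps)
next
  case (rel_smul e c l r)
  show ?case
    unfolding scalar_lift_diff scalar_lift_single by (simp add: algebra_simps)
next
  case (rel_swp e l r)
  then have e: "Poly_Mapping.keys e \<subseteq> {1, 2}" by simp
  have s: "Poly_Mapping.lookup (swp perm_E e) 1 = Poly_Mapping.lookup e 2"
    "Poly_Mapping.lookup (swp perm_E e) 2 = Poly_Mapping.lookup e 1"
    unfolding perm_E_simps perm_E_swap[OF e] by (simp_all add: lookup_add lookup_single)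
  show ?case
    unfolding scalar_lift_diff scalar_lift_single perm_coeff.simps perm_aug.simps s by (simp add: algebra_simps)
next
  case (rel_left p e r)
  let ?h = "\<lambda>l. Nd e l r"
  have 1: "pm_lift (*) (\<lambda>t. perm_coeff t j) (lin_ext ?h p) = Poly_Mapping.lookup e 2 * pm_lift (*) perm_aug p * perm_coeff r j +
     Poly_Mapping.lookup e 1 * pm_lift (*) (\<lambda>t. perm_coeff t j) p * perm_aug r"
    unfolding scalar_lift_lin_ext
    unfolding pm_lift_def sum_distrib_left sum_distrib_right sum.distrib[symmetric]
    by (intro sum.cong refl) (simp add: algebra_simps)
  have 2: "pm_lift (*) perm_aug (lin_ext ?h p) = (Poly_Mapping.lookup e 1 + Poly_Mapping.lookup e 2) * pm_lift (*) perm_aug p * perm_aug r"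
    unfolding scalar_lift_lin_ext
    unfolding pm_lift_def sum_distrib_left sum_distrib_right sum.distrib[symmetric]
    by (intro sum.cong refl) (simp add: algebra_simps)
  show ?case unfolding 1 2 using rel_left.IH by simp
next
  case (rel_right p e l)
  let ?h = "\<lambda>r. Nd e l r"
  have 1: "pm_lift (*) (\<lambda>t. perm_coeff t j) (lin_ext ?h p) = Poly_Mapping.lookup e 2 * perm_aug l * pm_lift (*) (\<lambda>t. perm_coeff t j) p +
     Poly_Mapping.lookup e 1 * perm_coeff l j * pm_lift (*) perm_aug p"
    unfolding scalar_lift_lin_ext
    unfolding pm_lift_def sum_distrib_left sum_distrib_right sum.distrib[symmetric]
    by (intro sum.cong refl) (simp add: algebra_simps)
  have 2: "pm_lift (*) perm_aug (lin_ext ?h p) = (Poly_Mapping.lookup e 1 + Poly_Mapping.lookup e 2) * perm_aug l * pm_lift (*) perm_aug p"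
    unfolding scalar_lift_lin_ext
    unfolding pm_lift_def sum_distrib_left sum_distrib_right sum.distrib[symmetric]
    by (intro sum.cong refl) (simp add: algebra_simps)
  show ?case unfolding 1 2 using rel_right.IH by simp
qed

lemma perm_coord_null:
  assumes "p \<in> free_null perm_E n"
  shows "perm_coord n p = vzero (opsp perm_operad n)"
proof -
  have "perm_coord n p j \<in> {0}" for j
    unfolding perm_coord_def
    by (rule linear_span_mem[OF scalar_lift_linear module.subspace_single_0[OF field_vector_space[folded module_iff_vector_space]] _ assms[unfolded free_null_eq]])
      (use perm_coord_relators in auto)
  then show ?thesis by (auto simp: perm_operad_def)
qed

definition perm_proj :: "nat \<Rightarrow> ((nat \<Rightarrow>\<^sub>0 'k) btree \<Rightarrow>\<^sub>0 'k) set \<Rightarrow> nat \<Rightarrow> 'k::field" where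
  "perm_proj n X = perm_coord n (rep X)"

lemma perm_proj_hom: "operad_hom (free_operad perm_E) perm_operad perm_proj"
  using free.lift_hom[OF perm_coord_tree_hom perm_linear_operad perm_coord_null]
  by (simp add: perm_proj_def[abs_def])

lemma perm_proj_class:
  "1 \<le> n \<Longrightarrow> Poly_Mapping.keys p \<subseteq> trees perm_E n \<Longrightarrow> perm_proj n (free_class perm_E n p) = perm_coord n p"
  using free.lift_hom_coset[OF perm_coord_tree_hom perm_linear_operad perm_coord_null, where n = n and x = p]
  by (simp add: perm_proj_def free_class_def)

text \<open>The kernel of the coordinate morphism is an ideal, hence stable under permutations; the
  two basic relations remain to be checked.\<close>

lemma perm_proj_R:
  assumes "r \<in> (perm_R :: ((nat \<Rightarrow>\<^sub>0 'k) btree \<Rightarrow>\<^sub>0 'k::field) set set)"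
  shows "r \<in> carr (opsp (free_operad perm_E) 3)" "perm_proj 3 r = (\<lambda>j. 0)"
proof -
  let ?K = "\<lambda>n. {x \<in> carr (opsp (free_operad perm_E) n). perm_proj n x = vzero (opsp (perm_operad :: ('k, nat \<Rightarrow> 'k) operad) n)}"
  have K: "operadic_ideal (free_operad (perm_E :: ('k, nat \<Rightarrow>\<^sub>0 'k) s2mod)) ?K"
    by (rule kernel_ideal[OF perm_proj_hom free.quot_linear_operad perm_linear_operad])
  let ?m = "Nd (perm_e 2 :: nat \<Rightarrow>\<^sub>0 'k)" and ?x = "Lf 1" and ?y = "Lf 2" and ?z = "Lf 3"
  have t: "?m (?m ?x ?y) ?z \<in> trees perm_E 3" "?m ?x (?m ?y ?z) \<in> trees perm_E 3" "?m (?m ?y ?x) ?z \<in> trees perm_E 3"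
    by (auto simp: trees_def perm_e_def)
  have n: "(1::nat) \<le> 3" by simp
  have mem: "free_class perm_E 3 (basis s - basis t) \<in> ?K 3"
    if "s \<in> trees perm_E 3" "t \<in> trees perm_E 3" "perm_coeff s = perm_coeff t" for s t :: "(nat \<Rightarrow>\<^sub>0 'k) btree"
  proof -
    have k: "Poly_Mapping.keys (basis s - basis t :: _ \<Rightarrow>\<^sub>0 'k) \<subseteq> trees perm_E 3"
      by (intro keys_diff_subset) (use that in auto)
    have "perm_coord 3 (basis s - basis t) = (\<lambda>j. 0)"
      using that(3) by (simp add: perm_coord_def[abs_def] scalar_lift_diff fun_eq_iff)
    then have "perm_proj 3 (free_class perm_E 3 (basis s - basis t)) = vzero (opsp perm_operad 3)"
      using perm_proj_class[OF n k] by (simp add: perm_operad_def)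
    moreover have "free_class perm_E 3 (basis s - basis t) \<in> carr (opsp (free_operad perm_E) 3)"
      using vlinearD(1)[OF free_class_linear[OF n]] k by simp
    ultimately show ?thesis by blast
  qed
  \<comment> \<open>All three monomials have \<open>x\<^sub>3\<close> as rightmost variable, so each
    has the coordinates of \<open>e\<^sup>3\<^sub>3\<close>.\<close>
  have a: "free_class perm_E 3 (basis (?m (?m ?x ?y) ?z) - basis (?m ?x (?m ?y ?z))) \<in> ?K 3"
    by (rule mem[OF t(1,2)]) (auto simp: perm_e_def lookup_single)
  have c: "free_class perm_E 3 (basis (?m (?m ?x ?y) ?z) - basis (?m (?m ?y ?x) ?z)) \<in> ?K 3"
    by (rule mem[OF t(1,3)]) (auto simp: perm_e_def lookup_single)
  have "perm_R \<subseteq> ?K 3"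
    unfolding perm_R_def Let_def
  proof (rule vspan_minimal[OF operadic_idealD(1)[OF K n]], rule subsetI, elim CollectE exE conjE)
    fix x q \<sigma>
    assume x: "x = oact (free_operad perm_E) 3 q \<sigma>" and \<sigma>: "\<sigma> permutes {1..3}"
      and "q \<in> {free_class perm_E 3 (basis (?m (?m ?x ?y) ?z) - basis (?m ?x (?m ?y ?z))),
        free_class perm_E 3 (basis (?m (?m ?x ?y) ?z) - basis (?m (?m ?y ?x) ?z))}"
    then have "q \<in> ?K 3" using a c by (elim insertE emptyE) simp_all
    then show "x \<in> ?K 3" unfolding x by (rule operadic_idealD(4)[OF K n \<sigma>])
  qed
  then have "r \<in> ?K 3" using assms by blast
  then show "r \<in> carr (opsp (free_operad perm_E) 3)" "perm_proj 3 r = (\<lambda>j. 0)"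
    by (simp_all add: perm_operad_def)
qed

lemma perm_proj_gen:
  assumes "j \<in> {1, 2}"
  shows "perm_proj 2 (free_gen perm_E (perm_e j)) = (\<lambda>i. if i = j then 1 else 0)"
proof -
  let ?t = "Nd (perm_e j) (Lf 1) (Lf 2)"
  have "?t \<in> trees perm_E 2" using assms by (auto simp: trees_def perm_e_def)
  then have "perm_proj 2 (free_gen perm_E (perm_e j)) = perm_coeff ?t"
    using perm_proj_class[of 2 "basis ?t"] by (simp add: free_gen_def del: One_nat_def)
  moreover have "perm_coeff ?t = (\<lambda>i. if i = j then 1 else 0)"
    using assms by (auto simp: perm_e_def lookup_single fun_eq_iff)
  ultimately show ?thesis by (rule trans)
qed

section \<open>Multilinear maps of degree zero\<close>

lemma multilinearI:
  assumes "\<And>x y. (\<And>j. j \<in> {1..n} \<Longrightarrow> x j = y j) \<Longrightarrow> f x = f y"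
    "\<And>j x. j \<in> {1..n} \<Longrightarrow> Vector_Spaces.linear sc sc (\<lambda>v. f (x(j := v)))"
  shows "f \<in> multilinear_maps sc n"
  using assms unfolding multilinear_maps_def by blast

lemma multilinear_linear:
  "f \<in> multilinear_maps sc n \<Longrightarrow> j \<in> {1..n} \<Longrightarrow> Vector_Spaces.linear sc sc (\<lambda>v. f (x(j := v)))"
  unfolding multilinear_maps_def by blast

section \<open>Koszul signs of permutations\<close>

lemma power_card_Collect:
  "finite S \<Longrightarrow> (- 1 :: 'k::comm_ring_1) ^ card {x \<in> S. Q x} = (\<Prod>x\<in>S. if Q x then - 1 else 1)"
proof (induction S rule: finite_induct)
  case (insert a S)
  have "{x \<in> insert a S. Q x} = (if Q a then insert a {x \<in> S. Q x} else {x \<in> S. Q x})" by auto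
  then show ?case using insert by simp
qed simp

text \<open>In product form the effect of inserting one element into B can be split off.\<close>

lemma koszul_sign_prod:
  assumes "B \<subseteq> {1..n}"
  shows "koszul_sign n \<sigma> B = (\<Prod>i\<in>B. \<Prod>k\<in>B. if i < k \<and> \<sigma> k < \<sigma> i then - 1 else 1 :: 'k::field)"
proof -
  have f: "finite B" using assms finite_subset by blast
  have "{(i, j). i \<in> {1..n} \<and> j \<in> {1..n} \<and> i < j \<and> \<sigma> i > \<sigma> j \<and> i \<in> B \<and> j \<in> B} =
     {x \<in> B \<times> B. fst x < snd x \<and> \<sigma> (snd x) < \<sigma> (fst x)}"
    using assms by auto
  then show ?thesis
    unfolding koszul_sign_def using f
    by (simp add: power_card_Collect prod.cartesian_product case_prod_unfold)
qed

text \<open>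
  Moving the argument \<open>j\<close> from even to odd changes the Koszul sign by the arguments with which \<open>j\<close>
  is inverted, and these are the ones that lie to the left of \<open>j\<close> either before or after \<open>\<sigma>\<close>.
\<close>

lemma koszul_sign_flip:
  assumes B: "B \<subseteq> {1..n}" "B' \<subseteq> {1..n}" and j: "B - {j} = B' - {j}" "(j \<in> B) \<noteq> (j \<in> B')"
    and inj: "inj \<sigma>"
  shows "koszul_sign n \<sigma> B * (\<Prod>l\<in>B - {j}. if \<sigma> l < \<sigma> j then - 1 else 1) =
    koszul_sign n \<sigma> B' * (\<Prod>l\<in>B - {j}. if l < j then - 1 else 1 :: 'k::field)"
proof -
  define C where "C = B - {j}"
  let ?s = "\<lambda>i k. if i < k \<and> \<sigma> k < \<sigma> i then - 1 else 1 :: 'k"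
  have C: "finite C" "j \<notin> C" "C \<subseteq> {1..n}"
    using B finite_subset[OF B(1)] by (auto simp: C_def)
  let ?I = "\<Prod>l\<in>C. ?s l j * ?s j l"
  have ins: "koszul_sign n \<sigma> (insert j C) = koszul_sign n \<sigma> C * ?I" if "j \<in> {1..n}"
  proof -
    have "koszul_sign n \<sigma> (insert j C) = (\<Prod>i\<in>insert j C. \<Prod>k\<in>insert j C. ?s i k)"
      using C that by (intro koszul_sign_prod) auto
    also have "\<dots> = (\<Prod>k\<in>C. ?s j k) * (\<Prod>i\<in>C. ?s i j * (\<Prod>k\<in>C. ?s i k))"
      using C by simp
    also have "\<dots> = koszul_sign n \<sigma> C * ?I"
      using C by (simp add: koszul_sign_prod prod.distrib)
    finally show ?thesis .
  qed
  have o: "j < l \<longleftrightarrow> \<not> l < j" "\<sigma> j < \<sigma> l \<longleftrightarrow> \<not> \<sigma> l < \<sigma> j" if "l \<in> C" for l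
  proof -
    have "l \<noteq> j" "\<sigma> l \<noteq> \<sigma> j" using that C(2) injD[OF inj, of l j] by auto
    then show "j < l \<longleftrightarrow> \<not> l < j" "\<sigma> j < \<sigma> l \<longleftrightarrow> \<not> \<sigma> l < \<sigma> j" by linarith+
  qed
  \<comment> \<open>A pair l, j is inverted exactly if one of l < j and \<sigma> l < \<sigma> j
    holds and the other fails, so each of the three signs is the product of the other two.\<close>
  have e1: "?s l j * ?s j l * (if \<sigma> l < \<sigma> j then - 1 else 1) = (if l < j then - 1 else 1)" if "l \<in> C" for l
    unfolding o[OF that] by (cases "l < j"; cases "\<sigma> l < \<sigma> j"; simp)
  have e2: "?s l j * ?s j l * (if l < j then - 1 else 1) = (if \<sigma> l < \<sigma> j then - 1 else 1)" if "l \<in> C" for l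
    unfolding o[OF that] by (cases "l < j"; cases "\<sigma> l < \<sigma> j"; simp)
  have e: "?I * (\<Prod>l\<in>C. if \<sigma> l < \<sigma> j then - 1 else 1) = (\<Prod>l\<in>C. if l < j then - 1 else 1 :: 'k)"
    unfolding prod.distrib[symmetric] by (rule prod.cong[OF refl e1])
  have e': "?I * (\<Prod>l\<in>C. if l < j then - 1 else 1) = (\<Prod>l\<in>C. if \<sigma> l < \<sigma> j then - 1 else 1 :: 'k)"
    unfolding prod.distrib[symmetric] by (rule prod.cong[OF refl e2])
  show ?thesis
  proof (cases "j \<in> B")
    case True
    then have b: "B = insert j C" "B' = C" "j \<in> {1..n}" using j B by (auto simp: C_def)
    show ?thesis
      unfolding C_def[symmetric] unfolding b(1,2) ins[OF b(3)] mult.assoc e ..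
  next
    case False
    then have b: "B' = insert j C" "B = C" "j \<in> {1..n}" using j B by (auto simp: C_def)
    show ?thesis
      unfolding C_def[symmetric] unfolding b(1,2) ins[OF b(3)] mult.assoc e' ..
  qed
qed

text \<open>Maps of degree zero compose without Koszul signs.\<close>

definition End0 ::
  "('k::field \<Rightarrow> 'v::ab_group_add \<Rightarrow> 'v) \<Rightarrow> ('g::ring_parity \<Rightarrow> 'v set) \<Rightarrow> ('k, (nat \<Rightarrow> 'v) \<Rightarrow> 'v) operad" where
  "End0 sc gr = \<lparr>
     opsp = (\<lambda>n. \<lparr> carr = End_hom sc gr n 0, vzero = (\<lambda>x. 0), vadd = (\<lambda>f g x. f x + g x),
                vsmul = (\<lambda>c f x. sc c (f x)) \<rparr>),
     ounit = (\<lambda>x. x 1),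
     ocomp = (\<lambda>m n i f g x. f (\<lambda>k. if k < i then x k else if k = i then g (\<lambda>j. x (j + i - 1)) else x (k + n - 1))),
     oact = End_act sc gr \<rparr>"

section \<open>Homogeneous components, parity and maps of degree zero\<close>

context graded_space
begin

lemma sc_vector_space: "vector_space sc"
  by unfold_locales

lemma hcomp_decomposition: "homogeneous_decomposition gr x (hcomp gr x)"
  unfolding hcomp_def by (rule theI'[OF gr_decomposition])

lemma hcomp_in: "hcomp gr x g \<in> gr g"
  and hcomp_finite: "finite {g. hcomp gr x g \<noteq> 0}"
  and hcomp_sum: "(\<Sum>g | hcomp gr x g \<noteq> 0. hcomp gr x g) = x"
  using hcomp_decomposition[of x] by (simp_all add: homogeneous_decomposition_def)

lemma hcomp_eqI: "homogeneous_decomposition gr x c \<Longrightarrow> hcomp gr x = c"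
  using gr_decomposition hcomp_decomposition by blast

lemma hcomp_add: "hcomp gr (x + y) g = hcomp gr x g + hcomp gr y g"
proof -
  let ?S = "{g. hcomp gr x g \<noteq> 0} \<union> {g. hcomp gr y g \<noteq> 0}" and ?c = "\<lambda>g. hcomp gr x g + hcomp gr y g"
  have f: "finite ?S" using hcomp_finite by blast
  have s: "(\<Sum>g\<in>?S. hcomp gr z g) = z" if "z = x \<or> z = y" for z
    using that by (subst (2) hcomp_sum[symmetric]) (auto intro!: sum.mono_neutral_right f)
  have "(\<Sum>g | ?c g \<noteq> 0. ?c g) = (\<Sum>g\<in>?S. ?c g)"
    by (intro sum.mono_neutral_left f) auto
  also have "\<dots> = x + y" using s by (simp add: sum.distrib)
  finally have "homogeneous_decomposition gr (x + y) ?c"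
    unfolding homogeneous_decomposition_def
    using finite_subset[of "{g. ?c g \<noteq> 0}" ?S] f subspace_add[OF gr_subspace hcomp_in hcomp_in] by (auto intro: finite_subset[OF _ f])
  from hcomp_eqI[OF this] show ?thesis by simp
qed

lemma hcomp_scale: "hcomp gr (sc a x) g = sc a (hcomp gr x g)"
proof (cases "a = 0")
  case True
  then show ?thesis using hcomp_homogeneous[OF subspace_0[OF gr_subspace]] by simp
next
  case False
  have "homogeneous_decomposition gr (sc a x) (\<lambda>g. sc a (hcomp gr x g))"
    unfolding homogeneous_decomposition_def
    using False hcomp_finite hcomp_sum subspace_scale[OF gr_subspace hcomp_in]
    by (simp add: scale_sum_right[symmetric])
  from hcomp_eqI[OF this] show ?thesis by simp
qed

lemma linear_eq_homogeneous:
  assumes "Vector_Spaces.linear sc s f" "Vector_Spaces.linear sc s h" "\<And>g v. v \<in> gr g \<Longrightarrow> f v = h v"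
  shows "f v = h v"
proof -
  have "f (\<Sum>g | hcomp gr v g \<noteq> 0. hcomp gr v g) = h (\<Sum>g | hcomp gr v g \<noteq> 0. hcomp gr v g)"
    unfolding linear_sum'[OF assms(1)] linear_sum'[OF assms(2)]
    by (rule sum.cong[OF refl assms(3)[OF hcomp_in]])
  then show ?thesis by (simp add: hcomp_sum)
qed

lemma parity_part_linear: "Vector_Spaces.linear sc sc (parity_part gr b)"
proof -
  \<comment> \<open>The support of a sum can be smaller than the union of the supports; a fixed
    finite S makes the parts of x, y and x + y comparable.\<close>
  have e: "parity_part gr b x = (\<Sum>g\<in>S. if odd g = b then hcomp gr x g else 0)"
    if "finite S" "{g. hcomp gr x g \<noteq> 0} \<subseteq> S" for S x
    unfolding parity_part_def using that
    by (subst sum.inter_filter[symmetric]) (auto intro!: sum.mono_neutral_left)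
  have "parity_part gr b (x + y) = parity_part gr b x + parity_part gr b y" for x y
  proof -
    let ?S = "{g. hcomp gr x g \<noteq> 0} \<union> {g. hcomp gr y g \<noteq> 0}"
    have f: "finite ?S" using hcomp_finite by blast
    have s: "{g. hcomp gr (x + y) g \<noteq> 0} \<subseteq> ?S" by (auto simp: hcomp_add)
    show ?thesis
      unfolding e[OF f s] e[OF f Un_upper1] e[OF f Un_upper2] sum.distrib[symmetric]
      by (rule sum.cong) (auto simp: hcomp_add)
  qed
  moreover have "parity_part gr b (sc a x) = sc a (parity_part gr b x)" for a x
  proof -
    have s: "{g. hcomp gr (sc a x) g \<noteq> 0} \<subseteq> {g. hcomp gr x g \<noteq> 0}" by (auto simp: hcomp_scale)
    show ?thesis
      unfolding e[OF hcomp_finite s] e[OF hcomp_finite order_refl, of x] scale_sum_right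
      by (rule sum.cong) (auto simp: hcomp_scale)
  qed
  ultimately show ?thesis by (simp add: Vector_Spaces.linear_iff sc_vector_space)
qed

lemma parity_inv_linear: "Vector_Spaces.linear sc sc (parity_inv gr)"
  using parity_part_linear[of False] parity_part_linear[of True]
  unfolding parity_inv_def[abs_def] Vector_Spaces.linear_iff by (simp add: scale_right_diff_distrib)

lemma id_linear: "Vector_Spaces.linear sc sc (\<lambda>v. v)"
  by (simp add: Vector_Spaces.linear_iff sc_vector_space)

lemma parity_inv_involution: "parity_inv gr (parity_inv gr v) = v"
  by (rule linear_eq_homogeneous[OF linear_compose'[OF parity_inv_linear parity_inv_linear] id_linear])
    (simp add: parity_inv_homogeneous parity_inv_homogeneous[OF gr_signed])

text \<open>The arguments are resolved into homogeneous components one position at a time; A is the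
  set of positions still to be resolved.\<close>

lemma multilinear_eq_homogeneous:
  assumes f: "f \<in> multilinear_maps sc n" and h: "h \<in> multilinear_maps sc n"
    and eq: "\<And>x \<delta>. (\<And>j. j \<in> {1..n} \<Longrightarrow> x j \<in> gr (\<delta> j)) \<Longrightarrow> f x = h x"
  shows "f = h"
proof
  fix x
  have "f x = h x" if "finite A" "A \<subseteq> {1..n}" "\<And>j. j \<in> {1..n} - A \<Longrightarrow> \<exists>g. x j \<in> gr g" for A x
    using that
  proof (induction A arbitrary: x rule: finite_induct)
    case empty
    then obtain \<delta> where "\<And>j. j \<in> {1..n} \<Longrightarrow> x j \<in> gr (\<delta> j)" by (metis Diff_empty)
    then show ?case by (rule eq)
  next
    case (insert a A)
    have a: "a \<in> {1..n}" using insert.prems by simp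
    have "f (x(a := x a)) = h (x(a := x a))"
    proof (rule linear_eq_homogeneous[OF multilinear_linear[OF f a] multilinear_linear[OF h a]])
      fix g v assume "v \<in> gr g"
      then show "f (x(a := v)) = h (x(a := v))"
        using insert.prems by (intro insert.IH) auto
    qed
    then show ?case by simp
  qed
  from this[of "{1..n}"] show "f x = h x" by simp
qed

lemma multilinear_apply:
  assumes f: "f \<in> multilinear_maps sc n" and L: "Vector_Spaces.linear sc sc L"
    and M: "\<And>k. Vector_Spaces.linear sc sc (M k)"
  shows "(\<lambda>x. L (f (\<lambda>k. M k (x k)))) \<in> multilinear_maps sc n"
proof (rule multilinearI)
  fix x y :: "nat \<Rightarrow> 'v" assume "\<And>j. j \<in> {1..n} \<Longrightarrow> x j = y j"
  then have "f (\<lambda>k. M k (x k)) = f (\<lambda>k. M k (y k))" by (intro multilinear_cong[OF f]) simp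
  then show "L (f (\<lambda>k. M k (x k))) = L (f (\<lambda>k. M k (y k)))" by simp
next
  fix j x assume j: "j \<in> {1..n}"
  have "(\<lambda>k. M k ((x(j := v)) k)) = (\<lambda>k. M k (x k))(j := M j v)" for v by auto
  then show "Vector_Spaces.linear sc sc (\<lambda>v. L (f (\<lambda>k. M k ((x(j := v)) k))))"
    using linear_compose'[OF linear_compose'[OF M[of j] multilinear_linear[OF f j, of "\<lambda>k. M k (x k)"]] L] by simp
qed

lemma multilinear_reindex:
  assumes f: "f \<in> multilinear_maps sc n" and \<pi>: "\<pi> permutes {1..n}"
    and M: "\<And>k. Vector_Spaces.linear sc sc (M k)"
  shows "(\<lambda>x. f (\<lambda>k. M k (x (\<pi> k)))) \<in> multilinear_maps sc n"
proof (rule multilinearI)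
  fix x y :: "nat \<Rightarrow> 'v" assume "\<And>j. j \<in> {1..n} \<Longrightarrow> x j = y j"
  then have "x (\<pi> k) = y (\<pi> k)" if "k \<in> {1..n}" for k
    using permutes_in_image[OF \<pi>] that by blast
  then show "f (\<lambda>k. M k (x (\<pi> k))) = f (\<lambda>k. M k (y (\<pi> k)))"
    by (intro multilinear_cong[OF f]) simp
next
  fix j x assume j: "j \<in> {1..n}"
  let ?l = "inv \<pi> j"
  have l: "?l \<in> {1..n}" using permutes_in_image[OF permutes_inv[OF \<pi>]] j by blast
  have "\<pi> k = j \<longleftrightarrow> k = ?l" for k using permutes_inverses[OF \<pi>] by metis
  then have "(\<lambda>k. M k ((x(j := v)) (\<pi> k))) = (\<lambda>k. M k (x (\<pi> k)))(?l := M ?l v)" for v by auto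
  then show "Vector_Spaces.linear sc sc (\<lambda>v. f (\<lambda>k. M k ((x(j := v)) (\<pi> k))))"
    using linear_compose'[OF M[of ?l] multilinear_linear[OF f l, of "\<lambda>k. M k (x (\<pi> k))"]] by simp
qed

lemma multilinear_scaled_sum:
  assumes "\<And>a. a \<in> A \<Longrightarrow> f a \<in> multilinear_maps sc n"
  shows "(\<lambda>x. \<Sum>a\<in>A. sc (c a) (f a x)) \<in> multilinear_maps sc n"
proof (rule multilinearI)
  fix x y :: "nat \<Rightarrow> 'v" assume "\<And>j. j \<in> {1..n} \<Longrightarrow> x j = y j"
  then have "f a x = f a y" if "a \<in> A" for a using multilinear_cong[OF assms[OF that]] by simp
  then show "(\<Sum>a\<in>A. sc (c a) (f a x)) = (\<Sum>a\<in>A. sc (c a) (f a y))" by (intro sum.cong) simp_all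
next
  fix j x assume j: "j \<in> {1..n}"
  show "Vector_Spaces.linear sc sc (\<lambda>v. \<Sum>a\<in>A. sc (c a) (f a (x(j := v))))"
    using multilinear_linear[OF assms j]
    by (intro linear_sum_fun sc_vector_space) (auto simp: Vector_Spaces.linear_iff scale_right_distrib mult.commute)
qed

lemma End_act_multilinear:
  assumes "f \<in> multilinear_maps sc n" "\<sigma> permutes {1..n}"
  shows "End_act sc gr n f \<sigma> \<in> multilinear_maps sc n"
  unfolding End_act_def[abs_def]
  by (intro multilinear_scaled_sum multilinear_reindex[OF assms(1) permutes_inv[OF assms(2)]] parity_part_linear)

lemma End_homI:
  assumes "f \<in> multilinear_maps sc n"
    "\<And>x \<delta>. (\<And>j. j \<in> {1..n} \<Longrightarrow> x j \<in> gr (\<delta> j)) \<Longrightarrow> f x \<in> gr (p + (\<Sum>j=1..n. \<delta> j))"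
  shows "f \<in> End_hom sc gr n p"
  using assms unfolding End_hom_def by blast

lemma End_hom_multilinear: "f \<in> End_hom sc gr n p \<Longrightarrow> f \<in> multilinear_maps sc n"
  by (simp add: End_hom_def)

lemma End_hom_degree:
  "f \<in> End_hom sc gr n 0 \<Longrightarrow> (\<And>j. j \<in> {1..n} \<Longrightarrow> x j \<in> gr (\<delta> j)) \<Longrightarrow> f x \<in> gr (\<Sum>j=1..n. \<delta> j)"
  unfolding End_hom_def by force

lemma degree_zero_parity:
  assumes g: "g \<in> End_hom sc gr n 0"
  shows "parity_inv gr (g x) = g (\<lambda>j. parity_inv gr (x j))"
proof -
  have gm: "g \<in> multilinear_maps sc n" using g by (rule End_hom_multilinear)
  have "(\<lambda>x. parity_inv gr (g (\<lambda>j. parity_inv gr (x j)))) = g"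
  proof (rule multilinear_eq_homogeneous[OF multilinear_apply[OF gm parity_inv_linear parity_inv_linear] gm])
    fix x \<delta> assume "\<And>j. j \<in> {1..n} \<Longrightarrow> x j \<in> gr (\<delta> j)"
    \<comment> \<open>A map of degree zero has vanishing odd part, which says that it is fixed by
      conjugation with the parity involution.\<close>
    from End_part_homogeneous[OF g this, where b = True]
    show "parity_inv gr (g (\<lambda>j. parity_inv gr (x j))) = g x"
      by (simp add: End_part_def)
  qed
  then have "parity_inv gr (g (\<lambda>j. parity_inv gr (x j))) = g x" by (rule fun_cong)
  then show ?thesis by (metis parity_inv_involution)
qed

lemma End_part_degree_zero:
  assumes "g \<in> End_hom sc gr n 0"
  shows "End_part sc gr b g x = (if b then 0 else g x)"
  using scale_left_distrib[of "1/2" "1/2" "g x"]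
  by (simp add: End_part_def degree_zero_parity[OF assms] parity_inv_involution scale_right_distrib)

text \<open>The summand for the odd part of g puts 0 into slot i of f and vanishes; the other
  summand applies no parity.\<close>

lemma End_comp_degree_zero:
  assumes f: "f \<in> multilinear_maps sc m" and g: "g \<in> End_hom sc gr n 0" and i: "i \<in> {1..m}"
  shows "End_comp sc gr n i f g = ocomp (End0 sc gr) m n i f g"
proof
  fix x
  let ?t = "\<lambda>b k. if k < i then (if b then parity_inv gr (x k) else x k)
        else if k = i then End_part sc gr b g (\<lambda>j. x (j + i - 1)) else x (k + n - 1)"
  have "f (?t True) = 0"
    by (rule multilinear_zero[OF f i]) (simp add: End_part_degree_zero[OF g])
  then show "End_comp sc gr n i f g x = ocomp (End0 sc gr) m n i f g x"
    unfolding End_comp_def UNIV_bool by (simp add: End_part_degree_zero[OF g] End0_def cong: if_cong)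
qed

text \<open>The degree count for a composite, whose slot i receives an output with the total degree
  of its block.\<close>

lemma sum_blocks:
  fixes \<delta> :: "nat \<Rightarrow> 'c::comm_monoid_add"
  assumes "1 \<le> n" "i \<in> {1..m}"
  shows "(\<Sum>k=1..m. if k < i then \<delta> k else if k = i then \<Sum>j=1..n. \<delta> (j + i - 1) else \<delta> (k + n - 1)) =
    (\<Sum>j=1..m + n - 1. \<delta> j)"
proof -
  let ?F = "\<lambda>k. if k < i then \<delta> k else if k = i then \<Sum>j=1..n. \<delta> (j + i - 1) else \<delta> (k + n - 1)"
  have "{1..m} = {1..<i} \<union> ({i} \<union> {i + 1..m})" using assms by auto
  then have "(\<Sum>k=1..m. ?F k) = (\<Sum>k\<in>{1..<i}. ?F k) + ((\<Sum>k\<in>{i}. ?F k) + (\<Sum>k\<in>{i + 1..m}. ?F k))"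
    by (simp only:) (subst sum.union_disjoint; (subst sum.union_disjoint)?; auto)
  moreover have "{1..m + n - 1} = {1..<i} \<union> ({i..i + n - 1} \<union> {i + n..m + n - 1})" using assms by auto
  then have "(\<Sum>k=1..m + n - 1. \<delta> k) = (\<Sum>k\<in>{1..<i}. \<delta> k) + ((\<Sum>k\<in>{i..i + n - 1}. \<delta> k) + (\<Sum>k\<in>{i + n..m + n - 1}. \<delta> k))"
    using assms by (simp only:) (subst sum.union_disjoint; (subst sum.union_disjoint)?; auto)
  moreover have "(\<Sum>k\<in>{i..i + n - 1}. \<delta> k) = (\<Sum>j=1..n. \<delta> (j + i - 1))"
    by (rule sum.reindex_bij_witness[where i = "\<lambda>j. j + i - 1" and j = "\<lambda>k. k + 1 - i"]) (use assms in auto)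
  moreover have "(\<Sum>k\<in>{i + n..m + n - 1}. \<delta> k) = (\<Sum>k\<in>{i + 1..m}. \<delta> (k + n - 1))"
    by (rule sum.reindex_bij_witness[where i = "\<lambda>j. j + n - 1" and j = "\<lambda>k. k + 1 - n"]) (use assms in auto)
  ultimately show ?thesis by simp
qed

lemma End0_comp_closed:
  assumes f: "f \<in> End_hom sc gr m 0" and g: "g \<in> End_hom sc gr n 0" and h: "1 \<le> n" "i \<in> {1..m}"
  shows "ocomp (End0 sc gr) m n i f g \<in> End_hom sc gr (m + n - 1) 0"
proof (rule End_homI)
  let ?y = "\<lambda>x k. if k < i then x k else if k = i then g (\<lambda>j. x (j + i - 1)) else x (k + n - 1)"
  have fm: "f \<in> multilinear_maps sc m" and gm: "g \<in> multilinear_maps sc n"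
    using f g by (auto intro: End_hom_multilinear)
  have c: "ocomp (End0 sc gr) m n i f g x = f (?y x)" for x by (simp add: End0_def)
  show "ocomp (End0 sc gr) m n i f g \<in> multilinear_maps sc (m + n - 1)"
  proof (rule multilinearI)
    fix x y :: "nat \<Rightarrow> 'v" assume xy: "\<And>j. j \<in> {1..m + n - 1} \<Longrightarrow> x j = y j"
    have "x (j + i - 1) = y (j + i - 1)" if "j \<in> {1..n}" for j
      by (rule xy) (use that h in auto)
    then have "g (\<lambda>j. x (j + i - 1)) = g (\<lambda>j. y (j + i - 1))"
      by (intro multilinear_cong[OF gm]) blast
    moreover have "x k = y k" if "k \<in> {1..m}" "k < i" for k
      by (rule xy) (use that h in auto)
    moreover have "x (k + n - 1) = y (k + n - 1)" if "k \<in> {1..m}" "i < k" for k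
      by (rule xy) (use that h in auto)
    ultimately show "ocomp (End0 sc gr) m n i f g x = ocomp (End0 sc gr) m n i f g y"
      unfolding c by (intro multilinear_cong[OF fm]) (auto simp del: One_nat_def)
  next
    fix j x assume j: "j \<in> {1..m + n - 1}"
    consider "j < i" | "i \<le> j" "j < i + n" | "i + n \<le> j" by linarith
    then show "Vector_Spaces.linear sc sc (\<lambda>v. ocomp (End0 sc gr) m n i f g (x(j := v)))"
    proof cases
      case 1
      have "(?y (x(j := v))) = (?y x)(j := v)" for v
      proof -
        have "g (\<lambda>l. (x(j := v)) (l + i - 1)) = g (\<lambda>l. x (l + i - 1))"
          using 1 by (intro multilinear_cong[OF gm]) auto
        then show ?thesis using 1 h by (auto simp: fun_eq_iff)
      qed
      then show ?thesis unfolding c using 1 j h multilinear_linear[OF fm, of j "?y x"] by simp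
    next
      case 2
      \<comment> \<open>Argument j of the composite is argument j + 1 - i of g, whose output sits in
        slot i of f.\<close>
      have e: "(?y (x(j := v))) = (?y x)(i := g ((\<lambda>l. x (l + i - 1))(j + 1 - i := v)))" for v
      proof -
        have "g (\<lambda>l. (x(j := v)) (l + i - 1)) = g ((\<lambda>l. x (l + i - 1))(j + 1 - i := v))"
          using 2 by (intro multilinear_cong[OF gm]) auto
        then show ?thesis using 2 h by (auto simp: fun_eq_iff)
      qed
      have "j + 1 - i \<in> {1..n}" using 2 by auto
      from linear_compose'[OF multilinear_linear[OF gm this, of "\<lambda>l. x (l + i - 1)"] multilinear_linear[OF fm h(2), of "?y x"]]
      show ?thesis unfolding c e .
    next
      case 3
      have "(?y (x(j := v))) = (?y x)(j + 1 - n := v)" for v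
      proof -
        have "g (\<lambda>l. (x(j := v)) (l + i - 1)) = g (\<lambda>l. x (l + i - 1))"
          using 3 by (intro multilinear_cong[OF gm]) auto
        then show ?thesis using 3 h by (auto simp: fun_eq_iff)
      qed
      moreover have "j + 1 - n \<in> {1..m}" using 3 j h unfolding atLeastAtMost_iff by linarith
      ultimately show ?thesis unfolding c using multilinear_linear[OF fm, of "j + 1 - n" "?y x"] by simp
    qed
  qed
next
  let ?y = "\<lambda>x k. if k < i then x k else if k = i then g (\<lambda>j. x (j + i - 1)) else x (k + n - 1)"
  fix x \<delta> assume x: "\<And>j. j \<in> {1..m + n - 1} \<Longrightarrow> x j \<in> gr (\<delta> j)"
  have gx: "g (\<lambda>j. x (j + i - 1)) \<in> gr (\<Sum>j=1..n. \<delta> (j + i - 1))"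
  proof (rule End_hom_degree[OF g])
    show "x (j + i - 1) \<in> gr (\<delta> (j + i - 1))" if "j \<in> {1..n}" for j
      by (rule x) (use that h in auto)
  qed
  have "f (?y x) \<in> gr (\<Sum>k=1..m. if k < i then \<delta> k else if k = i then \<Sum>j=1..n. \<delta> (j + i - 1) else \<delta> (k + n - 1))"
  proof (rule End_hom_degree[OF f])
    fix k assume k: "k \<in> {1..m}"
    have "x k \<in> gr (\<delta> k)" if "k < i" by (rule x) (use k that h in auto)
    moreover have "x (k + n - 1) \<in> gr (\<delta> (k + n - 1))" if "i < k" by (rule x) (use k that h in auto)
    ultimately show "?y x k \<in> gr (if k < i then \<delta> k else if k = i then \<Sum>j=1..n. \<delta> (j + i - 1) else \<delta> (k + n - 1))"
      using gx by auto
  qed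
  then show "ocomp (End0 sc gr) m n i f g x \<in> gr (0 + (\<Sum>j=1..m + n - 1. \<delta> j))"
    unfolding sum_blocks[OF h] by (simp add: End0_def)
qed

lemma End0_act_closed:
  assumes f: "f \<in> End_hom sc gr n 0" and \<sigma>: "\<sigma> permutes {1..n}"
  shows "End_act sc gr n f \<sigma> \<in> End_hom sc gr n 0"
proof (rule End_homI)
  show "End_act sc gr n f \<sigma> \<in> multilinear_maps sc n"
    by (rule End_act_multilinear[OF End_hom_multilinear[OF f] \<sigma>])
  fix x \<delta> assume x: "\<And>j. j \<in> {1..n} \<Longrightarrow> x j \<in> gr (\<delta> j)"
  have "inv \<sigma> k \<in> {1..n}" if "k \<in> {1..n}" for k
    using permutes_in_image[OF permutes_inv[OF \<sigma>]] that by blast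
  then have "f (\<lambda>k. x (inv \<sigma> k)) \<in> gr (\<Sum>k=1..n. \<delta> (inv \<sigma> k))"
    using x by (intro End_hom_degree[OF f]) blast
  also have "(\<Sum>k=1..n. \<delta> (inv \<sigma> k)) = (\<Sum>k=1..n. \<delta> k)"
    using sum.permute[OF permutes_inv[OF \<sigma>], of \<delta>] by (simp add: o_def)
  finally show "End_act sc gr n f \<sigma> x \<in> gr (0 + (\<Sum>j=1..n. \<delta> j))"
    using End_act_homogeneous[OF End_hom_multilinear[OF f] \<sigma> x] subspace_scale[OF gr_subspace] by simp
qed

lemma End0_linear_operad: "linear_operad (End0 sc gr)"
proof (rule linear_operad.intro)
  fix n :: nat
  have "(\<lambda>x. f x + h x) \<in> End_hom sc gr n 0" if "f \<in> End_hom sc gr n 0" "h \<in> End_hom sc gr n 0" for f h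
  proof (rule End_homI)
    show "(\<lambda>x. f x + h x) \<in> multilinear_maps sc n"
      using multilinear_scaled_sum[of UNIV "\<lambda>b. if b then f else h" n "\<lambda>b. 1"] that
      by (simp add: End_hom_multilinear UNIV_bool add.commute)
    show "f x + h x \<in> gr (0 + (\<Sum>j=1..n. \<delta> j))" if "\<And>j. j \<in> {1..n} \<Longrightarrow> x j \<in> gr (\<delta> j)" for x \<delta>
      using subspace_add[OF gr_subspace End_hom_degree End_hom_degree] \<open>f \<in> _\<close> \<open>h \<in> _\<close> that by simp
  qed
  moreover have "(\<lambda>x. sc a (f x)) \<in> End_hom sc gr n 0" if "f \<in> End_hom sc gr n 0" for a f
  proof (rule End_homI)
    show "(\<lambda>x. sc a (f x)) \<in> multilinear_maps sc n"
      using multilinear_scaled_sum[of "{f}" "\<lambda>f. f" n "\<lambda>_. a"] that by (simp add: End_hom_multilinear)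
    show "sc a (f x) \<in> gr (0 + (\<Sum>j=1..n. \<delta> j))" if "\<And>j. j \<in> {1..n} \<Longrightarrow> x j \<in> gr (\<delta> j)" for x \<delta>
      using subspace_scale[OF gr_subspace End_hom_degree] \<open>f \<in> _\<close> that by simp
  qed
  moreover have "(\<lambda>x. 0) \<in> End_hom sc gr n 0"
  proof (rule End_homI)
    show "(\<lambda>x. 0) \<in> multilinear_maps sc n" using multilinear_scaled_sum[of "{}" _ n] by simp
  qed (use subspace_0[OF gr_subspace] in simp)
  ultimately show "vspace (opsp (End0 sc gr) n)"
    by unfold_locales (auto simp: End0_def scale_right_distrib scale_left_distrib add_ac)
next
  show "ounit (End0 sc gr) \<in> carr (opsp (End0 sc gr) 1)"
    by (auto simp: End0_def intro!: End_homI multilinearI id_linear)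
next
  fix m n i :: nat and g assume h: "1 \<le> m" "1 \<le> n" "i \<in> {1..m}" "g \<in> carr (opsp (End0 sc gr) n)"
  then show "vlinear (opsp (End0 sc gr) m) (opsp (End0 sc gr) (m + n - 1)) (\<lambda>f. ocomp (End0 sc gr) m n i f g)"
    using End0_comp_closed unfolding vlinear_def by (simp add: End0_def)
next
  fix m n i :: nat and f assume h: "1 \<le> m" "1 \<le> n" "i \<in> {1..m}" "f \<in> carr (opsp (End0 sc gr) m)"
  then have fm: "f \<in> multilinear_maps sc m" by (simp add: End0_def End_hom_multilinear)
  have e: "(\<lambda>k. if k < i then x k else if k = i then v else x (k + n - 1)) =
      (\<lambda>k. if k < i then x k else if k = i then 0 else x (k + n - 1))(i := v)" for x :: "nat \<Rightarrow> 'v" and v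
    by auto
  have "f (\<lambda>k. if k < i then x k else if k = i then v + w else x (k + n - 1)) =
      f (\<lambda>k. if k < i then x k else if k = i then v else x (k + n - 1)) +
      f (\<lambda>k. if k < i then x k else if k = i then w else x (k + n - 1))"
    "f (\<lambda>k. if k < i then x k else if k = i then sc a v else x (k + n - 1)) =
      sc a (f (\<lambda>k. if k < i then x k else if k = i then v else x (k + n - 1)))" for x v w a
    unfolding e[of x "v + w"] e[of x v] e[of x w] e[of x "sc a v"]
    using multilinear_linear[OF fm h(3)] by (rule linear_add' linear_scale')+
  then show "vlinear (opsp (End0 sc gr) n) (opsp (End0 sc gr) (m + n - 1)) (\<lambda>g. ocomp (End0 sc gr) m n i f g)"
    using End0_comp_closed h unfolding vlinear_def by (simp add: End0_def)
next
  fix n :: nat and \<sigma> assume h: "1 \<le> n" "\<sigma> permutes {1..n}"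
  show "vlinear (opsp (End0 sc gr) n) (opsp (End0 sc gr) n) (\<lambda>f. oact (End0 sc gr) n f \<sigma>)"
    using End0_act_closed[OF _ h(2)] unfolding vlinear_def
    by (simp add: End0_def End_act_def fun_eq_iff scale_right_distrib sum.distrib scale_sum_right mult.commute)
qed

text \<open>The values lie in degree zero, where composition has no signs. The degree condition
  becomes the carrier of \<open>End0\<close>; the action keeps its signs, which depend on the
  arguments.\<close>

lemma graded_algebra_iff: "graded_algebra P sc gr \<phi> \<longleftrightarrow> operad_hom P (End0 sc gr) \<phi>"
proof -
  have sub: "End_hom sc gr n 0 \<subseteq> carr (End_space sc gr n)" for n
    unfolding End_space_def Let_def using vspan_superset by fastforce
  have s: "vadd (End_space sc gr n) = (\<lambda>f g x. f x + g x)" "vsmul (End_space sc gr n) = (\<lambda>c f x. sc c (f x))" for n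
    by (simp_all add: End_space_def Let_def)
  have c: "ocomp (End_operad sc gr) m n i (\<phi> m f) (\<phi> n g) = ocomp (End0 sc gr) m n i (\<phi> m f) (\<phi> n g)"
    if "\<phi> m f \<in> End_hom sc gr m 0" "\<phi> n g \<in> End_hom sc gr n 0" "i \<in> {1..m}" for m n i f g
    using End_comp_degree_zero[OF End_hom_multilinear[OF that(1)] that(2,3)] by (simp add: End_operad_def)
  have a: "oact (End_operad sc gr) = oact (End0 sc gr)" "ounit (End_operad sc gr) = ounit (End0 sc gr)"
    "opsp (End_operad sc gr) = End_space sc gr" "ohom (End_operad sc gr) = End_hom sc gr"
    by (simp_all add: End_operad_def End0_def)
  have l: "vlinear (opsp P n) (End_space sc gr n) (\<phi> n) \<and> (\<forall>p\<in>carr (opsp P n). \<phi> n p \<in> End_hom sc gr n 0) \<longleftrightarrow>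
      vlinear (opsp P n) (opsp (End0 sc gr) n) (\<phi> n)" for n
    unfolding vlinear_def s using sub[of n] by (auto simp: End0_def)
  have mem: "\<phi> n p \<in> End_hom sc gr n 0" if "vlinear (opsp P n) (opsp (End0 sc gr) n) (\<phi> n)" "p \<in> carr (opsp P n)" for n p
    using that l by blast
  show ?thesis
  proof
    assume g: "graded_algebra P sc gr \<phi>"
    then have h: "operad_hom P (End_operad sc gr) \<phi>"
      and m: "\<And>n p. 1 \<le> n \<Longrightarrow> p \<in> carr (opsp P n) \<Longrightarrow> \<phi> n p \<in> End_hom sc gr n 0"
      unfolding graded_algebra_def a by blast+
    show "operad_hom P (End0 sc gr) \<phi>"
      unfolding operad_hom_def
    proof (intro conjI allI impI ballI)
      show "vlinear (opsp P n) (opsp (End0 sc gr) n) (\<phi> n)" if "1 \<le> n" for n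
        using l[of n] operad_homD(1)[OF h that] m[OF that] unfolding a by blast
    qed (simp_all add: operad_homD(2-4)[OF h] m c a del: One_nat_def)
  next
    assume h: "operad_hom P (End0 sc gr) \<phi>"
    have m: "\<phi> n p \<in> End_hom sc gr n 0" if "1 \<le> n" "p \<in> carr (opsp P n)" for n p
      by (rule mem[OF operad_homD(1)[OF h that(1)] that(2)])
    have "operad_hom P (End_operad sc gr) \<phi>"
      unfolding operad_hom_def
    proof (intro conjI allI impI ballI)
      show "vlinear (opsp P n) (opsp (End_operad sc gr) n) (\<phi> n)" if "1 \<le> n" for n
        using l[of n] operad_homD(1)[OF h that] unfolding a by blast
    qed (simp_all add: operad_homD(2-4)[OF h] m c a del: One_nat_def)
    then show "graded_algebra P sc gr \<phi>" unfolding graded_algebra_def a using m by blast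
  qed
qed

end

section \<open>Derived operations on the shifted space\<close>

context graded_space
begin

lemma shift_graded_space: "graded_space sc (shift gr)"
proof (unfold_locales)
  show "subspace (shift gr g)" for g unfolding shift_def by (rule gr_subspace)
  fix x
  \<comment> \<open>Decompositions for the shifted grading are the old ones reindexed by g + 1,
    because \<open>shift gr (g + 1) = gr g\<close>.\<close>
  have d: "homogeneous_decomposition (shift gr) x c \<longleftrightarrow> homogeneous_decomposition gr x (\<lambda>g. c (g + 1))" for c
  proof -
    have b: "bij_betw (\<lambda>g. g + 1) {g. c (g + 1) \<noteq> 0} {g. c g \<noteq> 0}"
      by (rule bij_betwI[where g = "\<lambda>g. g - 1"]) auto
    have "(\<forall>g. c g \<in> gr (g - 1)) \<longleftrightarrow> (\<forall>g. c (g + 1) \<in> gr g)"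
      by (metis add_diff_cancel_right' diff_add_cancel)
    then show ?thesis
      unfolding homogeneous_decomposition_def shift_def
      using bij_betw_finite[OF b] sum.reindex_bij_betw[OF b, of c] by simp
  qed
  show "\<exists>!c. homogeneous_decomposition (shift gr) x c"
  proof
    show "homogeneous_decomposition (shift gr) x (\<lambda>g. hcomp gr x (g - 1))"
      unfolding d using hcomp_decomposition by simp
    fix c assume "homogeneous_decomposition (shift gr) x c"
    then have "hcomp gr x = (\<lambda>g. c (g + 1))" unfolding d by (rule hcomp_eqI)
    then show "c = (\<lambda>g. hcomp gr x (g - 1))" by simp
  qed
qed

end

context dg_algebra
begin

sublocale sh: graded_space sc "shift gr"
  by (rule shift_graded_space)

abbreviation "par \<equiv> parity_inv gr"

text \<open>The differential is odd and therefore anticommutes with the parity involution.\<close>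

lemma d_par: "par (d v) = - d (par v)"
proof (rule linear_eq_homogeneous[where f = "\<lambda>v. par (d v)" and h = "\<lambda>v. - d (par v)"])
  show "Vector_Spaces.linear sc sc (\<lambda>v. par (d v))" by (rule linear_compose'[OF d_linear parity_inv_linear])
  show "Vector_Spaces.linear sc sc (\<lambda>v. - d (par v))"
    using linear_compose'[OF parity_inv_linear d_linear] unfolding Vector_Spaces.linear_iff by simp
  fix g v assume v: "v \<in> gr g"
  show "par (d v) = - d (par v)"
    using parity_inv_homogeneous[OF v] parity_inv_homogeneous[OF d_degree[OF v]]
    by (simp add: linear_scale'[OF d_linear])
qed

lemma d_zero: "d 0 = 0"
  by (rule linear_zero'[OF d_linear])

lemma d_par_d: "d (par (d v)) = 0"
  by (simp add: d_par linear_neg'[OF d_linear] d_square d_zero)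

text \<open>
  With \<open>d s\<^sup>-\<^sup>1\<close> of degree zero, \<open>dslot j f\<close> is \<open>s f (d s\<^sup>-\<^sup>1, \<dots>, s\<^sup>-\<^sup>1, \<dots>, d s\<^sup>-\<^sup>1)\<close> with the bare \<open>s\<^sup>-\<^sup>1\<close> in
  position \<open>j\<close>.  Its only Koszul sign arises when \<open>s\<^sup>-\<^sup>1\<close> passes the arguments to its left.
\<close>

definition slot :: "nat \<Rightarrow> nat \<Rightarrow> 'a \<Rightarrow> 'a" where
  "slot j k v = (if k < j then par (d v) else if k = j then v else d v)"

definition dslot :: "nat \<Rightarrow> ((nat \<Rightarrow> 'a) \<Rightarrow> 'a) \<Rightarrow> (nat \<Rightarrow> 'a) \<Rightarrow> 'a" where
  "dslot j f x = f (\<lambda>k. slot j k (x k))"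

lemma slot_linear: "Vector_Spaces.linear sc sc (slot j k)"
proof -
  consider "k < j" | "k = j" | "j < k" by linarith
  then show ?thesis
    using linear_compose'[OF d_linear parity_inv_linear] id_linear d_linear
    by cases (simp_all add: slot_def[abs_def])
qed

lemma dslot_multilinear:
  assumes "f \<in> multilinear_maps sc n"
  shows "dslot j f \<in> multilinear_maps sc n"
  unfolding dslot_def[abs_def]
  by (rule multilinear_apply[OF assms id_linear slot_linear])

lemma dslot_hom:
  assumes f: "f \<in> End_hom sc gr n 0" and j: "j \<in> {1..n}"
  shows "dslot j f \<in> End_hom sc (shift gr) n 0"
proof (rule sh.End_homI)
  show "dslot j f \<in> multilinear_maps sc n" by (rule dslot_multilinear[OF End_hom_multilinear[OF f]])
  fix x \<delta> assume x: "\<And>k. k \<in> {1..n} \<Longrightarrow> x k \<in> shift gr (\<delta> k)"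
  have dx: "d (x k) \<in> gr (\<delta> k)" if "k \<in> {1..n}" for k
    using d_degree[of "x k" "\<delta> k - 1"] x[OF that] by (simp add: shift_def)
  \<comment> \<open>With degrees counted in sA, applying d preserves the number and the bare
    argument j loses 1, the degree that the final s restores.\<close>
  have "dslot j f x \<in> gr (\<Sum>k=1..n. \<delta> k - (if k = j then 1 else 0))"
    unfolding dslot_def
  proof (rule End_hom_degree[OF f])
    fix k assume k: "k \<in> {1..n}"
    show "slot j k (x k) \<in> gr (\<delta> k - (if k = j then 1 else 0))"
      using dx[OF k] x[OF k] parity_inv_homogeneous[OF dx[OF k]] gr_signed[OF dx[OF k]]
      by (auto simp: slot_def shift_def)
  qed
  also have "(\<Sum>k=1..n. \<delta> k - (if k = j then 1 else 0)) = (\<Sum>k=1..n. \<delta> k) - 1"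
    using j by (simp add: sum_subtractf sum.delta)
  finally show "dslot j f x \<in> shift gr (0 + (\<Sum>k=1..n. \<delta> k))" by (simp add: shift_def)
qed

text \<open>In \<open>dslot j g x\<close> all arguments except j are killed by d. If d is a
  derivation of g, it acts on the bare argument only, and the sign from passing the arguments on the
  left cancels the parity in \<open>slot\<close>.\<close>

definition derivative_closed :: "nat \<Rightarrow> ((nat \<Rightarrow> 'a) \<Rightarrow> 'a) \<Rightarrow> bool" where
  "derivative_closed n g \<longleftrightarrow> (\<forall>j\<in>{1..n}. \<forall>x. d (dslot j g x) = g (\<lambda>k. d (x k)))"

text \<open>Outside the block of g the slots agree by the definition of \<open>perm_index\<close>.
  Inside it, the question is how the outer slot i meets the output of g, which depends on the order
  of a and i.\<close>

lemma dslot_comp: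
  assumes f: "f \<in> End_hom sc gr m 0" and g: "g \<in> End_hom sc gr n 0" and dg: "derivative_closed n g"
    and h: "1 \<le> n" "i \<in> {1..m}" and a: "a \<in> {1..m}" and b: "b \<in> {1..n}"
  shows "ocomp (End0 sc (shift gr)) m n i (dslot a f) (dslot b g) =
    dslot (perm_index n i a b) (ocomp (End0 sc gr) m n i f g)"
proof
  fix x
  let ?c = "perm_index n i a b"
  let ?G = "dslot b g (\<lambda>j. x (j + i - 1))"
  have gm: "g \<in> multilinear_maps sc n" by (rule End_hom_multilinear[OF g])
  have dG: "d ?G = g (\<lambda>j. d (x (j + i - 1)))" using dg b by (simp add: derivative_closed_def)
  have mid: "slot a i ?G = g (\<lambda>j. slot ?c (j + i - 1) (x (j + i - 1)))"
  proof -
    consider "a < i" | "a = i" | "i < a" by linarith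
    then show ?thesis
    proof cases
      \<comment> \<open>The bare slot lies left of the block. The outer d meets the output of g, and
        \<open>derivative_closed\<close> turns it into d on every argument of g, whatever b
        is.\<close>
      case 1
      have "g (\<lambda>j. d (x (j + i - 1))) = g (\<lambda>j. slot ?c (j + i - 1) (x (j + i - 1)))"
        using 1 by (intro multilinear_cong[OF gm]) (auto simp: slot_def perm_index_def)
      then show ?thesis using 1 dG by (simp add: slot_def)
    next
      case 2
      have "slot b j (x (j + i - 1)) = slot ?c (j + i - 1) (x (j + i - 1))" if "j \<in> {1..n}" for j
      proof -
        have "j + i - 1 < b + i - 1 \<longleftrightarrow> j < b" "j + i - 1 = b + i - 1 \<longleftrightarrow> j = b"
          using that b h(2) unfolding atLeastAtMost_iff by linarith+
        then show ?thesis using 2 by (simp add: slot_def perm_index_def)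
      qed
      then have "?G = g (\<lambda>j. slot ?c (j + i - 1) (x (j + i - 1)))"
        unfolding dslot_def by (intro multilinear_cong[OF gm]) blast
      then show ?thesis using 2 by (simp add: slot_def[of i i])
    next
      \<comment> \<open>The block lies left of the bare slot and carries a parity sign as well; g
        has degree zero, so the parity distributes over its arguments.\<close>
      case 3
      have "g (\<lambda>j. par (d (x (j + i - 1)))) = g (\<lambda>j. slot ?c (j + i - 1) (x (j + i - 1)))"
        using 3 h by (intro multilinear_cong[OF gm]) (auto simp: slot_def perm_index_def)
      then show ?thesis using 3 dG by (simp add: slot_def degree_zero_parity[OF g])
    qed
  qed
  have l: "slot a k = slot ?c k" if "k < i" for k
    using that h b by (auto simp: slot_def fun_eq_iff perm_index_def)
  have r: "slot a k = slot ?c (k + n - 1)" if "i < k" for k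
    using that h b by (auto simp: slot_def fun_eq_iff perm_index_def)
  have "(\<lambda>k. slot a k (if k < i then x k else if k = i then ?G else x (k + n - 1))) =
    (\<lambda>k. if k < i then slot ?c k (x k) else if k = i then g (\<lambda>j. slot ?c (j + i - 1) (x (j + i - 1)))
       else slot ?c (k + n - 1) (x (k + n - 1)))"
  proof
    fix k
    consider "k < i" | "k = i" | "i < k" by linarith
    then show "slot a k (if k < i then x k else if k = i then ?G else x (k + n - 1)) =
      (if k < i then slot ?c k (x k) else if k = i then g (\<lambda>j. slot ?c (j + i - 1) (x (j + i - 1)))
       else slot ?c (k + n - 1) (x (k + n - 1)))"
      by cases (simp_all add: l r mid del: One_nat_def)
  qed
  then show "ocomp (End0 sc (shift gr)) m n i (dslot a f) (dslot b g) x =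
      dslot ?c (ocomp (End0 sc gr) m n i f g) x"
    by (simp add: End0_def dslot_def[of a] dslot_def[of ?c] del: One_nat_def)
qed

lemma derivative_closed_comp:
  assumes f: "f \<in> End_hom sc gr m 0" and g: "g \<in> End_hom sc gr n 0"
    and df: "derivative_closed m f" and dg: "derivative_closed n g" and h: "1 \<le> n" "i \<in> {1..m}"
  shows "derivative_closed (m + n - 1) (ocomp (End0 sc gr) m n i f g)"
  unfolding derivative_closed_def
proof (intro ballI allI)
  fix c x assume c: "c \<in> {1..m + n - 1}"
  \<comment> \<open>Every position c is the index of some composite. Outside the block of g any b
    gives the same index, and 1 is taken.\<close>
  obtain a b where ab: "a \<in> {1..m}" "b \<in> {1..n}" "c = perm_index n i a b"
  proof -
    consider "c < i" | "i \<le> c" "c < i + n" | "i + n \<le> c" by linarith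
    then show ?thesis
    proof cases
      case 1
      then show ?thesis using that[of c 1] c h by (auto simp: perm_index_def)
    next
      case 2
      have "c + 1 - i \<in> {1..n}" "c = perm_index n i i (c + 1 - i)"
        using 2 h unfolding atLeastAtMost_iff perm_index_def by (linarith, simp)
      with h(2) show ?thesis by (rule that)
    next
      case 3
      have "c + 1 - n \<in> {1..m}" "1 \<in> {1..n}" "c = perm_index n i (c + 1 - n) 1"
        using 3 h c unfolding atLeastAtMost_iff perm_index_def by (linarith, simp, auto)
      then show ?thesis by (rule that)
    qed
  qed
  let ?y = "\<lambda>k. if k < i then x k else if k = i then dslot b g (\<lambda>j. x (j + i - 1)) else x (k + n - 1)"
  have "d (dslot c (ocomp (End0 sc gr) m n i f g) x) = d (dslot a f ?y)"
    unfolding ab(3) dslot_comp[OF f g dg h ab(1,2), symmetric] by (simp add: End0_def)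
  also have "\<dots> = f (\<lambda>k. d (?y k))" using df ab(1) by (simp add: derivative_closed_def)
  also have "(\<lambda>k. d (?y k)) = (\<lambda>k. if k < i then d (x k) else if k = i then g (\<lambda>j. d (x (j + i - 1))) else d (x (k + n - 1)))"
    using dg ab(2) by (auto simp: derivative_closed_def fun_eq_iff)
  finally show "d (dslot c (ocomp (End0 sc gr) m n i f g) x) = ocomp (End0 sc gr) m n i f g (\<lambda>k. d (x k))"
    by (simp add: End0_def)
qed

text \<open>Even arguments contribute 1 and j fails Q. This brings the sign that the bare slot picks
  up from its left neighbours into the form used in \<open>koszul_sign_flip\<close>.\<close>

lemma sgn_prod:
  fixes j n :: nat
  assumes "\<not> Q j"
  shows "(\<Prod>l\<in>{l \<in> {1..n}. Q l}. sgn_of (\<delta> l)) =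
    (\<Prod>l\<in>{k \<in> {1..n}. odd (\<delta> k)} - {j}. if Q l then - 1 else 1 :: 'k)"
proof -
  let ?g = "\<lambda>l. if Q l then - 1 else 1 :: 'k"
  have e: "{k \<in> {1..n}. odd (\<delta> k)} - {j} = {l \<in> {1..n}. odd (\<delta> l) \<and> l \<noteq> j}" by auto
  have "prod ?g {l \<in> {1..n}. odd (\<delta> l) \<and> l \<noteq> j} = (\<Prod>l\<in>{1..n}. if odd (\<delta> l) \<and> l \<noteq> j then ?g l else 1)"
    by (rule prod.inter_filter) simp
  also have "\<dots> = (\<Prod>l\<in>{1..n}. if Q l then sgn_of (\<delta> l) else 1)"
    by (rule prod.cong) (use assms in auto)
  also have "\<dots> = (\<Prod>l\<in>{l \<in> {1..n}. Q l}. sgn_of (\<delta> l))"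
    by (rule prod.inter_filter[symmetric]) simp
  finally show ?thesis unfolding e by (rule sym)
qed

text \<open>Argument j is sent to position \<sigma> j of f. The Koszul sign in sA and the one in A
  differ in the parity of j alone, and the slot signs after and before \<sigma> compensate for this
  by \<open>koszul_sign_flip\<close>.\<close>

lemma dslot_act:
  assumes f: "f \<in> End_hom sc gr n 0" and \<sigma>: "\<sigma> permutes {1..n}" and j: "j \<in> {1..n}"
  shows "End_act sc (shift gr) n (dslot (\<sigma> j) f) \<sigma> = dslot j (End_act sc gr n f \<sigma>)"
proof (rule sh.multilinear_eq_homogeneous)
  have fm: "f \<in> multilinear_maps sc n" by (rule End_hom_multilinear[OF f])
  have am: "End_act sc gr n f \<sigma> \<in> multilinear_maps sc n" by (rule End_act_multilinear[OF fm \<sigma>])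
  show "End_act sc (shift gr) n (dslot (\<sigma> j) f) \<sigma> \<in> multilinear_maps sc n"
    by (rule sh.End_act_multilinear[OF dslot_multilinear[OF fm] \<sigma>])
  show "dslot j (End_act sc gr n f \<sigma>) \<in> multilinear_maps sc n" by (rule dslot_multilinear[OF am])
  fix x \<delta> assume x: "\<And>k. k \<in> {1..n} \<Longrightarrow> x k \<in> shift gr (\<delta> k)"
  have dx: "d (x k) \<in> gr (\<delta> k)" if "k \<in> {1..n}" for k
    using d_degree[of "x k" "\<delta> k - 1"] x[OF that] by (simp add: shift_def)
  have inv: "inv \<sigma> k \<in> {1..n}" if "k \<in> {1..n}" for k
    using permutes_in_image[OF permutes_inv[OF \<sigma>]] that by blast
  have \<sigma>_in: "\<sigma> k \<in> {1..n} \<longleftrightarrow> k \<in> {1..n}" for k by (rule permutes_in_image[OF \<sigma>])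
  have \<sigma>_inv: "\<sigma> (inv \<sigma> k) = k" "inv \<sigma> (\<sigma> k) = k" for k using permutes_inverses[OF \<sigma>] by auto
  \<comment> \<open>What f receives up to signs; \<open>?\<delta>\<close> gives the degrees in A.
    Only the bare argument has a degree that differs from its degree in sA.\<close>
  let ?z = "\<lambda>l. if l = j then x l else d (x l)"
  let ?\<delta> = "\<lambda>l. if l = j then \<delta> l - 1 else \<delta> l"
  let ?B = "{k \<in> {1..n}. odd (\<delta> k)}" and ?B' = "{k \<in> {1..n}. odd (?\<delta> k)}"
  have z: "?z k \<in> gr (?\<delta> k)" if "k \<in> {1..n}" for k
    using dx[OF that] x[OF that] by (cases "k = j") (simp_all add: shift_def)
  have "dslot (\<sigma> j) f (\<lambda>k. x (inv \<sigma> k)) =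
      f (\<lambda>k. if k \<in> {1..<\<sigma> j} then sc (sgn_of (\<delta> (inv \<sigma> k))) (?z (inv \<sigma> k)) else ?z (inv \<sigma> k))"
    unfolding dslot_def
  proof (rule multilinear_cong[OF fm], rule ballI)
    fix k assume k: "k \<in> {1..n}"
    have "inv \<sigma> k = j \<longleftrightarrow> k = \<sigma> j" using \<sigma>_inv by metis
    then show "slot (\<sigma> j) k (x (inv \<sigma> k)) =
        (if k \<in> {1..<\<sigma> j} then sc (sgn_of (\<delta> (inv \<sigma> k))) (?z (inv \<sigma> k)) else ?z (inv \<sigma> k))"
      using parity_inv_homogeneous[OF dx[OF inv[OF k]]] k by (auto simp: slot_def)
  qed
  also have "\<dots> = sc (\<Prod>k\<in>{1..<\<sigma> j}. sgn_of (\<delta> (inv \<sigma> k))) (f (\<lambda>k. ?z (inv \<sigma> k)))"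
    using \<sigma>_in[of j] j by (intro multilinear_scale[OF fm]) auto
  also have "(\<Prod>k\<in>{1..<\<sigma> j}. sgn_of (\<delta> (inv \<sigma> k))) = (\<Prod>l\<in>{l \<in> {1..n}. \<sigma> l < \<sigma> j}. sgn_of (\<delta> l) :: 'k)"
  proof (rule prod.reindex_bij_witness[where i = \<sigma> and j = "inv \<sigma>"])
    show "inv \<sigma> k \<in> {l \<in> {1..n}. \<sigma> l < \<sigma> j}" if "k \<in> {1..<\<sigma> j}" for k
    proof -
      have "k \<in> {1..n}" using that \<sigma>_in[of j] j by auto
      then show ?thesis using inv[of k] that by (simp add: \<sigma>_inv)
    qed
    show "\<sigma> l \<in> {1..<\<sigma> j}" if "l \<in> {l \<in> {1..n}. \<sigma> l < \<sigma> j}" for l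
      using that \<sigma>_in[of l] by auto
  qed (simp_all add: \<sigma>_inv)
  also have "\<dots> = (\<Prod>l\<in>?B - {j}. if \<sigma> l < \<sigma> j then - 1 else 1)"
    by (rule sgn_prod) simp
  finally have L: "dslot (\<sigma> j) f (\<lambda>k. x (inv \<sigma> k)) =
     sc (\<Prod>l\<in>?B - {j}. if \<sigma> l < \<sigma> j then - 1 else 1) (f (\<lambda>k. ?z (inv \<sigma> k)))" .
  have "dslot j (End_act sc gr n f \<sigma>) x =
      End_act sc gr n f \<sigma> (\<lambda>k. if k \<in> {1..<j} then sc (sgn_of (\<delta> k)) (?z k) else ?z k)"
    unfolding dslot_def
  proof (rule multilinear_cong[OF am], rule ballI)
    fix k assume k: "k \<in> {1..n}"
    then show "slot j k (x k) = (if k \<in> {1..<j} then sc (sgn_of (\<delta> k)) (?z k) else ?z k)"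
      using parity_inv_homogeneous[OF dx[OF k]] by (auto simp: slot_def)
  qed
  also have "\<dots> = sc (\<Prod>k\<in>{1..<j}. sgn_of (\<delta> k)) (End_act sc gr n f \<sigma> ?z)"
    using j by (intro multilinear_scale[OF am]) auto
  also have "(\<Prod>k\<in>{1..<j}. sgn_of (\<delta> k)) = (\<Prod>l\<in>?B - {j}. if l < j then - 1 else 1 :: 'k)"
  proof -
    have "{1..<j} = {l \<in> {1..n}. l < j}" using j by auto
    then show ?thesis using sgn_prod[where Q = "\<lambda>l. l < j" and j = j and n = n and \<delta> = \<delta>] by simp
  qed
  also have "End_act sc gr n f \<sigma> ?z = sc (koszul_sign n \<sigma> ?B') (f (\<lambda>k. ?z (inv \<sigma> k)))"
    by (rule End_act_homogeneous[OF fm \<sigma> z])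
  finally have R: "dslot j (End_act sc gr n f \<sigma>) x =
     sc (koszul_sign n \<sigma> ?B' * (\<Prod>l\<in>?B - {j}. if l < j then - 1 else 1)) (f (\<lambda>k. ?z (inv \<sigma> k)))"
    by (simp add: mult.commute)
  have K: "koszul_sign n \<sigma> ?B * (\<Prod>l\<in>?B - {j}. if \<sigma> l < \<sigma> j then - 1 else 1) =
      koszul_sign n \<sigma> ?B' * (\<Prod>l\<in>?B - {j}. if l < j then - 1 else 1 :: 'k)"
    by (rule koszul_sign_flip[OF _ _ _ _ permutes_inj[OF \<sigma>]]) (use j in auto)
  have A: "End_act sc (shift gr) n (dslot (\<sigma> j) f) \<sigma> x = sc (koszul_sign n \<sigma> ?B) (dslot (\<sigma> j) f (\<lambda>k. x (inv \<sigma> k)))"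
    by (rule sh.End_act_homogeneous[OF dslot_multilinear[OF fm] \<sigma> x])
  show "End_act sc (shift gr) n (dslot (\<sigma> j) f) \<sigma> x = dslot j (End_act sc gr n f \<sigma>) x"
    unfolding A L R scale_scale K ..
qed

lemma derivative_closed_act:
  assumes f: "f \<in> End_hom sc gr n 0" and \<sigma>: "\<sigma> permutes {1..n}" and df: "derivative_closed n f"
  shows "derivative_closed n (End_act sc gr n f \<sigma>)"
  unfolding derivative_closed_def
proof (intro ballI)
  fix j assume j: "j \<in> {1..n}"
  have fm: "f \<in> multilinear_maps sc n" by (rule End_hom_multilinear[OF f])
  have am: "End_act sc gr n f \<sigma> \<in> multilinear_maps sc n" by (rule End_act_multilinear[OF fm \<sigma>])
  have "(\<lambda>x. d (dslot j (End_act sc gr n f \<sigma>) x)) = (\<lambda>x. End_act sc gr n f \<sigma> (\<lambda>k. d (x k)))"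
  proof (rule sh.multilinear_eq_homogeneous)
    show "(\<lambda>x. d (dslot j (End_act sc gr n f \<sigma>) x)) \<in> multilinear_maps sc n"
      unfolding dslot_def by (rule multilinear_apply[OF am d_linear slot_linear])
    show "(\<lambda>x. End_act sc gr n f \<sigma> (\<lambda>k. d (x k))) \<in> multilinear_maps sc n"
      by (rule multilinear_apply[OF am id_linear d_linear])
    fix x \<delta> assume x: "\<And>k. k \<in> {1..n} \<Longrightarrow> x k \<in> shift gr (\<delta> k)"
    have dx: "d (x k) \<in> gr (\<delta> k)" if "k \<in> {1..n}" for k
      using d_degree[of "x k" "\<delta> k - 1"] x[OF that] by (simp add: shift_def)
    have \<sigma>j: "\<sigma> j \<in> {1..n}" using permutes_in_image[OF \<sigma>] j by blast
    let ?s = "koszul_sign n \<sigma> {k \<in> {1..n}. odd (\<delta> k)}"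
    \<comment> \<open>\<open>dslot_act\<close> moves slot j to slot \<sigma> j of f, where the
      hypothesis applies. The sign survives because each d (x k) has the same degree in A as x k has
      in sA.\<close>
    have "dslot j (End_act sc gr n f \<sigma>) x = sc ?s (dslot (\<sigma> j) f (\<lambda>k. x (inv \<sigma> k)))"
      unfolding dslot_act[OF f \<sigma> j, symmetric]
      by (rule sh.End_act_homogeneous[OF dslot_multilinear[OF fm] \<sigma> x])
    then have "d (dslot j (End_act sc gr n f \<sigma>) x) = sc ?s (f (\<lambda>k. d (x (inv \<sigma> k))))"
      using df \<sigma>j by (simp add: derivative_closed_def linear_scale'[OF d_linear])
    also have "\<dots> = End_act sc gr n f \<sigma> (\<lambda>k. d (x k))"
      by (rule End_act_homogeneous[OF fm \<sigma> dx, symmetric])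
    finally show "d (dslot j (End_act sc gr n f \<sigma>) x) = End_act sc gr n f \<sigma> (\<lambda>k. d (x k))" .
  qed
  then show "\<forall>x. d (dslot j (End_act sc gr n f \<sigma>) x) = End_act sc gr n f \<sigma> (\<lambda>k. d (x k))"
    by (simp add: fun_eq_iff)
qed

end

section \<open>The morphism from a tensor product of operads to operations on sA\<close>

lemma vlinear_pointwise:
  "vlinear V (opsp (End0 sc gr) n) f \<Longrightarrow> x \<in> carr V \<Longrightarrow> f x \<in> End_hom sc gr n 0"
  "vlinear V (opsp (End0 sc gr) n) f \<Longrightarrow> x \<in> carr V \<Longrightarrow> y \<in> carr V \<Longrightarrow> f (vadd V x y) = (\<lambda>z. f x z + f y z)"
  "vlinear V (opsp (End0 sc gr) n) f \<Longrightarrow> x \<in> carr V \<Longrightarrow> f (vsmul V c x) = (\<lambda>z. sc c (f x z))"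
  by (simp_all add: vlinear_def End0_def)

context dg_algebra
begin

text \<open>
  \<open>\<pi>\<close> reads off the coordinates in \<open>\<P>erm(n)\<close>.  As \<open>derived (e\<^sup>n\<^sub>j \<otimes> g) = dslot j g\<close>, this is an operad
  morphism out of \<open>\<P>erm \<otimes> \<P>\<close>, of which the white product \<open>\<P>erm \<circ> \<P>\<close> only sees the part generated in
  arity 2.
\<close>

definition derived_map ::
  "('p \<Rightarrow> nat \<Rightarrow> 'k) \<Rightarrow> ('q \<Rightarrow> (nat \<Rightarrow> 'a) \<Rightarrow> 'a) \<Rightarrow> nat \<Rightarrow> ('p \<times> 'q) \<Rightarrow> (nat \<Rightarrow> 'a) \<Rightarrow> 'a" where
  "derived_map \<pi> \<beta> n pq x = (\<Sum>j=1..n. sc (\<pi> (fst pq) j) (dslot j (\<beta> (snd pq)) x))"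

definition derived_ext ::
  "(nat \<Rightarrow> 'p \<Rightarrow> nat \<Rightarrow> 'k) \<Rightarrow> (nat \<Rightarrow> 'q \<Rightarrow> (nat \<Rightarrow> 'a) \<Rightarrow> 'a) \<Rightarrow> nat \<Rightarrow> ('p \<times> 'q \<Rightarrow>\<^sub>0 'k) \<Rightarrow>
     (nat \<Rightarrow> 'a) \<Rightarrow> 'a" where
  "derived_ext \<pi> \<beta> n q x = pm_lift sc (\<lambda>pq. derived_map (\<pi> n) (\<beta> n) n pq x) q"

lemma derived_ext_linear: "Vector_Spaces.linear psc sc (\<lambda>q. derived_ext \<pi> \<beta> n q x)"
  unfolding derived_ext_def by (rule pm_lift_linear)

lemma derived_ext_single:
  "derived_ext \<pi> \<beta> n (Poly_Mapping.single pq c) = (\<lambda>x. sc c (derived_map (\<pi> n) (\<beta> n) n pq x))"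
  unfolding derived_ext_def pm_lift_single ..

lemma derived_ext_basis: "derived_ext \<pi> \<beta> n (basis pq) = derived_map (\<pi> n) (\<beta> n) n pq"
  unfolding derived_ext_single by simp

lemma End_hom_scaled_sum:
  assumes "\<And>a. a \<in> A \<Longrightarrow> f a \<in> End_hom sc (shift gr) n 0"
  shows "(\<lambda>x. \<Sum>a\<in>A. sc (c a) (f a x)) \<in> End_hom sc (shift gr) n 0"
proof (rule sh.End_homI)
  show "(\<lambda>x. \<Sum>a\<in>A. sc (c a) (f a x)) \<in> multilinear_maps sc n"
    by (rule multilinear_scaled_sum) (rule sh.End_hom_multilinear[OF assms])
  show "(\<Sum>a\<in>A. sc (c a) (f a x)) \<in> shift gr (0 + (\<Sum>j=1..n. \<delta> j))"
    if x: "\<And>j. j \<in> {1..n} \<Longrightarrow> x j \<in> shift gr (\<delta> j)" for x \<delta>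
  proof (intro subspace_sum subspace_scale sh.gr_subspace)
    fix a assume "a \<in> A"
    then show "f a x \<in> shift gr (0 + (\<Sum>j=1..n. \<delta> j))"
      using sh.End_hom_degree[OF assms x] by simp
  qed
qed

context
  fixes P :: "('k, 'p, 'y) operad_scheme" and Q :: "('k, 'q, 'z) operad_scheme" and \<pi> \<beta>
  assumes P: "linear_operad P" and Q: "linear_operad Q"
    and \<pi>: "operad_hom P perm_operad \<pi>" and \<beta>: "operad_hom Q (End0 sc gr) \<beta>"
    and closed: "\<And>n g. 1 \<le> n \<Longrightarrow> g \<in> carr (opsp Q n) \<Longrightarrow> derivative_closed n (\<beta> n g)"
begin

interpretation PQ: operad_pair P Q by (simp add: operad_pair_def P Q)

lemma \<beta>_hom: "1 \<le> n \<Longrightarrow> g \<in> carr (opsp Q n) \<Longrightarrow> \<beta> n g \<in> End_hom sc gr n 0"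
  by (rule vlinear_pointwise(1)[OF operad_homD(1)[OF \<beta>]])

lemma derived_map_hom:
  assumes "1 \<le> n" "snd pq \<in> carr (opsp Q n)"
  shows "derived_map (\<pi> n) (\<beta> n) n pq \<in> End_hom sc (shift gr) n 0"
  unfolding derived_map_def[abs_def]
  by (rule End_hom_scaled_sum) (rule dslot_hom[OF \<beta>_hom[OF assms]])

lemma dslot_add: "dslot j (\<lambda>z. f z + g z) x = dslot j f x + dslot j g x"
  and dslot_scale: "dslot j (\<lambda>z. sc c (f z)) x = sc c (dslot j f x)"
  by (simp_all add: dslot_def)

lemma derived_map_bilinear:
  assumes n: "1 \<le> n" and p: "p \<in> carr (opsp P n)" "p' \<in> carr (opsp P n)"
    and q: "q \<in> carr (opsp Q n)" "q' \<in> carr (opsp Q n)"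
  shows "derived_map (\<pi> n) (\<beta> n) n (vadd (opsp P n) p p', q) x =
      derived_map (\<pi> n) (\<beta> n) n (p, q) x + derived_map (\<pi> n) (\<beta> n) n (p', q) x"
    and "derived_map (\<pi> n) (\<beta> n) n (p, vadd (opsp Q n) q q') x =
      derived_map (\<pi> n) (\<beta> n) n (p, q) x + derived_map (\<pi> n) (\<beta> n) n (p, q') x"
    and "derived_map (\<pi> n) (\<beta> n) n (vsmul (opsp P n) c p, q) x = sc c (derived_map (\<pi> n) (\<beta> n) n (p, q) x)"
    and "derived_map (\<pi> n) (\<beta> n) n (p, vsmul (opsp Q n) c q) x = sc c (derived_map (\<pi> n) (\<beta> n) n (p, q) x)"
proof -
  have "\<pi> n (vadd (opsp P n) p p') = (\<lambda>j. \<pi> n p j + \<pi> n p' j)" "\<pi> n (vsmul (opsp P n) c p) = (\<lambda>j. c * \<pi> n p j)"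
    using vlinearD(2,3)[OF operad_homD(1)[OF \<pi> n]] p by (simp_all add: perm_operad_def)
  moreover have "\<beta> n (vadd (opsp Q n) q q') = (\<lambda>z. \<beta> n q z + \<beta> n q' z)" "\<beta> n (vsmul (opsp Q n) c q) = (\<lambda>z. sc c (\<beta> n q z))"
    using vlinear_pointwise(2,3)[OF operad_homD(1)[OF \<beta> n]] q by simp_all
  ultimately show "derived_map (\<pi> n) (\<beta> n) n (vadd (opsp P n) p p', q) x =
      derived_map (\<pi> n) (\<beta> n) n (p, q) x + derived_map (\<pi> n) (\<beta> n) n (p', q) x"
    and "derived_map (\<pi> n) (\<beta> n) n (p, vadd (opsp Q n) q q') x =
      derived_map (\<pi> n) (\<beta> n) n (p, q) x + derived_map (\<pi> n) (\<beta> n) n (p, q') x"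
    and "derived_map (\<pi> n) (\<beta> n) n (vsmul (opsp P n) c p, q) x = sc c (derived_map (\<pi> n) (\<beta> n) n (p, q) x)"
    and "derived_map (\<pi> n) (\<beta> n) n (p, vsmul (opsp Q n) c q) x = sc c (derived_map (\<pi> n) (\<beta> n) n (p, q) x)"
    by (simp_all add: derived_map_def dslot_add dslot_scale scale_left_distrib scale_right_distrib
        sum.distrib scale_sum_right mult.commute)
qed

lemma derived_ext_null:
  assumes n: "1 \<le> n" and t: "t \<in> tensor_null (opsp P n) (opsp Q n)"
  shows "derived_ext \<pi> \<beta> n t = (\<lambda>x. 0)"
proof
  fix x
  have "derived_ext \<pi> \<beta> n t x \<in> {0}"
  proof (rule linear_span_mem[OF derived_ext_linear subspace_single_0])
    show "t \<in> pm.span (bilinear_relators (opsp P n) (opsp Q n))"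
      using t n by (simp add: tensor_null_eq PQ.P.opsp_vspace PQ.Q.opsp_vspace)
    fix r assume "r \<in> bilinear_relators (opsp P n) (opsp Q n)"
    then show "derived_ext \<pi> \<beta> n r x \<in> {0}"
      by (cases rule: bilinear_relators_cases)
        (simp_all add: linear_diff'[OF derived_ext_linear] derived_ext_single derived_map_bilinear[OF n])
  qed
  then show "derived_ext \<pi> \<beta> n t x = 0" by simp
qed

text \<open>Both sides are bilinear in the coordinates, and on a pair of indices a, b the claim is
  \<open>dslot_comp\<close>.\<close>

lemma derived_map_comp:
  assumes h: "1 \<le> m" "1 \<le> n" "i \<in> {1..m}"
    and p: "p \<in> carr (opsp P m)" "p' \<in> carr (opsp P n)" and q: "q \<in> carr (opsp Q m)" "q' \<in> carr (opsp Q n)"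
  shows "derived_map (\<pi> (m + n - 1)) (\<beta> (m + n - 1)) (m + n - 1) (ocomp P m n i p p', ocomp Q m n i q q') =
    ocomp (End0 sc (shift gr)) m n i (derived_map (\<pi> m) (\<beta> m) m (p, q)) (derived_map (\<pi> n) (\<beta> n) n (p', q'))"
proof
  fix x :: "nat \<Rightarrow> 'a"
  let ?f = "\<beta> m q" and ?g = "\<beta> n q'" and ?c = "\<pi> m p" and ?e = "\<pi> n p'"
  let ?fg = "ocomp (End0 sc gr) m n i ?f ?g"
  let ?y = "\<lambda>v k. if k < i then x k else if k = i then v else x (k + n - 1)"
  let ?D = "\<lambda>b. dslot b ?g (\<lambda>j. x (j + i - 1))"
  have f: "?f \<in> End_hom sc gr m 0" and g: "?g \<in> End_hom sc gr n 0" using \<beta>_hom h q by auto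
  have "derived_map (\<pi> (m + n - 1)) (\<beta> (m + n - 1)) (m + n - 1) (ocomp P m n i p p', ocomp Q m n i q q') x =
    (\<Sum>j=1..m + n - 1. sc (\<Sum>a=1..m. \<Sum>b=1..n. if perm_index n i a b = j then ?c a * ?e b else 0) (dslot j ?fg x))"
    unfolding derived_map_def fst_conv snd_conv operad_homD(3)[OF \<pi> h p] operad_homD(3)[OF \<beta> h q]
    by (simp add: perm_operad_def)
  also have "\<dots> = (\<Sum>j=1..m + n - 1. \<Sum>a=1..m. \<Sum>b=1..n. if perm_index n i a b = j then sc (?c a * ?e b) (dslot j ?fg x) else 0)"
    unfolding scale_sum_left by (intro sum.cong refl) simp
  \<comment> \<open>With j summed innermost, the condition on the index selects the single term j =
    \<open>perm_index n i a b\<close>.\<close>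
  also have "\<dots> = (\<Sum>a=1..m. \<Sum>b=1..n. \<Sum>j=1..m + n - 1. if perm_index n i a b = j then sc (?c a * ?e b) (dslot j ?fg x) else 0)"
    unfolding sum.swap[of _ _ "{1..m + n - 1}"] ..
  also have "\<dots> = (\<Sum>a=1..m. \<Sum>b=1..n. sc (?c a * ?e b) (dslot (perm_index n i a b) ?fg x))"
  proof (intro sum.cong refl)
    fix a b assume "a \<in> {1..m}" "b \<in> {1..n}"
    then have "perm_index n i a b \<in> {1..m + n - 1}" by (rule perm_index_range[OF h(3)])
    then show "(\<Sum>j=1..m + n - 1. if perm_index n i a b = j then sc (?c a * ?e b) (dslot j ?fg x) else 0) =
        sc (?c a * ?e b) (dslot (perm_index n i a b) ?fg x)"
      by (subst sum.delta') simp_all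
  qed
  also have "\<dots> = (\<Sum>a=1..m. sc (?c a) (dslot a ?f (?y (\<Sum>b=1..n. sc (?e b) (?D b)))))"
  proof (rule sum.cong[OF refl])
    fix a assume a: "a \<in> {1..m}"
    \<comment> \<open>As an update of one fixed sequence, \<open>?y v\<close> shows the outer
      operation to be linear in argument i, so the sum over b moves inside.\<close>
    have y: "?y v = (?y 0)(i := v)" for v by auto
    have l: "Vector_Spaces.linear sc sc (\<lambda>v. dslot a ?f (?y v))"
      by (subst y) (rule multilinear_linear[OF dslot_multilinear[OF End_hom_multilinear[OF f]] h(3)])
    have "sc (?c a * ?e b) (dslot (perm_index n i a b) ?fg x) = sc (?c a) (sc (?e b) (dslot a ?f (?y (?D b))))"
      if b: "b \<in> {1..n}" for b
      unfolding dslot_comp[OF f g closed[OF h(2) q(2)] h(2,3) a b, symmetric] by (simp add: End0_def)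
    then have "(\<Sum>b=1..n. sc (?c a * ?e b) (dslot (perm_index n i a b) ?fg x)) =
       (\<Sum>b=1..n. sc (?c a) (sc (?e b) (dslot a ?f (?y (?D b)))))"
      by (rule sum.cong[OF refl])
    also have "\<dots> = sc (?c a) (dslot a ?f (?y (\<Sum>b=1..n. sc (?e b) (?D b))))"
      unfolding linear_sum'[OF l] linear_scale'[OF l] scale_sum_right ..
    finally show "(\<Sum>b=1..n. sc (?c a * ?e b) (dslot (perm_index n i a b) ?fg x)) =
       sc (?c a) (dslot a ?f (?y (\<Sum>b=1..n. sc (?e b) (?D b))))" .
  qed
  finally show "derived_map (\<pi> (m + n - 1)) (\<beta> (m + n - 1)) (m + n - 1) (ocomp P m n i p p', ocomp Q m n i q q') x =
    ocomp (End0 sc (shift gr)) m n i (derived_map (\<pi> m) (\<beta> m) m (p, q)) (derived_map (\<pi> n) (\<beta> n) n (p', q')) x"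
    by (simp add: End0_def derived_map_def cong: if_cong del: One_nat_def)
qed

lemma derived_map_act:
  assumes h: "1 \<le> n" "\<sigma> permutes {1..n}" and p: "p \<in> carr (opsp P n)" and q: "q \<in> carr (opsp Q n)"
  shows "derived_map (\<pi> n) (\<beta> n) n (oact P n p \<sigma>, oact Q n q \<sigma>) =
    End_act sc (shift gr) n (derived_map (\<pi> n) (\<beta> n) n (p, q)) \<sigma>"
proof
  fix x :: "nat \<Rightarrow> 'a"
  let ?f = "\<beta> n q" and ?c = "\<pi> n p"
  have f: "?f \<in> End_hom sc gr n 0" using \<beta>_hom h q by auto
  have "\<beta> n (oact Q n q \<sigma>) = End_act sc gr n ?f \<sigma>" "\<pi> n (oact P n p \<sigma>) = (\<lambda>j. ?c (\<sigma> j))"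
    using operad_homD(4)[OF \<beta> h q] operad_homD(4)[OF \<pi> h p] by (simp_all add: End0_def perm_operad_def)
  then have "derived_map (\<pi> n) (\<beta> n) n (oact P n p \<sigma>, oact Q n q \<sigma>) x =
      (\<Sum>j=1..n. sc (?c (\<sigma> j)) (dslot j (End_act sc gr n ?f \<sigma>) x))"
    by (simp add: derived_map_def)
  also have "\<dots> = (\<Sum>j=1..n. sc (?c (\<sigma> j)) (End_act sc (shift gr) n (dslot (\<sigma> j) ?f) \<sigma> x))"
    by (intro sum.cong refl) (simp add: dslot_act[OF f h(2)])
  \<comment> \<open>Reindexing along \<sigma> removes the shift that the action on coordinates and
    the slots have in common.\<close>
  also have "\<dots> = (\<Sum>j=1..n. sc (?c j) (End_act sc (shift gr) n (dslot j ?f) \<sigma> x))"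
    using sum.permute[OF h(2), of "\<lambda>j. sc (?c j) (End_act sc (shift gr) n (dslot j ?f) \<sigma> x)"] by (simp add: o_def)
  also have "\<dots> = End_act sc (shift gr) n (derived_map (\<pi> n) (\<beta> n) n (p, q)) \<sigma> x"
    unfolding End_act_def derived_map_def fst_conv snd_conv scale_sum_right
    by (subst sum.swap) (simp add: mult.commute)
  finally show "derived_map (\<pi> n) (\<beta> n) n (oact P n p \<sigma>, oact Q n q \<sigma>) x =
    End_act sc (shift gr) n (derived_map (\<pi> n) (\<beta> n) n (p, q)) \<sigma> x" .
qed

lemma derived_ext_hom: "operad_hom (pair_operad P Q) (End0 sc (shift gr)) (derived_ext \<pi> \<beta>)"
proof (rule PQ.pair.homI)
  show "linear_operad (End0 sc (shift gr))" by (rule sh.End0_linear_operad)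
  show "vlinear (free_vs (carr (opsp P n) \<times> carr (opsp Q n))) (opsp (End0 sc (shift gr)) n) (derived_ext \<pi> \<beta> n)"
    if n: "1 \<le> n" for n
  proof -
    have "derived_ext \<pi> \<beta> n t \<in> End_hom sc (shift gr) n 0"
      if "Poly_Mapping.keys t \<subseteq> carr (opsp P n) \<times> carr (opsp Q n)" for t
      unfolding derived_ext_def[abs_def] pm_lift_def
      by (rule End_hom_scaled_sum, rule derived_map_hom[OF n]) (use that in auto)
    then show ?thesis
      by (simp add: vlinear_def End0_def fun_eq_iff linear_add'[OF derived_ext_linear] linear_psc[OF derived_ext_linear])
  qed
  have "\<pi> 1 (ounit P) = (\<lambda>j. if j = 1 then 1 else 0)" "\<beta> 1 (ounit Q) = (\<lambda>x. x 1)"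
    using operad_homD(2)[OF \<pi>] operad_homD(2)[OF \<beta>] by (simp_all add: perm_operad_def End0_def)
  then show "derived_ext \<pi> \<beta> 1 (basis (ounit P, ounit Q)) = ounit (End0 sc (shift gr))"
    by (simp add: derived_ext_basis derived_map_def dslot_def slot_def End0_def fun_eq_iff)
next
  fix m n i u w assume h: "1 \<le> m" "1 \<le> n" "i \<in> {1..m}"
    and u: "u \<in> carr (opsp P m) \<times> carr (opsp Q m)" and w: "w \<in> carr (opsp P n) \<times> carr (opsp Q n)"
  obtain p q p' q' where e: "u = (p, q)" "w = (p', q')" by (metis surj_pair)
  show "derived_ext \<pi> \<beta> (m + n - 1) (basis ((case u of (f, f') \<Rightarrow> \<lambda>(g, g'). (ocomp P m n i f g, ocomp Q m n i f' g')) w)) =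
    ocomp (End0 sc (shift gr)) m n i (derived_ext \<pi> \<beta> m (basis u)) (derived_ext \<pi> \<beta> n (basis w))"
    unfolding derived_ext_basis e prod.case by (rule derived_map_comp[OF h]) (use u w e in auto)
next
  fix n \<sigma> u assume h: "1 \<le> n" "\<sigma> permutes {1..n}" and u: "u \<in> carr (opsp P n) \<times> carr (opsp Q n)"
  obtain p q where e: "u = (p, q)" by (metis surj_pair)
  have "oact (End0 sc (shift gr)) n f \<sigma> = End_act sc (shift gr) n f \<sigma>" for f by (simp add: End0_def)
  then show "derived_ext \<pi> \<beta> n (basis (case u of (f, f') \<Rightarrow> (oact P n f \<sigma>, oact Q n f' \<sigma>))) =
    oact (End0 sc (shift gr)) n (derived_ext \<pi> \<beta> n (basis u)) \<sigma>"
    unfolding derived_ext_basis e prod.case using derived_map_act[OF h] u e by simp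
qed

definition derived_hom where "derived_hom n X = derived_ext \<pi> \<beta> n (rep X)"

lemma derived_hom: "operad_hom (tensor_operad P Q) (End0 sc (shift gr)) derived_hom"
proof -
  have "derived_ext \<pi> \<beta> n t = vzero (opsp (End0 sc (shift gr)) n)"
    if "1 \<le> n" "t \<in> tensor_null (opsp P n) (opsp Q n)" for n t
    using derived_ext_null[OF that] by (simp add: End0_def)
  from PQ.tensor.lift_hom[OF derived_ext_hom sh.End0_linear_operad this]
  show ?thesis by (simp add: derived_hom_def[abs_def])
qed

lemma derived_hom_tens:
  assumes "1 \<le> n" "p \<in> carr (opsp P n)" "q \<in> carr (opsp Q n)"
  shows "derived_hom n (tens (opsp P n) (opsp Q n) p q) = derived_map (\<pi> n) (\<beta> n) n (p, q)"
proof -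
  have z: "derived_ext \<pi> \<beta> n t = vzero (opsp (End0 sc (shift gr)) n)"
    if "1 \<le> n" "t \<in> tensor_null (opsp P n) (opsp Q n)" for n t
    using derived_ext_null[OF that] by (simp add: End0_def)
  have "derived_hom n (tens (opsp P n) (opsp Q n) p q) = derived_ext \<pi> \<beta> n (basis (p, q))"
    using PQ.tensor.lift_hom_coset[OF derived_ext_hom sh.End0_linear_operad z assms(1), of "basis (p, q)"] assms
    by (simp add: derived_hom_def tens_def)
  then show ?thesis by (simp add: derived_ext_basis)
qed

end

end

section \<open>The algebra over the white product\<close>

context dg_algebra
begin

abbreviation "F \<equiv> free_operad E"
abbreviation "relation_ideal \<equiv> gen_ideal F 3 R"

lemma R_carr: "R \<subseteq> carr (opsp F 3)"
  using relations by (simp add: quadratic_relations_def vsubspace_def)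

sublocale BQ: operad_quotient F relation_ideal
  rewrites "quot_operad F relation_ideal = bq_operad E R"
  by (simp_all add: operad_quotient_def operad_quotient_axioms_def free.quot_linear_operad
      gen_ideal_ideal[OF free.quot_linear_operad R_carr] bq_operad_def)

text \<open>The structure of A pulled back to the free operad, which is the second factor of the
  target of \<Phi> and admits induction over trees.\<close>

definition action :: "nat \<Rightarrow> ('e btree \<Rightarrow>\<^sub>0 'k) set \<Rightarrow> (nat \<Rightarrow> 'a) \<Rightarrow> 'a" where
  "action n g = \<alpha> n (vcoset (opsp F n) (relation_ideal n) g)"

lemma \<alpha>_hom: "operad_hom (bq_operad E R) (End0 sc gr) \<alpha>"
  using algebra by (simp add: graded_algebra_iff)

lemma action_hom: "operad_hom F (End0 sc gr) action"
  using operad_hom_compose[OF BQ.coset_hom \<alpha>_hom] by (simp add: action_def[abs_def])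

lemma action_closed: "1 \<le> n \<Longrightarrow> g \<in> carr (opsp F n) \<Longrightarrow> action n g \<in> End_hom sc gr n 0"
  by (rule vlinear_pointwise(1)[OF operad_homD(1)[OF action_hom]])

lemma action_relation:
  assumes "r \<in> R"
  shows "action 3 r = (\<lambda>x. 0)"
proof -
  have n: "(1::nat) \<le> 3" by simp
  have "r \<in> relation_ideal 3" by (rule subsetD[OF gen_ideal_superset assms])
  then have "vcoset (opsp F 3) (relation_ideal 3) r = vzero (opsp (bq_operad E R) 3)"
    using vsub.coset_zero[OF BQ.vsub[OF n]] by (simp add: BQ.quot_opsp vquot_def)
  then show ?thesis
    using vlinear_zero[OF operad_homD(1)[OF \<alpha>_hom n] linear_operad.opsp_vspace[OF BQ.quot_linear_operad n]
        linear_operad.opsp_vspace[OF End0_linear_operad n]]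
    by (simp add: action_def End0_def)
qed

lemma corolla_tree: "e \<in> carr E \<Longrightarrow> Nd e (Lf 1) (Lf 2) \<in> trees E 2"
  unfolding trees_def by auto

lemma free_gen_closed: "e \<in> carr E \<Longrightarrow> free_gen E e \<in> carr (opsp F 2)"
  unfolding free_gen_def by (rule free_class_closed[OF _ corolla_tree]) simp_all

lemma bracket_eq: "bracket E R \<alpha> e x y = action 2 (free_gen E e) (\<lambda>j. if j = 1 then x else y)"
  by (simp add: bracket_def action_def bq_gen_def)

lemma action_gen:
  assumes "e \<in> carr E"
  shows "action 2 (free_gen E e) x = bracket E R \<alpha> e (x 1) (x 2)"
  unfolding bracket_eq
proof (rule multilinear_cong[OF End_hom_multilinear[OF action_closed[OF _ free_gen_closed[OF assms]]]])
  show "\<forall>j\<in>{1..2}. x j = (if j = 1 then x 1 else x 2)" by (auto simp: le_Suc_eq numeral_2_eq_2)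
qed simp

lemma bracket_linear:
  assumes e: "e \<in> carr E"
  shows "Vector_Spaces.linear sc sc (\<lambda>x. bracket E R \<alpha> e x y)" "Vector_Spaces.linear sc sc (\<lambda>y. bracket E R \<alpha> e x y)"
proof -
  have m: "action 2 (free_gen E e) \<in> multilinear_maps sc 2"
    by (rule End_hom_multilinear[OF action_closed[OF _ free_gen_closed[OF e]]]) simp
  have "bracket E R \<alpha> e x y = action 2 (free_gen E e) ((\<lambda>j. if j = 1 then 0 else y)(1 := x))" for x y
    unfolding action_gen[OF e] by simp
  then show "Vector_Spaces.linear sc sc (\<lambda>x. bracket E R \<alpha> e x y)"
    using multilinear_linear[OF m, of 1 "\<lambda>j. if j = 1 then 0 else y"] by simp
  have "bracket E R \<alpha> e x y = action 2 (free_gen E e) ((\<lambda>j. x)(2 := y))" for x y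
    unfolding action_gen[OF e] by simp
  then show "Vector_Spaces.linear sc sc (\<lambda>y. bracket E R \<alpha> e x y)"
    using multilinear_linear[OF m, of 2 "\<lambda>j. x"] by simp
qed

text \<open>The parity involution replaces the sign, so the rule extends linearly from homogeneous x
  to all x.\<close>

lemma bracket_derivation:
  assumes e: "e \<in> carr E"
  shows "d (bracket E R \<alpha> e x y) = bracket E R \<alpha> e (d x) y + bracket E R \<alpha> e (par x) (d y)"
proof (rule linear_eq_homogeneous[where f = "\<lambda>x. d (bracket E R \<alpha> e x y)" and
      h = "\<lambda>x. bracket E R \<alpha> e (d x) y + bracket E R \<alpha> e (par x) (d y)"])
  show "Vector_Spaces.linear sc sc (\<lambda>x. d (bracket E R \<alpha> e x y))"
    by (rule linear_compose'[OF bracket_linear(1)[OF e] d_linear])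
  have "Vector_Spaces.linear sc sc (\<lambda>x. bracket E R \<alpha> e (d x) y)"
    "Vector_Spaces.linear sc sc (\<lambda>x. bracket E R \<alpha> e (par x) (d y))"
    by (rule linear_compose'[OF d_linear bracket_linear(1)[OF e]] linear_compose'[OF parity_inv_linear bracket_linear(1)[OF e]])+
  then show "Vector_Spaces.linear sc sc (\<lambda>x. bracket E R \<alpha> e (d x) y + bracket E R \<alpha> e (par x) (d y))"
    unfolding Vector_Spaces.linear_iff by (simp add: scale_right_distrib)
  fix g v assume "v \<in> gr g"
  then show "d (bracket E R \<alpha> e v y) = bracket E R \<alpha> e (d v) y + bracket E R \<alpha> e (par v) (d y)"
    using d_derivation[OF e] by (simp add: parity_inv_homogeneous linear_scale'[OF bracket_linear(1)[OF e]])
qed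

lemma derivative_closed_unit: "derivative_closed 1 (\<lambda>x. x 1)"
  by (auto simp: derivative_closed_def dslot_def slot_def)

lemma derivative_closed_gen:
  assumes e: "e \<in> carr E"
  shows "derivative_closed 2 (action 2 (free_gen E e))"
  unfolding derivative_closed_def
proof (intro ballI allI)
  fix j x assume "j \<in> {1..2::nat}"
  then consider "j = 1" | "j = 2" by fastforce
  then show "d (dslot j (action 2 (free_gen E e)) x) = action 2 (free_gen E e) (\<lambda>k. d (x k))"
  proof cases
    case 1
    then show ?thesis
      using linear_zero'[OF bracket_linear(2)[OF e]]
      by (simp add: dslot_def action_gen[OF e] slot_def bracket_derivation[OF e] d_square)
  next
    \<comment> \<open>The first argument is par (d x), on which d vanishes. The sign of the
      derivation rule adds a second parity, and the two cancel.\<close>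
    case 2
    then show ?thesis
      using linear_zero'[OF bracket_linear(1)[OF e]]
      by (simp add: dslot_def action_gen[OF e] slot_def bracket_derivation[OF e] d_par_d parity_inv_involution)
  qed
qed

lemma derivative_closed_lincomb:
  assumes "derivative_closed n f" "derivative_closed n g"
  shows "derivative_closed n (\<lambda>x. f x + sc c (g x))"
  using assms unfolding derivative_closed_def
  by (simp add: dslot_def linear_add'[OF d_linear] linear_scale'[OF d_linear])

text \<open>Tree monomials are covered by \<open>trees_induct\<close>; the condition is linear in
  the operation, which gives all classes.\<close>

lemma derivative_closed_action:
  assumes n: "1 \<le> n" and g: "g \<in> carr (opsp F n)"
  shows "derivative_closed n (action n g)"
proof -
  have tree: "derivative_closed n (action n (free_class E n (basis t)))" if "t \<in> trees E n" for n t
    using that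
  proof (induction rule: trees_induct)
    case unit
    then show ?case
      using derivative_closed_unit operad_homD(2)[OF action_hom] by (simp add: free_class_unit End0_def)
  next
    case (corolla e)
    then show ?case using derivative_closed_gen by (simp add: free_gen_def)
  next
    case (comp m n i S T)
    note c = free_class_closed[OF comp(1,4)] free_class_closed[OF comp(2,5)]
    show ?case
      unfolding free_class_comp[OF comp(1-5), symmetric] operad_homD(3)[OF action_hom comp(1-3) c]
      by (rule derivative_closed_comp[OF action_closed[OF comp(1) c(1)] action_closed[OF comp(2) c(2)] comp(6,7,2,3)])
  next
    case (act n \<sigma> t)
    note c = free_class_closed[OF act(1,3)]
    have "action n (free_class E n (basis (graft (\<lambda>k. Lf (inv \<sigma> k)) t))) = End_act sc gr n (action n (free_class E n (basis t))) \<sigma>"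
      unfolding free_class_act[OF act(1-3), symmetric] operad_homD(4)[OF action_hom act(1,2) c] by (simp add: End0_def)
    then show ?case using derivative_closed_act[OF action_closed[OF act(1) c] act(2,4)] by simp
  qed
  have "vlinear (free_vs (trees E n)) (opsp (End0 sc gr) n) (\<lambda>p. action n (free_class E n p))"
    by (rule vlinear_compose[OF free_class_linear[OF n] operad_homD(1)[OF action_hom n]])
  note lin = vlinear_pointwise[OF this]
  obtain p where p: "Poly_Mapping.keys p \<subseteq> trees E n" "g = free_class E n p"
    using free.quot_carrE[OF n g] by (auto simp: free_class_def)
  have "derivative_closed n (action n (free_class E n p))"
    using p(1)
  proof (induction p rule: pm_induct)
    case zero
    have "action n (free_class E n 0) = (\<lambda>x. 0)" using lin(3)[of 0 0] by simp
    then show ?case by (simp add: derivative_closed_def dslot_def d_zero)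
  next
    case (add p b t)
    have "Poly_Mapping.keys (psc b (basis t)) \<subseteq> trees E n" using add by simp
    then have "action n (free_class E n (p + psc b (basis t))) =
       (\<lambda>x. action n (free_class E n p) x + sc b (action n (free_class E n (basis t)) x))"
      using lin(2)[of p "psc b (basis t)"] lin(3)[of "basis t" b] add by simp
    then show ?case using derivative_closed_lincomb[OF add(3) tree[OF add(2)]] by simp
  qed
  then show ?thesis using p by simp
qed

abbreviation "EP \<equiv> perm_E :: ('k, nat \<Rightarrow>\<^sub>0 'k) s2mod"
abbreviation "ET \<equiv> s2_tensor EP E"
abbreviation "WR \<equiv> white_relations EP perm_R E R"

sublocale PE: s2_pair EP E
  by (simp add: s2_pair_def perm_E_module s2_module_axioms)

definition derived_struct :: "nat \<Rightarrow> (((nat \<Rightarrow>\<^sub>0 'k) \<times> 'e \<Rightarrow>\<^sub>0 'k) set btree \<Rightarrow>\<^sub>0 'k) set \<Rightarrow> (nat \<Rightarrow> 'a) \<Rightarrow> 'a" where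
  "derived_struct n X = derived_hom perm_proj action n (manin_map EP E n X)"

lemmas tensor_assms = free.quot_linear_operad[of EP] free.quot_linear_operad[of E] perm_proj_hom action_hom
  derivative_closed_action

lemma derived_hom_struct: "operad_hom (tensor_operad (free_operad EP) F) (End0 sc (shift gr)) (derived_hom perm_proj action)"
  by (rule derived_hom[OF tensor_assms])

lemma derived_struct_hom: "operad_hom (free_operad ET) (End0 sc (shift gr)) derived_struct"
  using operad_hom_compose[OF PE.manin_map_hom derived_hom_struct] by (simp add: derived_struct_def[abs_def])

text \<open>The span in \<open>white_relations\<close> is generated by tensors of two kinds. One has
  zero coordinates in Perm, the other a zero action on A, so \<open>derived_map\<close> vanishes on
  both, and the kernel of \<open>derived_hom\<close> contains the span.\<close>

lemma derived_struct_relations: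
  assumes x: "x \<in> WR"
  shows "x \<in> carr (opsp (free_operad ET) 3)" "derived_struct 3 x = (\<lambda>x. 0)"
proof -
  let ?F1 = "opsp (free_operad EP) 3" and ?F2 = "opsp F 3"
  let ?K = "{y \<in> carr (vtensor ?F1 ?F2). derived_hom perm_proj action 3 y = vzero (opsp (End0 sc (shift gr)) 3)}"
  have n: "(1::nat) \<le> 3" by simp
  have V: "vspace ?F1" "vspace ?F2" by (rule vspace_free_operad[OF n])+
  have z: "vzero (opsp (End0 sc (shift gr)) 3) = (\<lambda>x. 0)" by (simp add: End0_def)
  have K: "vsubspace (vtensor ?F1 ?F2) ?K"
    using kernel_subspace[OF operad_homD(1)[OF derived_hom_struct n] _ linear_operad.opsp_vspace[OF sh.End0_linear_operad n]]
      vtensor_vspace[OF V] by (simp add: PE.F.opsp_tensor)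
  have t: "tens ?F1 ?F2 p q \<in> ?K"
    if "p \<in> carr ?F1" "q \<in> carr ?F2" "perm_proj 3 p = (\<lambda>j. 0) \<or> action 3 q = (\<lambda>x. 0)" for p q
  proof -
    have "derived_map (perm_proj 3) (action 3) 3 (p, q) = (\<lambda>x. 0)"
      using that(3) by (auto simp: derived_map_def dslot_def fun_eq_iff)
    then have "derived_hom perm_proj action 3 (tens ?F1 ?F2 p q) = (\<lambda>x. 0)"
      by (subst derived_hom_tens[OF tensor_assms n that(1,2)]) simp_all
    moreover have "tens ?F1 ?F2 p q \<in> carr (vtensor ?F1 ?F2)"
      using that(1,2) by (simp add: tens_def vtensor_def vquot_def)
    ultimately show ?thesis by (simp add: z)
  qed
  have "vspan (vtensor ?F1 ?F2) ({tens ?F1 ?F2 r f | r f. r \<in> perm_R \<and> f \<in> carr ?F2} \<union>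
               {tens ?F1 ?F2 f r | f r. f \<in> carr ?F1 \<and> r \<in> R}) \<subseteq> ?K"
  proof (rule vspan_minimal[OF K], rule Un_least)
    show "{tens ?F1 ?F2 r f | r f. r \<in> perm_R \<and> f \<in> carr ?F2} \<subseteq> ?K"
      using t perm_proj_R by blast
    show "{tens ?F1 ?F2 f r | f r. f \<in> carr ?F1 \<and> r \<in> R} \<subseteq> ?K"
      using t action_relation R_carr by blast
  qed
  note K' = subsetD[OF this]
  note x' = CollectD[OF x[unfolded white_relations_def Let_def]]
  have "manin_map EP E 3 x \<in> ?K" by (rule K'[OF conjunct2[OF x']])
  with conjunct1[OF x'] show "x \<in> carr (opsp (free_operad ET) 3)" "derived_struct 3 x = (\<lambda>x. 0)"
    by (simp_all add: derived_struct_def z)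
qed

lemma derived_struct_ideal:
  assumes "1 \<le> n" "x \<in> gen_ideal (free_operad ET) 3 WR n"
  shows "derived_struct n x = vzero (opsp (End0 sc (shift gr)) n)"
proof -
  let ?K = "\<lambda>n. {x \<in> carr (opsp (free_operad ET) n). derived_struct n x = vzero (opsp (End0 sc (shift gr)) n)}"
  have "operadic_ideal (free_operad ET) ?K"
    by (rule kernel_ideal[OF derived_struct_hom free.quot_linear_operad sh.End0_linear_operad])
  moreover have "WR \<subseteq> ?K 3" using derived_struct_relations by (auto simp: End0_def)
  ultimately have "gen_ideal (free_operad ET) 3 WR n \<subseteq> ?K n" by (rule gen_ideal_minimal)
  then show ?thesis using assms(2) by blast
qed

sublocale WQ: operad_quotient "free_operad ET" "gen_ideal (free_operad ET) 3 WR"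
  rewrites "quot_operad (free_operad ET) (gen_ideal (free_operad ET) 3 WR) = white_product EP perm_R E R"
proof -
  have "WR \<subseteq> carr (opsp (free_operad ET) 3)" using derived_struct_relations(1) by blast
  from gen_ideal_ideal[OF free.quot_linear_operad this]
  show "operad_quotient (free_operad ET) (gen_ideal (free_operad ET) 3 WR)"
    by (simp add: operad_quotient_def operad_quotient_axioms_def free.quot_linear_operad)
qed (simp add: white_product_def bq_operad_def)

definition white_struct where "white_struct n X = derived_struct n (rep X)"

lemma white_struct_hom: "operad_hom (white_product EP perm_R E R) (End0 sc (shift gr)) white_struct"
  using WQ.lift_hom[OF derived_struct_hom sh.End0_linear_operad derived_struct_ideal]
  by (simp add: white_struct_def[abs_def])

lemma white_struct_gen:
  assumes j: "j \<in> {1, 2}" and e: "e \<in> carr E"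
  shows "white_struct 2 (white_gen EP perm_R E R (perm_e j) e) = dslot j (action 2 (free_gen E e))"
proof -
  have n: "(1::nat) \<le> 2" by simp
  have pe: "perm_e j \<in> carr EP" using j by (auto simp: perm_e_def)
  have t: "tens EP E (perm_e j) e \<in> carr ET" by (rule PE.ET_tens[OF pe e])
  have p: "free_gen EP (perm_e j) \<in> carr (opsp (free_operad EP) 2)"
    unfolding free_gen_def by (rule free_class_closed[OF n]) (use pe in \<open>auto simp: trees_def\<close>)
  have g: "free_gen ET (tens EP E (perm_e j) e) \<in> carr (opsp (free_operad ET) 2)"
    unfolding free_gen_def by (rule free_class_closed[OF n]) (use t in \<open>auto simp: trees_def\<close>)
  have "white_struct 2 (white_gen EP perm_R E R (perm_e j) e) = derived_struct 2 (free_gen ET (tens EP E (perm_e j) e))"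
    unfolding white_struct_def white_gen_def bq_gen_def
    by (rule WQ.lift_hom_coset[OF derived_struct_hom sh.End0_linear_operad derived_struct_ideal n g])
  also have "\<dots> = derived_map (perm_proj 2) (action 2) 2 (free_gen EP (perm_e j), free_gen E e)"
    unfolding derived_struct_def PE.manin_map_gen[OF pe e]
    by (rule derived_hom_tens[OF tensor_assms n p free_gen_closed[OF e]])
  also have "\<dots> = dslot j (action 2 (free_gen E e))"
  proof
    fix x
    have "j \<in> {1..2}" using j by auto
    then show "derived_map (perm_proj 2) (action 2) 2 (free_gen EP (perm_e j), free_gen E e) x = dslot j (action 2 (free_gen E e)) x"
      unfolding derived_map_def fst_conv snd_conv perm_proj_gen[OF j]
      by (simp add: if_distrib[of "\<lambda>c. sc c _"] cong: if_cong)
  qed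
  finally show ?thesis .
qed

text \<open>In \<open>slot\<close> the parity stands outside d. Moving it inside, past the odd d,
  produces the minus sign of the bracket.\<close>

lemma derived_lower_eq:
  assumes e: "e \<in> carr E"
  shows "dslot 2 (action 2 (free_gen E e)) = derived_lower E R gr \<alpha> d e"
  by (rule ext) (simp add: dslot_def action_gen[OF e] slot_def derived_lower_def d_par linear_neg'[OF bracket_linear(1)[OF e]])

lemma derived_upper_eq:
  assumes e: "e \<in> carr E"
  shows "dslot 1 (action 2 (free_gen E e)) = derived_upper E R \<alpha> d e"
  by (rule ext) (simp add: dslot_def action_gen[OF e] slot_def derived_upper_def)

end

theorem theorem3p2:
  fixes E :: "('k::field_char_0, 'e) s2mod"
    and R :: "('e btree \<Rightarrow>\<^sub>0 'k) set set"
    and sc :: "'k \<Rightarrow> 'a::ab_group_add \<Rightarrow> 'a"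
    and gr :: "'g::ring_parity \<Rightarrow> 'a set"
    and \<alpha> :: "nat \<Rightarrow> ('e btree \<Rightarrow>\<^sub>0 'k) set set \<Rightarrow> (nat \<Rightarrow> 'a) \<Rightarrow> 'a"
    and d :: "'a \<Rightarrow> 'a"
  assumes "dg_algebra E R sc gr \<alpha> d"
  shows "\<exists>\<psi>. graded_algebra (white_product perm_E perm_R E R) sc (shift gr) \<psi> \<and>
    (\<forall>e\<in>carr E.
       \<psi> 2 (white_gen perm_E perm_R E R (perm_e 2) e) = derived_lower E R gr \<alpha> d e \<and>
       \<psi> 2 (white_gen perm_E perm_R E R (perm_e 1) e) = derived_upper E R \<alpha> d e)"
proof -
  interpret dg_algebra E R sc gr \<alpha> d by fact
  have "graded_algebra (white_product perm_E perm_R E R) sc (shift gr) white_struct"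
    unfolding sh.graded_algebra_iff by (rule white_struct_hom)
  moreover have "white_struct 2 (white_gen perm_E perm_R E R (perm_e 2) e) = derived_lower E R gr \<alpha> d e \<and>
       white_struct 2 (white_gen perm_E perm_R E R (perm_e 1) e) = derived_upper E R \<alpha> d e"
    if "e \<in> carr E" for e
    using white_struct_gen[of 2 e] white_struct_gen[of 1 e] that derived_lower_eq derived_upper_eq by simp
  ultimately show ?thesis by blast
qed

end
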